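(* Let $A$ be a finite-dimensional algebra over a field $k$, and let $M$ be an $A$-module of dimension $d=\dim_k M$. Then the number $\mathrm{b}_A(M)$ of brick chain filtrations of $M$ satisfies \[ \mathrm{b}_A(M)\leq 2^{d^2}. \]
   Context: Algebras are associative and unital; modules are finite-dimensional right modules. A brick is a module whose endomorphism ring is a division ring. For a brick $B$, $\mathsf{Filt}\,B$ is the class of modules admitting a finite filtration by submodules all of whose successive factors are isomorphic to $B$; it contains the zero module (empty filtration). A brick chain filtration of a module $M$ is a chain of submodules $0=M_0\subsetneq M_1\subsetneq\cdots\subsetneq M_t=M$ for which there exist bricks $B_1,\ldots,B_t$ such that $M_i/M_{i-1}\in\mathsf{Filt}\,B_i$ for all $1\le i\le t$ and $\operatorname{Hom}_A(B_i,B_j)=0$ for all $i<j$. $\mathrm{b}_A(M)$ denotes the number of chains $(M_i)_{i=0}^t$ of submodules of $M$ (of any length $t$) that are brick chain filtrations of $M$; actual chains of submodules are counted. By convention $\mathrm{b}_A(0)=1$ (the empty chain, $t=0$). *)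

theory Defs
  imports
    "HOL-Algebra.AbelCoset"
    "Jordan_Normal_Form.Missing_VectorSpace"
begin

locale algebra_over_field = vectorspace K A + R?: ring A for K and A (structure) +
  assumes smult_mult_left:
    "\<lbrakk>c \<in> carrier K; x \<in> carrier A; y \<in> carrier A\<rbrakk>
      \<Longrightarrow> (c \<odot>\<^bsub>A\<^esub> x) \<otimes> y = c \<odot>\<^bsub>A\<^esub> (x \<otimes> y)"
    and smult_mult_right:
    "\<lbrakk>c \<in> carrier K; x \<in> carrier A; y \<in> carrier A\<rbrakk>
      \<Longrightarrow> x \<otimes> (c \<odot>\<^bsub>A\<^esub> y) = c \<odot>\<^bsub>A\<^esub> (x \<otimes> y)"

locale fin_dim_algebra = algebra_over_field +
  assumes fin_dim_algebra: "fin_dim"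

text \<open>
  The library's module locale requires a commutative base ring, but its record type fits right
  modules over arbitrary rings: for a right module \<open>M\<close>, the term \<open>a \<odot>\<^bsub>M\<^esub> x\<close> stands for the right
  action \<open>x \<cdot> a\<close>, so that \<open>x \<cdot> (a b) = (x \<cdot> a) \<cdot> b\<close> becomes \<open>right_smult_assoc\<close> below. The
  multiplicative components of the record are irrelevant for modules. The library's predicate
  \<open>Module.submodule\<close> and function \<open>module_hom\<close> do not mention commutativity and are used as they
  stand.
\<close>

locale right_module = R?: ring A + M?: abelian_group M
  for A :: "('a, 'r) ring_scheme" (structure) and M :: "('a, 'm) module" +
  assumes right_smult_closed:
    "\<lbrakk>a \<in> carrier A; x \<in> carrier M\<rbrakk> \<Longrightarrow> a \<odot>\<^bsub>M\<^esub> x \<in> carrier M"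
    and right_smult_add_ring:
    "\<lbrakk>a \<in> carrier A; b \<in> carrier A; x \<in> carrier M\<rbrakk>
      \<Longrightarrow> (a \<oplus> b) \<odot>\<^bsub>M\<^esub> x = (a \<odot>\<^bsub>M\<^esub> x) \<oplus>\<^bsub>M\<^esub> (b \<odot>\<^bsub>M\<^esub> x)"
    and right_smult_add_module:
    "\<lbrakk>a \<in> carrier A; x \<in> carrier M; y \<in> carrier M\<rbrakk>
      \<Longrightarrow> a \<odot>\<^bsub>M\<^esub> (x \<oplus>\<^bsub>M\<^esub> y) = (a \<odot>\<^bsub>M\<^esub> x) \<oplus>\<^bsub>M\<^esub> (a \<odot>\<^bsub>M\<^esub> y)"
    and right_smult_assoc:
    "\<lbrakk>a \<in> carrier A; b \<in> carrier A; x \<in> carrier M\<rbrakk>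
      \<Longrightarrow> (a \<otimes> b) \<odot>\<^bsub>M\<^esub> x = b \<odot>\<^bsub>M\<^esub> (a \<odot>\<^bsub>M\<^esub> x)"
    and right_smult_one:
    "x \<in> carrier M \<Longrightarrow> \<one> \<odot>\<^bsub>M\<^esub> x = x"

definition underlying_space ::
    "('k, 'p) ring_scheme \<Rightarrow> ('k, 'a, 'q) module_scheme \<Rightarrow> ('a, 'm) module \<Rightarrow> ('k, 'm) module" where
  "underlying_space K A M =
    \<lparr>carrier = carrier M, mult = mult M, one = one M, zero = zero M, add = add M,
     smult = (\<lambda>c x. (c \<odot>\<^bsub>A\<^esub> \<one>\<^bsub>A\<^esub>) \<odot>\<^bsub>M\<^esub> x)\<rparr>"

definition fin_dim_right_module ::
    "('k, 'p) ring_scheme \<Rightarrow> ('k, 'a, 'q) module_scheme \<Rightarrow> ('a, 'm) module \<Rightarrow> bool" where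
  "fin_dim_right_module K A M \<longleftrightarrow>
    right_module A M \<and> vectorspace.fin_dim K (underlying_space K A M)"

definition module_dim ::
    "('k, 'p) ring_scheme \<Rightarrow> ('k, 'a, 'q) module_scheme \<Rightarrow> ('a, 'm) module \<Rightarrow> nat" where
  "module_dim K A M = vectorspace.dim K (underlying_space K A M)"

text \<open>
  Homomorphisms are made extensional so that equality in the Hom set is equality on the carrier.
\<close>

definition Hom :: "('a, 'r) ring_scheme \<Rightarrow> ('a, 'm) module \<Rightarrow> ('a, 'n) module \<Rightarrow> ('m \<Rightarrow> 'n) set" where
  "Hom A M N = module_hom A M N \<inter> extensional (carrier M)"

definition zero_hom :: "('a, 'm) module \<Rightarrow> ('a, 'n) module \<Rightarrow> 'm \<Rightarrow> 'n" where
  "zero_hom M N = (\<lambda>x\<in>carrier M. \<zero>\<^bsub>N\<^esub>)"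

definition End_ring :: "('a, 'r) ring_scheme \<Rightarrow> ('a, 'm) module \<Rightarrow> ('m \<Rightarrow> 'm) ring" where
  "End_ring A M =
    \<lparr>carrier = Hom A M M, mult = compose (carrier M), one = (\<lambda>x\<in>carrier M. x),
     zero = zero_hom M M, add = (\<lambda>f g. \<lambda>x\<in>carrier M. f x \<oplus>\<^bsub>M\<^esub> g x)\<rparr>"

text \<open>The zero ring is excluded, since there \<open>\<zero>\<close> is a unit.\<close>

definition division_ring :: "('a, 'r) ring_scheme \<Rightarrow> bool" where
  "division_ring R \<longleftrightarrow> ring R \<and> Units R = carrier R - {\<zero>\<^bsub>R\<^esub>}"

definition brick ::
    "('k, 'p) ring_scheme \<Rightarrow> ('k, 'a, 'q) module_scheme \<Rightarrow> ('a, 'b) module \<Rightarrow> bool" where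
  "brick K A B \<longleftrightarrow> fin_dim_right_module K A B \<and> division_ring (End_ring A B)"

definition module_isomorphic ::
    "('a, 'r) ring_scheme \<Rightarrow> ('a, 'm) module \<Rightarrow> ('a, 'n) module \<Rightarrow> bool" where
  "module_isomorphic A M N \<longleftrightarrow> (\<exists>f \<in> Hom A M N. bij_betw f (carrier M) (carrier N))"

definition quotient_module :: "('a, 'm) module \<Rightarrow> 'm set \<Rightarrow> ('a, 'm set) module" where
  "quotient_module M N =
    \<lparr>carrier = a_rcosets\<^bsub>M\<^esub> N, mult = undefined, one = undefined, zero = N, add = set_add M,
     smult = (\<lambda>a X. \<Union>x\<in>X. N +>\<^bsub>M\<^esub> (a \<odot>\<^bsub>M\<^esub> x))\<rparr>"

text \<open>For submodules \<open>V \<subseteq> U\<close> of \<open>M\<close>, the module \<open>U / V\<close>.\<close>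

definition subquotient :: "('a, 'm) module \<Rightarrow> 'm set \<Rightarrow> 'm set \<Rightarrow> ('a, 'm set) module" where
  "subquotient M U V = quotient_module (M\<lparr>carrier := U\<rparr>) V"

definition in_Filt ::
    "('k, 'p) ring_scheme \<Rightarrow> ('k, 'a, 'q) module_scheme \<Rightarrow> ('a, 'b) module \<Rightarrow> ('a, 'm) module \<Rightarrow> bool"
  where
  "in_Filt K A B M \<longleftrightarrow>
    fin_dim_right_module K A M \<and>
    (\<exists>Ns. Ns \<noteq> [] \<and> hd Ns = {\<zero>\<^bsub>M\<^esub>} \<and> last Ns = carrier M \<and>
      (\<forall>N \<in> set Ns. Module.submodule N A M) \<and>
      (\<forall>i. Suc i < length Ns \<longrightarrow>
        Ns ! i \<subseteq> Ns ! Suc i \<and> module_isomorphic A (subquotient M (Ns ! Suc i) (Ns ! i)) B))"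

text \<open>
  A chain \<open>M\<^sub>0 \<subset> \<dots> \<subset> M\<^sub>t\<close> is the list of its \<open>t + 1\<close> members, and \<open>Bs ! i\<close> is the brick belonging
  to the factor \<open>M\<^sub>i\<^sub>+\<^sub>1 / M\<^sub>i\<close>. Existence of the bricks can only be expressed for bricks whose
  elements are taken from some type \<open>'b\<close>, which is therefore an explicit parameter. All conditions on the
  bricks are invariant under isomorphism, and every finite-dimensional module is isomorphic to one
  with elements in \<open>nat \<Rightarrow> 'k\<close>. Hence the type \<open>nat \<Rightarrow> 'k\<close> for \<open>'b\<close> accounts for all bricks, and
  other types never yield additional chains.
\<close>

definition brick_chain_filtration ::
    "'b itself \<Rightarrow> ('k, 'p) ring_scheme \<Rightarrow> ('k, 'a, 'q) module_scheme \<Rightarrow> ('a, 'm) module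
      \<Rightarrow> 'm set list \<Rightarrow> bool" where
  "brick_chain_filtration (_ :: 'b itself) K A M Ms \<longleftrightarrow>
    Ms \<noteq> [] \<and> hd Ms = {\<zero>\<^bsub>M\<^esub>} \<and> last Ms = carrier M \<and>
    (\<forall>N \<in> set Ms. Module.submodule N A M) \<and>
    (\<forall>i. Suc i < length Ms \<longrightarrow> Ms ! i \<subset> Ms ! Suc i) \<and>
    (\<exists>Bs :: ('a, 'b) module list.
      length Ms = Suc (length Bs) \<and>
      (\<forall>B \<in> set Bs. brick K A B) \<and>
      (\<forall>i < length Bs. in_Filt K A (Bs ! i) (subquotient M (Ms ! Suc i) (Ms ! i))) \<and>
      (\<forall>i j. i < j \<and> j < length Bs \<longrightarrow> Hom A (Bs ! i) (Bs ! j) = {zero_hom (Bs ! i) (Bs ! j)}))"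

definition brick_chain_filtrations ::
    "'b itself \<Rightarrow> ('k, 'p) ring_scheme \<Rightarrow> ('k, 'a, 'q) module_scheme \<Rightarrow> ('a, 'm) module
      \<Rightarrow> 'm set list set" where
  "brick_chain_filtrations ty K A M = {Ms. brick_chain_filtration ty K A M Ms}"

definition num_brick_chain_filtrations ::
    "'b itself \<Rightarrow> ('k, 'p) ring_scheme \<Rightarrow> ('k, 'a, 'q) module_scheme \<Rightarrow> ('a, 'm) module \<Rightarrow> nat" where
  "num_brick_chain_filtrations ty K A M = card (brick_chain_filtrations ty K A M)"

end

theory Submission
  imports "HOL-Library.Product_Lexorder" Complex_Main Defs
begin

text \<open>
  Let \<open>U = M\<^sub>t\<^sub>-\<^sub>1\<close> be the penultimate member of a brick chain filtration of \<open>M\<close>. The Hom condition on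
  the bricks gives \<open>Hom(U, M/U) = 0\<close>, and the rest of the chain is a brick chain filtration of \<open>U\<close>.
  So \<open>b(M)\<close> is at most the sum of \<open>b(U)\<close> over all such rigid \<open>U \<noteq> M\<close>.

  Rigid submodules are nondegenerate isolated points of the variety of submodules. In a Schubert cell,
  i.e. for a fixed set \<open>S\<close> of pivots of the reduced echelon basis, this variety is given by quadratic
  equations in the \<open>n\<close> free entries. For two rigid submodules \<open>U, U'\<close> in the cell consider the linear
  system for homomorphisms \<open>U \<rightarrow> M/U'\<close> in the directions of the cell. It has \<open>n\<close> unknowns, its
  coefficients are affine in the entries of \<open>U\<close>, and it has a nonzero solution iff \<open>U \<noteq> U'\<close>. So
  a suitable \<open>n \<times> n\<close> minor is a polynomial of degree at most \<open>n\<close> separating \<open>U'\<close> from all other rigid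
  submodules in the cell, whose number is therefore at most that of the monomials, hence at most \<open>4\<^sup>n\<close>.

  By induction \<open>b(M)\<close> is at most the sum of \<open>4\<^sup>n 2 ^ |S|\<^sup>2\<close> over all proper subsets \<open>S\<close> of \<open>{1..d}\<close>. Summing
  \<open>4\<^sup>n\<close> over the \<open>S\<close> with \<open>d - e\<close> elements gives a Gaussian binomial coefficient, which is at most
  \<open>(4/3)\<^sup>e 4 ^ (e (d - e))\<close>; and \<open>(4/3)\<^sup>e 2 ^ (- e\<^sup>2)\<close> sums to at most \<open>1\<close> over \<open>e \<ge> 1\<close>.
\<close>

section \<open>Counting nondegenerate solutions of quadratic equations\<close>

text \<open>The tangent space at \<open>U\<close> of the variety of submodules is Hom(U, M/U); this
  is why rigid means nondegenerate. Bezout's inequality would bound the isolated solutions in a cell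
  by 2^n. The weaker 4^n bounds the number binom(2n, n) of monomials of degree at most n in n
  variables and needs only linear algebra. Since a minor is selected separately for each
  \<open>U'\<close> from the given equations, no generic choice is made, and finite fields need no
  separate treatment. Neither polynomials nor varieties are formed: only values at finitely many
  points occur, and having small degree is expressed by the linear relations that these values
  satisfy. The bound 4^n is just good enough for the exponent d^2: for submodules of codimension e
  the largest cell has n = e(d - e), and 4^(e(d - e)) 2^((d - e)^2) = 2^(d^2 - e^2). The factor
  2^(-e^2) then pays for the smaller cells and for the sum over e.\<close>

definition exponents :: "'q set \<Rightarrow> nat \<Rightarrow> ('q \<Rightarrow> nat) set" where
  "exponents Q n = {m. (\<forall>p. p \<notin> Q \<longrightarrow> m p = 0) \<and> sum m Q \<le> n}"

text \<open>The exact number is the binomial coefficient of \<open>n + card Q\<close> over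
  \<open>n\<close>. A power of two is enough, and removing one variable \<open>p\<close> turns the
  estimate into a geometric sum over the exponent of \<open>p\<close>.\<close>

lemma card_exponents:
  fixes Q :: "'q set"
  assumes "finite Q"
  shows "finite (exponents Q n) \<and> card (exponents Q n) \<le> 2 ^ (n + card Q)"
  using assms
proof (induction Q arbitrary: n rule: finite_induct)
  case empty
  have "exponents ({} :: 'q set) n = {\<lambda>_. 0}"
    by (auto simp: exponents_def)
  then show ?case by simp
next
  case (insert p Q)
  have sub: "exponents (insert p Q) n \<subseteq> (\<Union>k\<in>{..n}. (\<lambda>m. m(p := k)) ` exponents Q (n - k))"
  proof
    fix m assume m: "m \<in> exponents (insert p Q) n"
    have le: "m p + sum m Q \<le> n"
      using m insert.hyps by (auto simp: exponents_def)
    have "sum (m(p := 0)) Q = sum m Q"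
      using insert.hyps by (intro sum.cong) auto
    then have "m(p := 0) \<in> exponents Q (n - m p)"
      using m le by (auto simp: exponents_def)
    then have "m \<in> (\<lambda>m'. m'(p := m p)) ` exponents Q (n - m p)"
      by (intro image_eqI[of _ _ "m(p := 0)"]) auto
    then show "m \<in> (\<Union>k\<in>{..n}. (\<lambda>m. m(p := k)) ` exponents Q (n - k))"
      using le by auto
  qed
  have fin: "finite (\<Union>k\<in>{..n}. (\<lambda>m. m(p := k)) ` exponents Q (n - k))"
    using insert.IH by auto
  have pow: "(\<Sum>k\<in>{..n}. (2 :: nat) ^ (n - k + c)) \<le> 2 ^ (n + Suc c)" for c :: nat
  proof -
    have "(\<Sum>k\<in>{..n}. (2 :: nat) ^ (n - k + c)) = (\<Sum>k\<in>{..n}. 2 ^ (k + c))"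
      using sum.nat_diff_reindex[of "\<lambda>k. (2 :: nat) ^ (k + c)" "Suc n"]
      by (simp add: lessThan_Suc_atMost)
    also have "\<dots> \<le> 2 ^ (n + Suc c)"
      by (induction n) auto
    finally show ?thesis .
  qed
  have "card (exponents (insert p Q) n) \<le> card (\<Union>k\<in>{..n}. (\<lambda>m. m(p := k)) ` exponents Q (n - k))"
    using sub fin by (rule card_mono[rotated])
  also have "\<dots> \<le> (\<Sum>k\<in>{..n}. card ((\<lambda>m. m(p := k)) ` exponents Q (n - k)))"
    by (rule card_UN_le) simp
  also have "\<dots> \<le> (\<Sum>k\<in>{..n}. 2 ^ (n - k + card Q))"
    using insert.IH by (intro sum_mono) (meson card_image_le order_trans)
  also have "\<dots> \<le> 2 ^ (n + card (insert p Q))"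
    using pow[of "card Q"] insert.hyps by simp
  finally show ?case
    using finite_subset[OF sub fin] by blast
qed

section \<open>Finite sums and homogeneous linear systems\<close>

lemma (in abelian_monoid) finsum_swap:
  assumes "finite A" "finite B" "\<And>a b. a \<in> A \<Longrightarrow> b \<in> B \<Longrightarrow> f a b \<in> carrier G"
  shows "(\<Oplus>a\<in>A. \<Oplus>b\<in>B. f a b) = (\<Oplus>b\<in>B. \<Oplus>a\<in>A. f a b)"
  using assms(1,3)
proof (induction A rule: finite_induct)
  case empty
  then show ?case by simp
next
  case (insert a A)
  have "(\<Oplus>b\<in>B. \<Oplus>a\<in>insert a A. f a b) = (\<Oplus>b\<in>B. f a b \<oplus> (\<Oplus>a\<in>A. f a b))"
    using insert by (intro finsum_cong') (auto simp: Pi_def)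
  also have "\<dots> = (\<Oplus>b\<in>B. f a b) \<oplus> (\<Oplus>b\<in>B. \<Oplus>a\<in>A. f a b)"
    using insert by (intro finsum_addf) (auto simp: Pi_def)
  finally show ?case
    using insert by (simp add: Pi_def)
qed

lemma (in abelian_group) finsum_minus:
  assumes "finite A" "\<And>a. a \<in> A \<Longrightarrow> f a \<in> carrier G"
  shows "(\<Oplus>a\<in>A. \<ominus> f a) = \<ominus> (\<Oplus>a\<in>A. f a)"
  using assms
proof (induction A rule: finite_induct)
  case empty
  then show ?case by (metis finsum_empty l_zero minus_equality zero_closed)
qed (auto simp: Pi_def minus_add)

text \<open>Gaussian elimination with one equation per induction step: either all its coefficients
  vanish, or it is solved for one unknown.\<close>

lemma (in field) homogeneous_system:
  assumes "finite E" "finite J" "card E < card J"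
    and "\<And>e j. e \<in> E \<Longrightarrow> j \<in> J \<Longrightarrow> m e j \<in> carrier R"
  shows "\<exists>c\<in>J \<rightarrow> carrier R. (\<exists>j\<in>J. c j \<noteq> \<zero>) \<and> (\<forall>e\<in>E. (\<Oplus>j\<in>J. c j \<otimes> m e j) = \<zero>)"
  using assms
proof (induction E arbitrary: J m rule: finite_induct)
  case empty
  then obtain j where "j \<in> J" by fastforce
  then show ?case
    by (intro bexI[of _ "\<lambda>_. \<one>"]) auto
next
  case (insert e E)
  show ?case
  proof (cases "\<forall>j\<in>J. m e j = \<zero>")
    case True
    have "\<exists>c\<in>J \<rightarrow> carrier R. (\<exists>j\<in>J. c j \<noteq> \<zero>) \<and> (\<forall>e\<in>E. (\<Oplus>j\<in>J. c j \<otimes> m e j) = \<zero>)"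
      using insert.prems insert.hyps by (intro insert.IH) auto
    then obtain c where c: "c \<in> J \<rightarrow> carrier R" "\<exists>j\<in>J. c j \<noteq> \<zero>"
      "\<And>e'. e' \<in> E \<Longrightarrow> (\<Oplus>j\<in>J. c j \<otimes> m e' j) = \<zero>"
      by blast
    have "(\<Oplus>j\<in>J. c j \<otimes> m e j) = (\<Oplus>j\<in>J. \<zero>)"
      using True c(1) by (intro finsum_cong') (auto simp: Pi_def)
    then show ?thesis
      using c by (intro bexI[of _ c]) auto
  next
    case False
    then obtain j0 where j0: "j0 \<in> J" "m e j0 \<noteq> \<zero>" by blast
    define J' where "J' = J - {j0}"
    have J: "J = insert j0 J'" "j0 \<notin> J'" "finite J'"
      using j0 insert.prems by (auto simp: J'_def)
    have mE: "\<And>j. j \<in> J' \<Longrightarrow> m e j \<in> carrier R" "m e j0 \<in> carrier R"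
      "\<And>e' j. e' \<in> E \<Longrightarrow> j \<in> J' \<Longrightarrow> m e' j \<in> carrier R"
      "\<And>e'. e' \<in> E \<Longrightarrow> m e' j0 \<in> carrier R"
      using insert.prems J by auto
    define t where "t = inv (m e j0)"
    have t: "t \<in> carrier R" "t \<otimes> m e j0 = \<one>"
      using j0 mE(2) field_Units by (auto simp: t_def)
    \<comment> \<open>Row \<open>e'\<close> minus the multiple of row \<open>e\<close> that cancels
      the coefficient of the unknown \<open>j0\<close>.\<close>
    define m' where "m' e' j = m e' j \<ominus> (m e j \<otimes> t) \<otimes> m e' j0" for e' j
    have m': "\<And>e' j. e' \<in> E \<Longrightarrow> j \<in> J' \<Longrightarrow> m' e' j \<in> carrier R"
      using mE t by (auto simp: m'_def)
    have "card E < card J'"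
      using insert.prems insert.hyps J by simp
    then obtain c where c: "c \<in> J' \<rightarrow> carrier R" "\<exists>j\<in>J'. c j \<noteq> \<zero>"
      "\<And>e'. e' \<in> E \<Longrightarrow> (\<Oplus>j\<in>J'. c j \<otimes> m' e' j) = \<zero>"
      using insert.IH[of J' m'] J m' by blast
    have cc: "\<And>j. j \<in> J' \<Longrightarrow> c j \<in> carrier R" using c(1) by auto
    define s where "s = (\<Oplus>j\<in>J'. c j \<otimes> m e j)"
    have s: "s \<in> carrier R" using cc mE by (auto simp: s_def intro!: finsum_closed)
    \<comment> \<open>The value at \<open>j0\<close> solves equation \<open>e\<close>: it is minus
      the rest \<open>s\<close> of that equation, divided by \<open>m e j0\<close>.\<close>
    define c' where "c' = c(j0 := \<ominus> (s \<otimes> t))"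
    have c'0: "c' j0 = \<ominus> (s \<otimes> t)" by (simp add: c'_def)
    have eq: "(\<Oplus>j\<in>J. c' j \<otimes> m e' j) = \<ominus> (s \<otimes> t) \<otimes> m e' j0 \<oplus> (\<Oplus>j\<in>J'. c j \<otimes> m e' j)"
      if "e' \<in> insert e E" for e'
    proof -
      have "(\<Oplus>j\<in>J. c' j \<otimes> m e' j) = c' j0 \<otimes> m e' j0 \<oplus> (\<Oplus>j\<in>J'. c' j \<otimes> m e' j)"
        unfolding J(1) using J cc mE t s that
        by (intro finsum_insert) (auto simp: c'_def)
      also have "(\<Oplus>j\<in>J'. c' j \<otimes> m e' j) = (\<Oplus>j\<in>J'. c j \<otimes> m e' j)"
        using J cc mE that by (intro finsum_cong') (auto simp: c'_def)
      finally show ?thesis by (simp add: c'0)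
    qed
    have "(\<Oplus>j\<in>J. c' j \<otimes> m e' j) = \<zero>" if e': "e' \<in> E" for e'
    proof -
      have "\<zero> = (\<Oplus>j\<in>J'. c j \<otimes> m e' j \<oplus> \<ominus> ((c j \<otimes> m e j) \<otimes> (t \<otimes> m e' j0)))"
        unfolding c(3)[OF e', symmetric]
        using cc mE t e' by (intro finsum_cong') (auto simp: m'_def minus_eq r_distr r_minus m_ac)
      also have "\<dots> = (\<Oplus>j\<in>J'. c j \<otimes> m e' j) \<oplus> (\<Oplus>j\<in>J'. \<ominus> ((c j \<otimes> m e j) \<otimes> (t \<otimes> m e' j0)))"
        using cc mE t e' by (intro finsum_addf) auto
      also have "(\<Oplus>j\<in>J'. \<ominus> ((c j \<otimes> m e j) \<otimes> (t \<otimes> m e' j0))) = \<ominus> (s \<otimes> (t \<otimes> m e' j0))"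
        using cc mE t e' J by (simp add: finsum_minus finsum_ldistr s_def Pi_def)
      finally have *: "(\<Oplus>j\<in>J'. c j \<otimes> m e' j) \<oplus> \<ominus> (s \<otimes> (t \<otimes> m e' j0)) = \<zero>" by simp
      have cl: "(\<Oplus>j\<in>J'. c j \<otimes> m e' j) \<in> carrier R"
        using cc mE e' by (auto intro!: finsum_closed)
      show ?thesis
        using * cl s t mE(4)[OF e'] e' by (simp add: eq l_minus m_assoc a_comm)
    qed
    moreover have "(\<Oplus>j\<in>J. c' j \<otimes> m e j) = \<zero>"
      using s t mE(2) by (simp add: eq l_minus m_assoc l_neg flip: s_def)
    moreover have "c' \<in> J \<rightarrow> carrier R"
      using J cc s t by (auto simp: c'_def)
    moreover have "\<exists>j\<in>J. c' j \<noteq> \<zero>"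
      using c(2) J by (auto simp: c'_def)
    ultimately show ?thesis by blast
  qed
qed

text \<open>The sign of \<open>b\<close> in a Laplace expansion along \<open>T\<close>. The count
  ignores \<open>b\<close> itself, so the same sign serves for removing an element of
  \<open>T\<close> and for inserting a new one.\<close>

definition (in ring) alt_sign :: "'q::linorder \<Rightarrow> 'q set \<Rightarrow> 'a" where
  "alt_sign b T = (if even (card {x \<in> T. x < b}) then \<one> else \<ominus> \<one>)"

lemma (in ring) alt_sign_closed [simp]: "alt_sign b T \<in> carrier R"
  by (simp add: alt_sign_def)

lemma (in ring) alt_sign_square: "alt_sign b T \<otimes> alt_sign b T = \<one>"
  by (simp add: alt_sign_def l_minus)

lemma (in ring) alt_sign_insert_self [simp]: "alt_sign b (insert b T) = alt_sign b T"
  unfolding alt_sign_def by (rule arg_cong[where f = "\<lambda>S. if even (card S) then \<one> else \<ominus> \<one>"]) auto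

lemma (in ring) alt_sign_remove_self [simp]: "alt_sign b (T - {b}) = alt_sign b T"
  unfolding alt_sign_def by (rule arg_cong[where f = "\<lambda>S. if even (card S) then \<one> else \<ominus> \<one>"]) auto

lemma (in ring) alt_sign_insert:
  assumes "finite T" "c \<notin> T"
  shows "alt_sign b (insert c T) = (if c < b then \<ominus> alt_sign b T else alt_sign b T)"
proof (cases "c < b")
  case True
  then have "{x \<in> insert c T. x < b} = insert c {x \<in> T. x < b}" by auto
  then show ?thesis using True assms by (simp add: alt_sign_def)
next
  case False
  then have "{x \<in> insert c T. x < b} = {x \<in> T. x < b}" by auto
  then show ?thesis using False by (simp add: alt_sign_def)
qed

text \<open>Exterior multiplication by one basis vector anticommutes with contraction by another.
  Since \<open>b\<close> and \<open>c\<close> differ, exactly one of the two signs changes when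
  insertion and removal are swapped.\<close>

lemma (in cring) alt_sign_exchange:
  assumes "finite T" "b \<in> T" "c \<notin> T"
  shows "alt_sign c T \<otimes> alt_sign b (insert c T) = \<ominus> (alt_sign b T \<otimes> alt_sign c (T - {b}))"
proof -
  have T: "insert b (T - {b}) = T" using assms by auto
  have sc: "alt_sign c T = (if b < c then \<ominus> alt_sign c (T - {b}) else alt_sign c (T - {b}))"
    using alt_sign_insert[of "T - {b}" b c] assms T by simp
  have sb: "alt_sign b (insert c T) = (if c < b then \<ominus> alt_sign b T else alt_sign b T)"
    using assms by (simp add: alt_sign_insert)
  have "b \<noteq> c" using assms by auto
  then consider "b < c" "\<not> c < b" | "c < b" "\<not> b < c" by fastforce
  then show ?thesis
  proof cases
    case 1
    then show ?thesis
      unfolding sc sb by (simp add: l_minus r_minus m_comm)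
  next
    case 2
    then show ?thesis
      unfolding sc sb by (simp add: l_minus r_minus m_comm)
  qed
qed

text \<open>
  The determinant of the square matrix with rows \<open>rs\<close> and columns \<open>T\<close>, expanded along the first
  row; it is \<open>\<zero>\<close> unless \<open>length rs = card T\<close>.
\<close>

primrec (in ring) minor :: "('r \<Rightarrow> 'q::linorder \<Rightarrow> 'a) \<Rightarrow> 'r list \<Rightarrow> 'q set \<Rightarrow> 'a" where
  "minor \<phi> [] T = (if T = {} then \<one> else \<zero>)"
| "minor \<phi> (r # rs) T = (\<Oplus>b\<in>T. alt_sign b T \<otimes> \<phi> r b \<otimes> minor \<phi> rs (T - {b}))"

lemma (in ring) minor_closed:
  assumes "\<And>r b. r \<in> set rs \<Longrightarrow> b \<in> T \<Longrightarrow> \<phi> r b \<in> carrier R"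
  shows "minor \<phi> rs T \<in> carrier R"
  using assms
proof (induction rs arbitrary: T)
  case (Cons r rs)
  have "\<And>b. minor \<phi> rs (T - {b}) \<in> carrier R"
    using Cons.prems by (intro Cons.IH) auto
  then show ?case
    using Cons.prems by (auto intro!: finsum_closed)
qed simp

text \<open>Contracting the exterior product of the rows with a vector that all rows annihilate.\<close>

lemma (in cring) minor_contract:
  assumes "finite Q" "\<And>r b. r \<in> set rs \<Longrightarrow> b \<in> Q \<Longrightarrow> \<phi> r b \<in> carrier R" "X \<in> Q \<rightarrow> carrier R"
    and "\<And>r. r \<in> set rs \<Longrightarrow> (\<Oplus>b\<in>Q. \<phi> r b \<otimes> X b) = \<zero>" "T \<subseteq> Q"
  shows "(\<Oplus>c\<in>Q - T. alt_sign c T \<otimes> X c \<otimes> minor \<phi> rs (insert c T)) = \<zero>"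
  using assms(2,4,5)
proof (induction rs arbitrary: T)
  case Nil
  have "(\<Oplus>c\<in>Q - T. alt_sign c T \<otimes> X c \<otimes> minor \<phi> [] (insert c T)) = (\<Oplus>c\<in>Q - T. \<zero>)"
    using assms(3) by (intro finsum_cong') (auto simp: Pi_iff)
  then show ?case by simp
next
  case (Cons r rs)
  define f where "f = minor \<phi> rs"
  have finT: "finite T" using Cons.prems assms(1) finite_subset by blast
  have X: "\<And>b. b \<in> Q \<Longrightarrow> X b \<in> carrier R" using assms(3) by auto
  have \<phi>: "\<And>b. b \<in> Q \<Longrightarrow> \<phi> r b \<in> carrier R" using Cons.prems by auto
  have f: "\<And>S. S \<subseteq> Q \<Longrightarrow> f S \<in> carrier R"
    unfolding f_def using Cons.prems(1) by (intro minor_closed) auto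
  have fT: "f T \<in> carrier R" using f Cons.prems by blast
  have fi: "\<And>b c. c \<in> Q - T \<Longrightarrow> f (insert c T - {b}) \<in> carrier R"
    "\<And>b c. c \<in> Q - T \<Longrightarrow> f (insert c (T - {b})) \<in> carrier R"
    using Cons.prems(3) by (auto intro!: f)
  have TQ: "\<And>b. b \<in> T \<Longrightarrow> b \<in> Q" using Cons.prems by auto
  define g where "g b c = alt_sign c T \<otimes> X c \<otimes> (alt_sign b (insert c T) \<otimes> \<phi> r b \<otimes> f (insert c T - {b}))" for b c
  have g: "\<And>b c. b \<in> T \<Longrightarrow> c \<in> Q - T \<Longrightarrow> g b c \<in> carrier R"
    using X \<phi> fi TQ by (auto simp: g_def)
  \<comment> \<open>Expand along \<open>r\<close>: column \<open>c\<close> itself gives the first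
    summand, since its two equal signs cancel, and the columns of \<open>T\<close> give the
    rest.\<close>
  have 1: "alt_sign c T \<otimes> X c \<otimes> minor \<phi> (r # rs) (insert c T)
      = \<phi> r c \<otimes> X c \<otimes> f T \<oplus> (\<Oplus>b\<in>T. g b c)" if c: "c \<in> Q - T" for c
  proof -
    have eqT: "insert c T - {c} = T" using c by auto
    have Xc: "X c \<in> carrier R" "\<phi> r c \<in> carrier R" using X \<phi> c by auto
    let ?S = "\<Oplus>b\<in>T. alt_sign b (insert c T) \<otimes> \<phi> r b \<otimes> f (insert c T - {b})"
    have S: "?S \<in> carrier R" using c \<phi> fi TQ by (auto intro!: finsum_closed)
    have "minor \<phi> (r # rs) (insert c T) = alt_sign c T \<otimes> \<phi> r c \<otimes> f T \<oplus> ?S"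
      using c finT X \<phi> fi TQ fT by (simp add: f_def[symmetric] Pi_def eqT)
    then have "alt_sign c T \<otimes> X c \<otimes> minor \<phi> (r # rs) (insert c T)
        = alt_sign c T \<otimes> X c \<otimes> (alt_sign c T \<otimes> \<phi> r c \<otimes> f T) \<oplus> alt_sign c T \<otimes> X c \<otimes> ?S"
      using S Xc fT by (simp add: r_distr)
    moreover have "alt_sign c T \<otimes> X c \<otimes> (alt_sign c T \<otimes> \<phi> r c \<otimes> f T) = (alt_sign c T \<otimes> alt_sign c T) \<otimes> (\<phi> r c \<otimes> X c \<otimes> f T)"
      using Xc fT by (simp add: m_ac)
    moreover have "(alt_sign c T \<otimes> alt_sign c T) \<otimes> (\<phi> r c \<otimes> X c \<otimes> f T) = \<phi> r c \<otimes> X c \<otimes> f T"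
      using Xc fT by (simp add: alt_sign_square)
    moreover have "alt_sign c T \<otimes> X c \<otimes> ?S = (\<Oplus>b\<in>T. g b c)"
      unfolding g_def using c finT X \<phi> fi TQ by (intro finsum_rdistr) auto
    ultimately show ?thesis by simp
  qed
  have 2: "(\<Oplus>c\<in>Q - T. g b c) = \<phi> r b \<otimes> X b \<otimes> f T" if b: "b \<in> T" for b
  proof -
    have Xb: "X b \<in> carrier R" "\<phi> r b \<in> carrier R" using X \<phi> b TQ by auto
    define h where "h c = alt_sign c (T - {b}) \<otimes> X c \<otimes> f (insert c (T - {b}))" for c
    have h: "\<And>c. c \<in> Q - T \<Longrightarrow> h c \<in> carrier R"
      using X fi by (auto simp: h_def)
    have sQ: "Q - (T - {b}) = insert b (Q - T)" using b TQ by auto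
    have ib: "insert b (T - {b}) = T" using b by auto
    have hb: "h b = alt_sign b T \<otimes> X b \<otimes> f T" "h b \<in> carrier R"
      using Xb fT unfolding h_def ib alt_sign_remove_self by auto
    \<comment> \<open>The induction hypothesis for \<open>T - {b}\<close> has one extra term,
      \<open>c = b\<close>, which is therefore minus the sum over \<open>Q - T\<close>.\<close>
    have "\<zero> = (\<Oplus>c\<in>Q - (T - {b}). h c)"
      unfolding h_def f_def using Cons.prems by (intro Cons.IH[symmetric]) auto
    also have "\<dots> = alt_sign b T \<otimes> X b \<otimes> f T \<oplus> (\<Oplus>c\<in>Q - T. h c)"
      unfolding sQ using assms(1) b h hb by (subst finsum_insert) auto
    finally have eq: "\<ominus> (\<Oplus>c\<in>Q - T. h c) = alt_sign b T \<otimes> X b \<otimes> f T"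
      using h X fT TQ b by (metis (no_types, lifting) finsum_closed Pi_I m_closed alt_sign_closed minus_equality)
    have "g b c = (alt_sign b T \<otimes> \<phi> r b) \<otimes> (\<ominus> h c)" if c: "c \<in> Q - T" for c
    proof -
      have Xc: "X c \<in> carrier R" and fc: "f (insert c (T - {b})) \<in> carrier R"
        using X fi c by auto
      have ins: "insert c T - {b} = insert c (T - {b})" using b c by auto
      have "g b c = (alt_sign c T \<otimes> alt_sign b (insert c T)) \<otimes> (\<phi> r b \<otimes> X c \<otimes> f (insert c (T - {b})))"
        unfolding g_def ins using Xb Xc fc by (simp add: m_ac)
      also have "alt_sign c T \<otimes> alt_sign b (insert c T) = \<ominus> (alt_sign b T \<otimes> alt_sign c (T - {b}))"
        using alt_sign_exchange[OF finT b] c by auto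
      finally show ?thesis
        unfolding h_def using Xb Xc fc by (simp add: m_ac l_minus r_minus)
    qed
    then have "(\<Oplus>c\<in>Q - T. g b c) = (\<Oplus>c\<in>Q - T. (alt_sign b T \<otimes> \<phi> r b) \<otimes> (\<ominus> h c))"
      using h Xb by (intro finsum_cong') auto
    also have "\<dots> = (alt_sign b T \<otimes> \<phi> r b) \<otimes> (\<Oplus>c\<in>Q - T. \<ominus> h c)"
      using h Xb assms(1) by (intro finsum_rdistr[symmetric]) auto
    also have "\<dots> = (alt_sign b T \<otimes> \<phi> r b) \<otimes> (alt_sign b T \<otimes> X b \<otimes> f T)"
      unfolding eq[symmetric] using h assms(1) by (subst finsum_minus) auto
    also have "\<dots> = (alt_sign b T \<otimes> alt_sign b T) \<otimes> (\<phi> r b \<otimes> X b \<otimes> f T)"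
      using Xb fT by (simp add: m_ac)
    also have "\<dots> = \<phi> r b \<otimes> X b \<otimes> f T" using Xb fT by (simp add: alt_sign_square)
    finally show ?thesis .
  qed
  have "(\<Oplus>c\<in>Q - T. alt_sign c T \<otimes> X c \<otimes> minor \<phi> (r # rs) (insert c T))
      = (\<Oplus>c\<in>Q - T. \<phi> r c \<otimes> X c \<otimes> f T \<oplus> (\<Oplus>b\<in>T. g b c))"
    using 1 g \<phi> X fT by (intro finsum_cong') (auto intro!: finsum_closed)
  also have "\<dots> = (\<Oplus>c\<in>Q - T. \<phi> r c \<otimes> X c \<otimes> f T) \<oplus> (\<Oplus>c\<in>Q - T. \<Oplus>b\<in>T. g b c)"
    using g \<phi> X fT by (intro finsum_addf) (auto intro!: finsum_closed)
  also have "(\<Oplus>c\<in>Q - T. \<Oplus>b\<in>T. g b c) = (\<Oplus>b\<in>T. \<phi> r b \<otimes> X b \<otimes> f T)"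
  proof -
    have "(\<Oplus>c\<in>Q - T. \<Oplus>b\<in>T. g b c) = (\<Oplus>b\<in>T. \<Oplus>c\<in>Q - T. g b c)"
      using assms(1) finT g by (intro finsum_swap) auto
    also have "\<dots> = (\<Oplus>b\<in>T. \<phi> r b \<otimes> X b \<otimes> f T)"
      using 2 \<phi> X fT TQ by (intro finsum_cong') auto
    finally show ?thesis .
  qed
  \<comment> \<open>The two parts complete each other to a sum over \<open>Q\<close>, the pairing of
    row \<open>r\<close> with \<open>X\<close>, which is zero.\<close>
  also have "(\<Oplus>c\<in>Q - T. \<phi> r c \<otimes> X c \<otimes> f T) \<oplus> (\<Oplus>b\<in>T. \<phi> r b \<otimes> X b \<otimes> f T)
      = (\<Oplus>c\<in>(Q - T) \<union> T. \<phi> r c \<otimes> X c \<otimes> f T)"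
    using assms(1) finT \<phi> X fT TQ by (intro finsum_Un_disjoint[symmetric]) auto
  also have "(Q - T) \<union> T = Q" using TQ by auto
  also have "(\<Oplus>c\<in>Q. \<phi> r c \<otimes> X c \<otimes> f T) = (\<Oplus>c\<in>Q. \<phi> r c \<otimes> X c) \<otimes> f T"
    using assms(1) \<phi> X fT by (intro finsum_ldistr[symmetric]) auto
  also have "\<dots> = \<zero>" using Cons.prems(2)[of r] fT by simp
  finally show ?case .
qed

text \<open>Contract with \<open>T = Q - {c}\<close>: a single term remains, and it is
  \<open>X c\<close> times the minor up to sign.\<close>

lemma (in field) minor_eq_zero:
  assumes "finite Q" "\<And>r b. r \<in> set rs \<Longrightarrow> b \<in> Q \<Longrightarrow> \<phi> r b \<in> carrier R" "X \<in> Q \<rightarrow> carrier R"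
    and "\<And>r. r \<in> set rs \<Longrightarrow> (\<Oplus>b\<in>Q. \<phi> r b \<otimes> X b) = \<zero>" "c \<in> Q" "X c \<noteq> \<zero>"
  shows "minor \<phi> rs Q = \<zero>"
proof -
  have "Q - (Q - {c}) = {c}" "insert c (Q - {c}) = Q" using assms(5) by auto
  moreover have "(\<Oplus>b\<in>Q - (Q - {c}). alt_sign b (Q - {c}) \<otimes> X b \<otimes> minor \<phi> rs (insert b (Q - {c}))) = \<zero>"
    using assms by (intro minor_contract) auto
  moreover have "minor \<phi> rs Q \<in> carrier R" using assms by (intro minor_closed) auto
  moreover have Xc: "X c \<in> carrier R" using assms by auto
  ultimately have "alt_sign c Q \<otimes> X c \<otimes> minor \<phi> rs Q = \<zero>"
    by simp
  moreover have "alt_sign c Q \<noteq> \<zero>" using alt_sign_square[of c Q] by auto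
  ultimately show ?thesis
    using assms(6) Xc \<open>minor \<phi> rs Q \<in> carrier R\<close> by (simp add: integral_iff)
qed

text \<open>Columns are added one at a time. The cofactors for a row still to be chosen form a
  nonzero vector, whose entry at the new column is the old minor up to sign. By the last assumption
  some row does not annihilate this vector, and expanding along that row gives the larger
  minor.\<close>

lemma (in field) exists_nonzero_minor:
  assumes "finite T" "\<And>r b. r \<in> Rows \<Longrightarrow> b \<in> T \<Longrightarrow> \<phi> r b \<in> carrier R"
    and "\<And>X. X \<in> T \<rightarrow> carrier R \<Longrightarrow> (\<And>r. r \<in> Rows \<Longrightarrow> (\<Oplus>b\<in>T. \<phi> r b \<otimes> X b) = \<zero>)
      \<Longrightarrow> (\<And>b. b \<in> T \<Longrightarrow> X b = \<zero>)"
  shows "\<exists>rs. set rs \<subseteq> Rows \<and> length rs = card T \<and> minor \<phi> rs T \<noteq> \<zero>"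
  using assms
proof (induction T rule: finite_induct)
  case empty
  show ?case by (rule exI[of _ "[]"]) simp
next
  case (insert t T)
  have \<phi>: "\<And>r b. r \<in> Rows \<Longrightarrow> b \<in> insert t T \<Longrightarrow> \<phi> r b \<in> carrier R" by (fact insert.prems(1))
  have "\<exists>rs. set rs \<subseteq> Rows \<and> length rs = card T \<and> minor \<phi> rs T \<noteq> \<zero>"
  proof (rule insert.IH)
    fix X b assume X: "X \<in> T \<rightarrow> carrier R" "\<And>r. r \<in> Rows \<Longrightarrow> (\<Oplus>b\<in>T. \<phi> r b \<otimes> X b) = \<zero>" and b: "b \<in> T"
    define Y where "Y = X(t := \<zero>)"
    have "(\<Oplus>b\<in>insert t T. \<phi> r b \<otimes> Y b) = \<zero>" if r: "r \<in> Rows" for r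
    proof -
      have "(\<Oplus>b\<in>T. \<phi> r b \<otimes> Y b) = (\<Oplus>b\<in>T. \<phi> r b \<otimes> X b)"
        using insert.hyps X(1) \<phi> r by (intro finsum_cong') (auto simp: Y_def Pi_iff)
      moreover have "(\<Oplus>b\<in>insert t T. \<phi> r b \<otimes> Y b) = \<phi> r t \<otimes> Y t \<oplus> (\<Oplus>b\<in>T. \<phi> r b \<otimes> Y b)"
        using insert.hyps X(1) \<phi> r by (intro finsum_insert) (auto simp: Y_def Pi_iff)
      ultimately show ?thesis using X(2)[OF r] \<phi> r by (simp add: Y_def)
    qed
    moreover have "Y \<in> insert t T \<rightarrow> carrier R" using X(1) by (auto simp: Y_def)
    ultimately have "Y b = \<zero>"
      using b insert.prems(2) by blast
    then show "X b = \<zero>" using b insert.hyps by (auto simp: Y_def split: if_splits)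
  qed (use \<phi> in auto)
  then obtain rs where rs: "set rs \<subseteq> Rows" "length rs = card T" "minor \<phi> rs T \<noteq> \<zero>" by blast
  define Y where "Y b = alt_sign b (insert t T) \<otimes> minor \<phi> rs (insert t T - {b})" for b
  have mc: "\<And>b. minor \<phi> rs (insert t T - {b}) \<in> carrier R"
    using \<phi> rs by (intro minor_closed) auto
  have Yc: "Y \<in> insert t T \<rightarrow> carrier R" unfolding Y_def using mc by (intro Pi_I m_closed alt_sign_closed)
  have Yt: "insert t T - {t} = T" using insert.hyps by auto
  have "Y t \<noteq> \<zero>"
    using rs(3) mc[of t] alt_sign_square[of t T] unfolding Y_def Yt by (auto simp: integral_iff)
  then obtain r where r: "r \<in> Rows" "(\<Oplus>b\<in>insert t T. \<phi> r b \<otimes> Y b) \<noteq> \<zero>"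
    using insert.prems(2)[OF Yc, of t] by blast
  have "minor \<phi> (r # rs) (insert t T) = (\<Oplus>b\<in>insert t T. \<phi> r b \<otimes> Y b)"
    unfolding minor.simps
  proof (intro finsum_cong')
    fix b assume "b \<in> insert t T"
    then show "alt_sign b (insert t T) \<otimes> \<phi> r b \<otimes> minor \<phi> rs (insert t T - {b}) = \<phi> r b \<otimes> Y b"
      unfolding Y_def using mc[of b] \<phi>[OF r(1), of b] by (simp add: m_ac del: insert_iff alt_sign_insert_self)
  qed (use Yc \<phi> r in auto)
  then show ?case
    using r rs insert.hyps by (intro exI[of _ "r # rs"]) auto
qed

section \<open>Monomial values at finitely many points\<close>

definition (in cring) monomial_at :: "'q set \<Rightarrow> ('i \<Rightarrow> 'q \<Rightarrow> 'a) \<Rightarrow> ('q \<Rightarrow> nat) \<Rightarrow> 'i \<Rightarrow> 'a" where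
  "monomial_at Q x m i = (\<Otimes>p\<in>Q. x i p [^] m p)"

lemma (in cring) monomial_at_closed:
  assumes "\<And>p. p \<in> Q \<Longrightarrow> x i p \<in> carrier R"
  shows "monomial_at Q x m i \<in> carrier R"
  unfolding monomial_at_def using assms by (intro finprod_closed) auto

lemma (in cring) monomial_at_upd:
  fixes Q :: "'q set"
  assumes "finite Q" "p \<in> Q" "\<And>q. q \<in> Q \<Longrightarrow> x i q \<in> carrier R"
  shows "monomial_at Q x (m(p := Suc (m p))) i = monomial_at Q x m i \<otimes> x i p"
proof -
  let ?P = "\<lambda>m. (\<Otimes>q\<in>Q - {p}. x i q [^] m q)"
  have split: "monomial_at Q x m' i = x i p [^] m' p \<otimes> ?P m'" for m' :: "'q \<Rightarrow> nat"
  proof -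
    have "Q = insert p (Q - {p})" using assms by auto
    then have "monomial_at Q x m' i = (\<Otimes>q\<in>insert p (Q - {p}). x i q [^] m' q)" by (simp add: monomial_at_def)
    also have "\<dots> = x i p [^] m' p \<otimes> ?P m'"
      using assms by (intro finprod_insert) auto
    finally show ?thesis .
  qed
  have P: "?P (m(p := Suc (m p))) = ?P m" using assms by (intro finprod_cong') auto
  have "?P m \<in> carrier R" using assms by (intro finprod_closed) auto
  then show ?thesis
    unfolding split P using assms by (simp add: m_ac)
qed

text \<open>
  A function on the finite point set \<open>J\<close> is the restriction of an affine function of the
  coordinates \<open>x i p\<close> iff it is annihilated by all weights annihilating constants and coordinates.
\<close>

definition (in ring) affine_on :: "'i set \<Rightarrow> 'q set \<Rightarrow> ('i \<Rightarrow> 'q \<Rightarrow> 'a) \<Rightarrow> ('i \<Rightarrow> 'a) \<Rightarrow> bool" where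
  "affine_on J Q x \<psi> \<longleftrightarrow> (\<forall>w\<in>J \<rightarrow> carrier R. (\<Oplus>i\<in>J. w i) = \<zero> \<longrightarrow>
    (\<forall>p\<in>Q. (\<Oplus>i\<in>J. w i \<otimes> x i p) = \<zero>) \<longrightarrow> (\<Oplus>i\<in>J. w i \<otimes> \<psi> i) = \<zero>)"

text \<open>A minor with affine entries has degree at most its number of rows, and \<open>k\<close>
  is the degree already used by the monomial. For the induction, the products of \<open>c\<close>,
  the monomial and a smaller minor are taken as weights: they annihilate constants, and also
  coordinates because multiplying by a coordinate raises one exponent. Hence they annihilate the
  affine entries of the next row.\<close>

lemma (in field) minor_annihilated:
  assumes "finite J" "finite Q" "\<And>i p. i \<in> J \<Longrightarrow> p \<in> Q \<Longrightarrow> x i p \<in> carrier R" "c \<in> J \<rightarrow> carrier R"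
    and c: "\<And>m. m \<in> exponents Q n \<Longrightarrow> (\<Oplus>i\<in>J. c i \<otimes> monomial_at Q x m i) = \<zero>"
    and "\<And>i r b. i \<in> J \<Longrightarrow> r \<in> set rs \<Longrightarrow> b \<in> Q \<Longrightarrow> \<Phi> i r b \<in> carrier R"
    and "\<And>r b. r \<in> set rs \<Longrightarrow> b \<in> Q \<Longrightarrow> affine_on J Q x (\<lambda>i. \<Phi> i r b)"
    and "m \<in> exponents Q k" "k + length rs \<le> n" "T \<subseteq> Q"
  shows "(\<Oplus>i\<in>J. c i \<otimes> monomial_at Q x m i \<otimes> minor (\<Phi> i) rs T) = \<zero>"
  using assms(6-)
proof (induction rs arbitrary: m k T)
  case Nil
  have m: "m \<in> exponents Q n" using Nil by (auto simp: exponents_def)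
  have cl: "\<And>i. i \<in> J \<Longrightarrow> c i \<otimes> monomial_at Q x m i \<in> carrier R"
    using assms(3,4) by (auto intro!: monomial_at_closed)
  have "(\<Oplus>i\<in>J. c i \<otimes> monomial_at Q x m i \<otimes> minor (\<Phi> i) [] T) = (\<Oplus>i\<in>J. c i \<otimes> monomial_at Q x m i \<otimes> (if T = {} then \<one> else \<zero>))"
    by simp
  also have "\<dots> = (\<Oplus>i\<in>J. c i \<otimes> monomial_at Q x m i) \<otimes> (if T = {} then \<one> else \<zero>)"
    using assms(1) cl by (intro finsum_ldistr[symmetric]) auto
  finally show ?case using c[OF m] by simp
next
  case (Cons r rs)
  have finT: "finite T" using Cons.prems assms(2) finite_subset by blast
  have cc: "\<And>i. i \<in> J \<Longrightarrow> c i \<in> carrier R" using assms(4) by auto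
  have mc: "\<And>i m. i \<in> J \<Longrightarrow> monomial_at Q x m i \<in> carrier R"
    using assms(3) by (auto intro!: monomial_at_closed)
  have \<Phi>: "\<And>i b. i \<in> J \<Longrightarrow> b \<in> T \<Longrightarrow> \<Phi> i r b \<in> carrier R" using Cons.prems by auto
  have fc: "\<And>i S. i \<in> J \<Longrightarrow> S \<subseteq> Q \<Longrightarrow> minor (\<Phi> i) rs S \<in> carrier R"
    using Cons.prems(1) by (intro minor_closed) auto
  have fc': "\<And>i b. i \<in> J \<Longrightarrow> minor (\<Phi> i) rs (T - {b}) \<in> carrier R"
    using fc Cons.prems(5) by blast
  have IH: "(\<Oplus>i\<in>J. c i \<otimes> monomial_at Q x m' i \<otimes> minor (\<Phi> i) rs T') = \<zero>"
    if "m' \<in> exponents Q (Suc k)" "T' \<subseteq> Q" for m' T'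
    using Cons.prems(4) that by (intro Cons.IH[OF Cons.prems(1,2), of m' "Suc k" T']) auto
  have 1: "(\<Oplus>i\<in>J. c i \<otimes> monomial_at Q x m i \<otimes> (alt_sign b T \<otimes> \<Phi> i r b \<otimes> minor (\<Phi> i) rs (T - {b}))) = \<zero>"
    if b: "b \<in> T" for b
  proof -
    define w where "w i = c i \<otimes> monomial_at Q x m i \<otimes> minor (\<Phi> i) rs (T - {b})" for i
    have w: "\<And>i. i \<in> J \<Longrightarrow> w i \<in> carrier R" using cc mc fc' by (auto simp: w_def)
    have "(\<Oplus>i\<in>J. w i) = \<zero>"
      unfolding w_def using Cons.prems(3,5) by (intro IH) (auto simp: exponents_def)
    moreover have "(\<Oplus>i\<in>J. w i \<otimes> x i p) = \<zero>" if p: "p \<in> Q" for p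
    proof -
      have "sum (m(p := Suc (m p))) Q = Suc (sum m Q)"
        using p assms(2) by (simp add: sum.remove[of Q p])
      then have "m(p := Suc (m p)) \<in> exponents Q (Suc k)"
        using Cons.prems(3) p by (auto simp: exponents_def)
      then have "\<zero> = (\<Oplus>i\<in>J. c i \<otimes> monomial_at Q x (m(p := Suc (m p))) i \<otimes> minor (\<Phi> i) rs (T - {b}))"
        using Cons.prems(5) by (intro IH[symmetric]) auto
      also have "\<dots> = (\<Oplus>i\<in>J. w i \<otimes> x i p)"
        using cc mc fc' assms(3) p
        by (intro finsum_cong') (auto simp: w_def monomial_at_upd[OF assms(2) p] m_ac)
      finally show ?thesis by simp
    qed
    ultimately have z: "(\<Oplus>i\<in>J. w i \<otimes> \<Phi> i r b) = \<zero>"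
      using Cons.prems(2)[of r b] Cons.prems(5) b w unfolding affine_on_def by auto
    have "(\<Oplus>i\<in>J. c i \<otimes> monomial_at Q x m i \<otimes> (alt_sign b T \<otimes> \<Phi> i r b \<otimes> minor (\<Phi> i) rs (T - {b})))
        = (\<Oplus>i\<in>J. alt_sign b T \<otimes> (w i \<otimes> \<Phi> i r b))"
      using cc mc fc' \<Phi> b by (intro finsum_cong') (auto simp: w_def m_ac)
    also have "\<dots> = alt_sign b T \<otimes> (\<Oplus>i\<in>J. w i \<otimes> \<Phi> i r b)"
      using w \<Phi> b assms(1) by (intro finsum_rdistr[symmetric]) auto
    finally show ?thesis using z by simp
  qed
  have "(\<Oplus>i\<in>J. c i \<otimes> monomial_at Q x m i \<otimes> minor (\<Phi> i) (r # rs) T)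
      = (\<Oplus>i\<in>J. \<Oplus>b\<in>T. c i \<otimes> monomial_at Q x m i \<otimes> (alt_sign b T \<otimes> \<Phi> i r b \<otimes> minor (\<Phi> i) rs (T - {b})))"
    unfolding minor.simps using finT cc mc fc' \<Phi>
    by (intro finsum_cong' finsum_rdistr) (auto intro!: finsum_closed)
  also have "\<dots> = (\<Oplus>b\<in>T. \<Oplus>i\<in>J. c i \<otimes> monomial_at Q x m i \<otimes> (alt_sign b T \<otimes> \<Phi> i r b \<otimes> minor (\<Phi> i) rs (T - {b})))"
    using finT assms(1) cc mc fc' \<Phi> by (intro finsum_swap) auto
  also have "\<dots> = (\<Oplus>b\<in>T. \<zero>)"
    using 1 by (intro finsum_cong') auto
  finally show ?case by simp
qed

text \<open>
  For each \<open>j\<close>, a nonzero maximal minor of \<open>\<Phi> j j\<close> is a polynomial of degree at most \<open>card Q\<close> that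
  vanishes at all points except \<open>j\<close>. Hence the vectors of monomial values at the points are linearly
  independent.
\<close>

lemma (in field) card_le_four_power:
  fixes Q :: "'q::linorder set"
  assumes "finite J" "finite Q" "\<And>i p. i \<in> J \<Longrightarrow> p \<in> Q \<Longrightarrow> x i p \<in> carrier R"
    and \<Phi>: "\<And>j i r b. j \<in> J \<Longrightarrow> i \<in> J \<Longrightarrow> r \<in> Rows \<Longrightarrow> b \<in> Q \<Longrightarrow> \<Phi> j i r b \<in> carrier R"
    and aff: "\<And>j r b. j \<in> J \<Longrightarrow> r \<in> Rows \<Longrightarrow> b \<in> Q \<Longrightarrow> affine_on J Q x (\<lambda>i. \<Phi> j i r b)"
    and sing: "\<And>i j. i \<in> J \<Longrightarrow> j \<in> J \<Longrightarrow> i \<noteq> j \<Longrightarrow>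
      \<exists>X\<in>Q \<rightarrow> carrier R. (\<exists>b\<in>Q. X b \<noteq> \<zero>) \<and> (\<forall>r\<in>Rows. (\<Oplus>b\<in>Q. \<Phi> j i r b \<otimes> X b) = \<zero>)"
    and reg: "\<And>j X b. j \<in> J \<Longrightarrow> X \<in> Q \<rightarrow> carrier R \<Longrightarrow>
      (\<And>r. r \<in> Rows \<Longrightarrow> (\<Oplus>b\<in>Q. \<Phi> j j r b \<otimes> X b) = \<zero>) \<Longrightarrow> b \<in> Q \<Longrightarrow> X b = \<zero>"
  shows "card J \<le> 4 ^ card Q"
proof (rule ccontr)
  let ?n = "card Q"
  have exps: "finite (exponents Q ?n)" "card (exponents Q ?n) \<le> 2 ^ (?n + ?n)"
    using card_exponents[OF assms(2), of ?n] by auto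
  have four: "(2 :: nat) ^ (?n + ?n) = 4 ^ ?n" by (simp add: power_add flip: power_mult_distrib)
  assume "\<not> card J \<le> 4 ^ ?n"
  then have "card (exponents Q ?n) < card J" using exps four by simp
  then have "\<exists>c\<in>J \<rightarrow> carrier R. (\<exists>j\<in>J. c j \<noteq> \<zero>) \<and>
      (\<forall>m\<in>exponents Q ?n. (\<Oplus>j\<in>J. c j \<otimes> monomial_at Q x m j) = \<zero>)"
    using exps(1) assms(1,3) by (intro homogeneous_system monomial_at_closed)
  then obtain c where c: "c \<in> J \<rightarrow> carrier R" "\<exists>j\<in>J. c j \<noteq> \<zero>"
      "\<And>m. m \<in> exponents Q ?n \<Longrightarrow> (\<Oplus>j\<in>J. c j \<otimes> monomial_at Q x m j) = \<zero>"
    by blast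
  then obtain j where j: "j \<in> J" "c j \<noteq> \<zero>" by blast
  have "\<exists>rs. set rs \<subseteq> Rows \<and> length rs = ?n \<and> minor (\<Phi> j j) rs Q \<noteq> \<zero>"
    by (rule exists_nonzero_minor) (use assms(2) \<Phi> reg j in auto)
  then obtain rs where rs: "set rs \<subseteq> Rows" "length rs = ?n" "minor (\<Phi> j j) rs Q \<noteq> \<zero>"
    by blast
  have cl: "\<And>i. i \<in> J \<Longrightarrow> minor (\<Phi> j i) rs Q \<in> carrier R"
    using \<Phi> rs j by (intro minor_closed) auto
  \<comment> \<open>The constant monomial leaves the whole degree \<open>card Q\<close> to the
    minor.\<close>
  have m0: "(\<lambda>_ :: 'q. 0 :: nat) \<in> exponents Q 0" by (simp add: exponents_def)
  have "\<zero> = (\<Oplus>i\<in>J. c i \<otimes> monomial_at Q x (\<lambda>_. 0) i \<otimes> minor (\<Phi> j i) rs Q)"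
    by (rule minor_annihilated[OF assms(1-3) c(1) c(3) _ _ m0, symmetric]) (use rs j \<Phi> aff in auto)
  also have "\<dots> = (\<Oplus>i\<in>J. c i \<otimes> minor (\<Phi> j i) rs Q)"
    using c(1) cl by (intro finsum_cong') (auto simp: monomial_at_def Pi_iff)
  also have "\<dots> = (\<Oplus>i\<in>insert j (J - {j}). c i \<otimes> minor (\<Phi> j i) rs Q)"
    using j by (simp add: insert_absorb)
  also have "\<dots> = c j \<otimes> minor (\<Phi> j j) rs Q \<oplus> (\<Oplus>i\<in>J - {j}. c i \<otimes> minor (\<Phi> j i) rs Q)"
    using assms(1) c(1) cl j by (intro finsum_insert) auto
  \<comment> \<open>At every other point the matrix has a nonzero kernel vector, so only the term of
    \<open>j\<close> survives.\<close>
  also have "(\<Oplus>i\<in>J - {j}. c i \<otimes> minor (\<Phi> j i) rs Q) = (\<Oplus>i\<in>J - {j}. \<zero>)"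
  proof (intro finsum_cong')
    fix i assume i: "i \<in> J - {j}"
    then obtain X where X: "X \<in> Q \<rightarrow> carrier R" "\<exists>b\<in>Q. X b \<noteq> \<zero>"
        "\<And>r. r \<in> Rows \<Longrightarrow> (\<Oplus>b\<in>Q. \<Phi> j i r b \<otimes> X b) = \<zero>"
      using sing[of i j] j by blast
    then obtain b where "b \<in> Q" "X b \<noteq> \<zero>" by blast
    then have "minor (\<Phi> j i) rs Q = \<zero>"
      using i rs j \<Phi> X by (intro minor_eq_zero[of Q rs _ X b] assms(2)) auto
    then show "c i \<otimes> minor (\<Phi> j i) rs Q = \<zero>" using i c(1) by (auto simp: Pi_iff)
  qed auto
  finally have "c j \<otimes> minor (\<Phi> j j) rs Q = \<zero>"
    using c(1) cl j by (simp add: Pi_def)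
  then show False
    using c(1) cl j rs(3) by (auto simp: integral_iff Pi_def)
qed

section \<open>Counting echelon shapes\<close>

text \<open>The free entries of a reduced echelon basis with pivot set \<open>S\<close>. A pivot is
  the largest index at which its basis vector is nonzero, so the free entries lie at smaller
  nonpivots.\<close>

definition echelon_cells :: "'i::linorder set \<Rightarrow> 'i set \<Rightarrow> ('i \<times> 'i) set" where
  "echelon_cells I S = {(s, c). s \<in> S \<and> c \<in> I - S \<and> c < s}"

text \<open>Gaussian binomial coefficients at \<open>4\<close>, by the Pascal rule.\<close>

fun gauss4 :: "nat \<Rightarrow> nat \<Rightarrow> nat" where
  "gauss4 d 0 = 1"
| "gauss4 0 (Suc e) = 0"
| "gauss4 (Suc d) (Suc e) = gauss4 d e + 4 ^ Suc e * gauss4 d (Suc e)"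

lemma gauss4_eq_0: "d < e \<Longrightarrow> gauss4 d e = 0"
  by (induction d e rule: gauss4.induct) auto

lemma gauss4_self [simp]: "gauss4 d d = 1"
  by (induction d) (auto simp: gauss4_eq_0)

text \<open>Split off the largest index \<open>m\<close>. As a nonpivot it has no pivot above it and
  adds no cell; as a pivot it adds one cell for each of the \<open>e\<close> nonpivots. This is the
  Pascal rule.\<close>

lemma sum_echelon_cells:
  fixes I :: "'i::linorder set"
  assumes "finite I"
  shows "(\<Sum>S | S \<subseteq> I \<and> card (I - S) = e. 4 ^ card (echelon_cells I S)) = gauss4 (card I) e"
  using assms
proof (induction I arbitrary: e rule: finite_linorder_max_induct)
  case empty
  show ?case
  proof (cases e)
    case 0
    then have "{S. S \<subseteq> ({} :: 'i set) \<and> card ({} - S) = e} = {{}}" by auto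
    then show ?thesis by (simp add: echelon_cells_def 0)
  next
    case (Suc e')
    then have "{S. S \<subseteq> ({} :: 'i set) \<and> card ({} - S) = e} = {}" by auto
    then show ?thesis using Suc by simp
  qed
next
  case (insert m I)
  have m: "m \<notin> I" "\<And>x. x \<in> I \<Longrightarrow> x < m" "\<And>x. x \<in> I \<Longrightarrow> \<not> m < x"
    using insert.hyps by (auto simp: not_less less_imp_le)
  define A where "A = {S. S \<subseteq> I \<and> Suc (card (I - S)) = e}"
  define B where "B = {S. S \<subseteq> I \<and> card (I - S) = e}"
  have fin: "finite A" "finite B" using insert.hyps by (auto simp: A_def B_def)
  have "{S. S \<subseteq> insert m I \<and> card (insert m I - S) = e} = A \<union> insert m ` B"
  proof (intro equalityI subsetI)
    fix S assume "S \<in> {S. S \<subseteq> insert m I \<and> card (insert m I - S) = e}"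
    then have S: "S \<subseteq> insert m I" "card (insert m I - S) = e" by auto
    show "S \<in> A \<union> insert m ` B"
    proof (cases "m \<in> S")
      case True
      then have "insert m I - S = I - (S - {m})" "S = insert m (S - {m})" using m by auto
      then show ?thesis using S by (auto simp: B_def intro!: image_eqI[of _ _ "S - {m}"])
    next
      case False
      then have "insert m I - S = insert m (I - S)" by auto
      then show ?thesis using S False m insert.hyps by (auto simp: A_def)
    qed
  next
    fix S assume "S \<in> A \<union> insert m ` B"
    then consider "S \<in> A" | T where "T \<in> B" "S = insert m T" by auto
    then show "S \<in> {S. S \<subseteq> insert m I \<and> card (insert m I - S) = e}"
    proof cases
      case 1
      then have "insert m I - S = insert m (I - S)" using m by (auto simp: A_def)
      then show ?thesis using 1 m insert.hyps by (auto simp: A_def)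
    next
      case 2
      then have "insert m I - S = I - T" using m by auto
      then show ?thesis using 2 by (auto simp: B_def)
    qed
  qed
  moreover have "A \<inter> insert m ` B = {}" using m by (auto simp: A_def)
  moreover have "inj_on (insert m) B"
    using m by (intro inj_onI) (auto simp: B_def dest: insert_ident[THEN iffD1, rotated 2])
  ultimately have "(\<Sum>S | S \<subseteq> insert m I \<and> card (insert m I - S) = e. 4 ^ card (echelon_cells (insert m I) S))
      = (\<Sum>S\<in>A. 4 ^ card (echelon_cells (insert m I) S))
        + (\<Sum>S\<in>B. (4 :: nat) ^ card (echelon_cells (insert m I) (insert m S)))"
    using fin by (simp add: sum.union_disjoint sum.reindex)
  also have "(\<Sum>S\<in>A. 4 ^ card (echelon_cells (insert m I) S)) = (\<Sum>S\<in>A. 4 ^ card (echelon_cells I S))"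
  proof (intro sum.cong refl)
    fix S assume "S \<in> A"
    then have "echelon_cells (insert m I) S = echelon_cells I S"
      using m by (auto simp: A_def echelon_cells_def)
    then show "4 ^ card (echelon_cells (insert m I) S) = 4 ^ card (echelon_cells I S)" by simp
  qed
  also have "(\<Sum>S\<in>B. (4 :: nat) ^ card (echelon_cells (insert m I) (insert m S)))
      = (\<Sum>S\<in>B. 4 ^ e * 4 ^ card (echelon_cells I S))"
  proof (intro sum.cong refl)
    fix S assume S: "S \<in> B"
    have eq: "echelon_cells (insert m I) (insert m S) = Pair m ` (I - S) \<union> echelon_cells I S"
    proof (rule Set.set_eqI)
      fix p :: "'i \<times> 'i"
      obtain s c where p: "p = (s, c)" by fastforce
      have "s \<in> S \<Longrightarrow> s \<noteq> m" "S \<subseteq> I" using m S by (auto simp: B_def)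
      then show "p \<in> echelon_cells (insert m I) (insert m S) \<longleftrightarrow> p \<in> Pair m ` (I - S) \<union> echelon_cells I S"
        unfolding p echelon_cells_def using m(1) m(2)[of c] by (cases "s = m"; cases "c = m") auto
    qed
    have "finite (echelon_cells I S)"
      using S by (intro finite_subset[OF _ finite_cartesian_product[OF insert.hyps(1) insert.hyps(1)]])
        (auto simp: B_def echelon_cells_def)
    moreover have "Pair m ` (I - S) \<inter> echelon_cells I S = {}"
      using m(1) S by (auto simp: B_def echelon_cells_def)
    moreover have "card (Pair m ` (I - S)) = e"
      using S by (simp add: card_image inj_on_def B_def)
    ultimately have "card (echelon_cells (insert m I) (insert m S)) = e + card (echelon_cells I S)"
      unfolding eq using insert.hyps(1) by (subst card_Un_disjoint) auto
    then show "(4 :: nat) ^ card (echelon_cells (insert m I) (insert m S)) = 4 ^ e * 4 ^ card (echelon_cells I S)"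
      by (simp add: power_add)
  qed
  also have "\<dots> = 4 ^ e * gauss4 (card I) e"
    unfolding sum_distrib_left[symmetric] B_def insert.IH ..
  also have "(\<Sum>S\<in>A. 4 ^ card (echelon_cells I S)) = (if e = 0 then 0 else gauss4 (card I) (e - 1))"
  proof (cases e)
    case (Suc e')
    then have "A = {S. S \<subseteq> I \<and> card (I - S) = e'}" by (auto simp: A_def)
    then show ?thesis using insert.IH[of e'] Suc by simp
  qed (simp add: A_def)
  also have "(if e = 0 then 0 else gauss4 (card I) (e - 1)) + 4 ^ e * gauss4 (card I) e
      = gauss4 (card (insert m I)) e"
    using insert.hyps m by (cases e) auto
  finally show ?case .
qed

text \<open>By the product formula the Gaussian binomial coefficient is at most 4^(u e) times the
  product of the factors 1 / (1 - 4^(-i)), each of which is at most 4/3. The induction by the Pascal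
  rule calls for a sharper form with the correction factor 1 - 4^(-u - 1), which excludes
  \<open>e = 0\<close>.\<close>

lemma gauss4_bound:
  "1 \<le> e \<Longrightarrow> 3 ^ e * 4 ^ Suc u * real (gauss4 (u + e) e) \<le> 4 ^ (e * Suc u) * (4 ^ Suc u - 1)"
proof (induction "u + e" arbitrary: u e)
  case 0
  then show ?case by simp
next
  case (Suc d)
  show ?case
  proof (cases u)
    case 0
    have "(3::real) ^ e * 4 \<le> 4 ^ e * 3"
      using Suc.prems
    proof (induction e rule: dec_induct)
      case (step n)
      then show ?case by simp
    qed simp
    then show ?thesis using 0 by simp
  next
    case (Suc v)
    obtain f where e: "e = Suc f" using Suc.prems by (cases e) auto
    define t :: real where "t = 4 ^ u"
    have t: "t \<ge> 1" "4 ^ Suc u = 4 * t" "4 ^ Suc v = t"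
      by (simp add: t_def) (simp_all add: t_def Suc)
    define P where "P = (4 * t) ^ f"
    have P: "P > 0" using t by (simp add: P_def)
    have pe: "4 ^ (e * Suc u) = P * (4 * t)" "(4::real) ^ (f * Suc u) = P"
      unfolding P_def t(2)[symmetric] e
      by (metis power_Suc2 power_mult mult.commute) (metis power_mult mult.commute)
    have te: "4 ^ (e * Suc v) = t ^ e"
      unfolding t(3)[symmetric] by (metis power_mult mult.commute)
    have "d = v + e" using Suc.hyps(2) Suc by simp
    then have IH1: "3 ^ e * t * real (gauss4 (v + e) e) \<le> t ^ e * (t - 1)"
      using Suc.hyps(1)[of v e] Suc.prems unfolding te t(3) by simp
    have rec: "real (gauss4 (u + e) e) = real (gauss4 (u + f) f) + 4 ^ e * real (gauss4 (v + e) e)"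
      by (simp add: e Suc)
    have "4 ^ e * t ^ e = P * (4 * t)"
      unfolding P_def e by (simp add: power_mult_distrib)
    then have b1: "4 * 4 ^ e * (3 ^ e * t * real (gauss4 (v + e) e)) \<le> 4 * (P * (4 * t) * (t - 1))"
      using mult_left_mono[OF IH1, of "4 * 4 ^ e"] by (simp add: algebra_simps)
    \<comment> \<open>This summand is bounded without the correction factor, so that
      \<open>f = 0\<close>, to which the induction hypothesis does not apply, is covered as
      well.\<close>
    have b0: "3 ^ e * (4 * t) * real (gauss4 (u + f) f) \<le> P * (12 * t)"
    proof (cases f)
      case 0
      then show ?thesis by (simp add: e P_def)
    next
      case (Suc f')
      then have "3 ^ f * 4 ^ Suc u * real (gauss4 (u + f) f) \<le> 4 ^ (f * Suc u) * (4 ^ Suc u - 1)"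
        using Suc.hyps(1)[of u f] \<open>Suc d = u + e\<close> e by simp
      then have "3 ^ f * (4 * t) * real (gauss4 (u + f) f) \<le> P * (4 * t - 1)"
        unfolding pe t(2) by simp
      then show ?thesis using P by (simp add: e algebra_simps)
    qed
    have "3 ^ e * 4 ^ Suc u * real (gauss4 (u + e) e)
        = 3 ^ e * (4 * t) * real (gauss4 (u + f) f) + 4 * 4 ^ e * (3 ^ e * t * real (gauss4 (v + e) e))"
      unfolding rec t(2) by (simp add: algebra_simps)
    also have "\<dots> \<le> P * (12 * t) + 4 * (P * (4 * t) * (t - 1))"
      using b0 b1 by (rule add_mono)
    \<comment> \<open>12 t + 16 t (t - 1) = 4 t (4 t - 1), so the correction of the other summand
      alone reproduces the required one.\<close>
    also have "\<dots> = P * (4 * t) * (4 * t - 1)" by (simp add: algebra_simps)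
    finally show ?thesis unfolding pe t(2) .
  qed
qed

lemma gauss4_le: "3 ^ e * real (gauss4 (u + e) e) \<le> 4 ^ e * 4 ^ (u * e)"
proof (cases "e = 0")
  case False
  then have "3 ^ e * 4 ^ Suc u * real (gauss4 (u + e) e) \<le> 4 ^ (e * Suc u) * (4 ^ Suc u - 1)"
    by (intro gauss4_bound) simp
  also have "\<dots> \<le> 4 ^ (e * Suc u) * 4 ^ Suc u" by simp
  finally have "4 ^ Suc u * (3 ^ e * real (gauss4 (u + e) e)) \<le> 4 ^ Suc u * (4 ^ e * 4 ^ (u * e))"
    by (simp add: power_add algebra_simps)
  then show ?thesis by (rule mult_left_le_imp_le) simp
qed simp

lemma sum_four_power_cells_le:
  fixes I :: "'i::linorder set"
  assumes "finite I"
  shows "(\<Sum>S\<in>Pow I - {I}. 4 ^ card (echelon_cells I S) * 2 ^ ((card S)\<^sup>2)) \<le> (2 :: nat) ^ ((card I)\<^sup>2)"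
proof -
  let ?d = "card I"
  let ?F = "\<lambda>S. (4 :: nat) ^ card (echelon_cells I S) * 2 ^ ((card S)\<^sup>2)"
  have pos: "card (I - S) \<in> {1..?d}" if "S \<in> Pow I - {I}" for S
  proof -
    have "I - S \<noteq> {}" using that by auto
    then show ?thesis using assms by (simp add: card_gt_0_iff Suc_le_eq card_mono)
  qed
  have "(\<Sum>S\<in>Pow I - {I}. ?F S) = (\<Sum>e\<in>{1..?d}. \<Sum>S | S \<in> Pow I - {I} \<and> card (I - S) = e. ?F S)"
    using assms pos by (intro sum.group[symmetric] finite_Diff finite_atLeastAtMost image_subsetI)
      (simp_all only: finite_Pow_iff)
  also have "\<dots> = (\<Sum>e\<in>{1..?d}. gauss4 ?d e * 2 ^ ((?d - e)\<^sup>2))"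
  proof (intro sum.cong refl)
    fix e assume e: "e \<in> {1..?d}"
    have "(\<Sum>S | S \<in> Pow I - {I} \<and> card (I - S) = e. ?F S)
        = (\<Sum>S | S \<subseteq> I \<and> card (I - S) = e. 4 ^ card (echelon_cells I S) * 2 ^ ((?d - e)\<^sup>2))"
    proof (intro sum.cong)
      fix S assume "S \<in> {S. S \<subseteq> I \<and> card (I - S) = e}"
      then have S: "S \<subseteq> I" "card (I - S) = e" by auto
      then have "card S = ?d - e"
        using card_Diff_subset[OF finite_subset[OF S(1) assms] S(1)] card_mono[OF assms S(1)] by linarith
      then show "?F S = 4 ^ card (echelon_cells I S) * 2 ^ ((?d - e)\<^sup>2)" by simp
    qed (use e in auto)
    then show "(\<Sum>S | S \<in> Pow I - {I} \<and> card (I - S) = e. ?F S) = gauss4 ?d e * 2 ^ ((?d - e)\<^sup>2)"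
      using sum_echelon_cells[OF assms] by (simp flip: sum_distrib_right)
  qed
  finally have eq: "(\<Sum>S\<in>Pow I - {I}. ?F S) = (\<Sum>e\<in>{1..?d}. gauss4 ?d e * 2 ^ ((?d - e)\<^sup>2))" .
  have "real (gauss4 ?d e * 2 ^ ((?d - e)\<^sup>2)) \<le> 2 ^ (?d\<^sup>2) * (2 * (1 / 3) ^ e)" if e: "e \<in> {1..?d}" for e
  proof -
    define u where "u = ?d - e"
    have d: "?d = u + e" using e by (simp add: u_def)
    \<comment> \<open>This is (e - 1)^2 >= 0. It serves to replace (4/3)^e 2^(-e^2) by 2 / 3^e, and
      these numbers sum to 1 over \<open>e \<ge> 1\<close>.\<close>
    have "2 * e \<le> e\<^sup>2 + 1"
      using zero_le_power2[of "int e - 1"] by (simp add: power2_diff flip: of_nat_le_iff[where 'a = int])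
    then have "(4::real) ^ e \<le> 2 * 2 ^ (e\<^sup>2)"
      using power_increasing[of "2 * e" "e\<^sup>2 + 1" "2 :: real"] by (simp add: power_mult)
    then have "4 ^ e * 4 ^ (u * e) * 2 ^ (u\<^sup>2) \<le> 2 * 2 ^ (e\<^sup>2) * 4 ^ (u * e) * (2::real) ^ (u\<^sup>2)"
      by (intro mult_right_mono) auto
    also have "(2::real) * 2 ^ (e\<^sup>2) * 4 ^ (u * e) * 2 ^ (u\<^sup>2) = 2 * 2 ^ (?d\<^sup>2)"
    proof -
      have "(4::real) ^ (u * e) = 2 ^ (2 * u * e)" by (simp add: power_mult mult.assoc)
      then show ?thesis by (simp add: d power2_sum power_add)
    qed
    finally have b: "4 ^ e * 4 ^ (u * e) * 2 ^ (u\<^sup>2) \<le> (2::real) * 2 ^ (?d\<^sup>2)" .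
    have "3 ^ e * real (gauss4 ?d e) * 2 ^ (u\<^sup>2) \<le> 2 * 2 ^ (?d\<^sup>2)"
      unfolding d by (rule order_trans[OF mult_right_mono[OF gauss4_le] b[unfolded d]]) simp
    then show ?thesis by (simp add: u_def field_simps power_divide)
  qed
  then have "real (\<Sum>S\<in>Pow I - {I}. ?F S) \<le> (\<Sum>e\<in>{1..?d}. 2 ^ (?d\<^sup>2) * (2 * (1 / 3) ^ e))"
    unfolding eq of_nat_sum by (rule sum_mono)
  also have "\<dots> = 2 ^ (?d\<^sup>2) * (\<Sum>e\<in>{1..?d}. 2 * (1 / 3) ^ e)"
    by (rule sum_distrib_left[symmetric])
  also have "(\<Sum>e\<in>{1..n}. 2 * (1 / 3 :: real) ^ e) = 1 - (1 / 3) ^ n" for n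
    by (induction n) (auto simp: field_simps)
  also have "(2::real) ^ (?d\<^sup>2) * (1 - (1 / 3) ^ ?d) \<le> 2 ^ (?d\<^sup>2) * 1"
    by (intro mult_left_mono) auto
  finally have "real (\<Sum>S\<in>Pow I - {I}. ?F S) \<le> real (2 ^ (?d\<^sup>2))" by simp
  then show ?thesis by (simp only: of_nat_le_iff)
qed

section \<open>Modules with trivial Hom spaces\<close>

lemma right_module_additive_subgroup:
  assumes "right_module A M" "Module.submodule N A M"
  shows "abelian_subgroup N M"
  using assms by (intro abelian_subgroupI3 additive_subgroup.intro)
    (auto simp: right_module_def Module.submodule_def)

section \<open>Restriction to submodules and passage to quotients\<close>

context right_module
begin

lemma submodule_closed:
  assumes "Module.submodule N A M"
  shows "N \<subseteq> carrier M" "\<zero>\<^bsub>M\<^esub> \<in> N"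
    "x \<in> N \<Longrightarrow> y \<in> N \<Longrightarrow> x \<oplus>\<^bsub>M\<^esub> y \<in> N" "x \<in> N \<Longrightarrow> \<ominus>\<^bsub>M\<^esub> x \<in> N"
    "x \<in> N \<Longrightarrow> y \<in> N \<Longrightarrow> x \<ominus>\<^bsub>M\<^esub> y \<in> N"
    "a \<in> carrier A \<Longrightarrow> x \<in> N \<Longrightarrow> a \<odot>\<^bsub>M\<^esub> x \<in> N"
proof -
  interpret abelian_subgroup N M
    by (rule right_module_additive_subgroup[OF right_module_axioms assms])
  show "N \<subseteq> carrier M" "\<zero>\<^bsub>M\<^esub> \<in> N" by auto
  show add: "x \<in> N \<Longrightarrow> y \<in> N \<Longrightarrow> x \<oplus>\<^bsub>M\<^esub> y \<in> N" for x y by simp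
  show neg: "x \<in> N \<Longrightarrow> \<ominus>\<^bsub>M\<^esub> x \<in> N" for x by simp
  show "x \<in> N \<Longrightarrow> y \<in> N \<Longrightarrow> x \<ominus>\<^bsub>M\<^esub> y \<in> N" unfolding a_minus_def by simp
  show "a \<in> carrier A \<Longrightarrow> x \<in> N \<Longrightarrow> a \<odot>\<^bsub>M\<^esub> x \<in> N"
    using assms by (rule Module.submodule.smult_closed)
qed

lemma right_module_restrict:
  assumes "Module.submodule N A M"
  shows "right_module A (M\<lparr>carrier := N\<rparr>)"
proof (intro right_module.intro right_module_axioms.intro R.ring_axioms)
  show "abelian_group (M\<lparr>carrier := N\<rparr>)"
  proof (intro abelian_groupI)
    fix x assume "x \<in> carrier (M\<lparr>carrier := N\<rparr>)"
    then show "\<exists>y\<in>carrier (M\<lparr>carrier := N\<rparr>). y \<oplus>\<^bsub>M\<lparr>carrier := N\<rparr>\<^esub> x = \<zero>\<^bsub>M\<lparr>carrier := N\<rparr>\<^esub>"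
      using submodule_closed[OF assms] by (intro bexI[of _ "\<ominus>\<^bsub>M\<^esub> x"]) (auto simp: M.l_neg)
  qed (use submodule_closed[OF assms] in \<open>auto simp: M.a_ac subset_iff\<close>)
qed (use submodule_closed[OF assms] in
  \<open>auto simp: right_smult_add_ring right_smult_add_module right_smult_assoc right_smult_one subset_iff\<close>)

lemma submodule_restrict_iff:
  assumes "Module.submodule U A M"
  shows "Module.submodule N A (M\<lparr>carrier := U\<rparr>) \<longleftrightarrow> Module.submodule N A M \<and> N \<subseteq> U"
proof -
  interpret U: right_module A "M\<lparr>carrier := U\<rparr>" by (rule right_module_restrict[OF assms])
  show ?thesis
  proof safe
    assume N: "Module.submodule N A (M\<lparr>carrier := U\<rparr>)"
    note c = U.submodule_closed[OF N] submodule_closed[OF assms]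
    \<comment> \<open>The inverse in the restricted record is described relative to the smaller
      carrier, so its agreement with the inverse in \<open>M\<close> has to be shown.\<close>
    have neg: "\<ominus>\<^bsub>M\<^esub> x \<in> N" if x: "x \<in> N" for x
    proof -
      have "\<ominus>\<^bsub>M\<lparr>carrier := U\<rparr>\<^esub> x \<in> N" using c x by auto
      moreover have "\<ominus>\<^bsub>M\<lparr>carrier := U\<rparr>\<^esub> x \<oplus>\<^bsub>M\<^esub> x = \<zero>\<^bsub>M\<^esub>"
        using U.M.l_neg[of x] c x by auto
      moreover have "\<And>y. y \<in> N \<Longrightarrow> y \<in> carrier M" using c by auto
      ultimately show ?thesis
        using M.minus_equality[of "\<ominus>\<^bsub>M\<lparr>carrier := U\<rparr>\<^esub> x" x] x by metis
    qed
    show "Module.submodule N A M"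
    proof (intro Module.submodule.intro subgroup.intro Module.submodule_axioms.intro)
      show "x \<in> N \<Longrightarrow> inv\<^bsub>add_monoid M\<^esub> x \<in> N" for x
        using neg by (simp add: a_inv_def)
    qed (use c in \<open>auto simp: subset_iff\<close>)
    show "x \<in> N \<Longrightarrow> x \<in> U" for x using c by auto
  next
    assume N: "Module.submodule N A M" "N \<subseteq> U"
    note c = submodule_closed[OF N(1)] submodule_closed[OF assms]
    have neg: "\<ominus>\<^bsub>M\<lparr>carrier := U\<rparr>\<^esub> x \<in> N" if x: "x \<in> N" for x
    proof -
      have "\<ominus>\<^bsub>M\<lparr>carrier := U\<rparr>\<^esub> x = \<ominus>\<^bsub>M\<^esub> x"
      proof -
        have "x \<in> U" "x \<in> carrier M" "\<ominus>\<^bsub>M\<^esub> x \<in> U" using c x N by auto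
        then show ?thesis using U.M.minus_equality[of "\<ominus>\<^bsub>M\<^esub> x" x] M.l_neg[of x] by simp
      qed
      then show ?thesis using c(4)[OF x] by simp
    qed
    show "Module.submodule N A (M\<lparr>carrier := U\<rparr>)"
    proof (intro Module.submodule.intro subgroup.intro Module.submodule_axioms.intro)
      show "x \<in> N \<Longrightarrow> inv\<^bsub>add_monoid (M\<lparr>carrier := U\<rparr>)\<^esub> x \<in> N" for x
        using neg[of x] unfolding a_inv_def by simp
    qed (use c N in \<open>auto simp: subset_iff\<close>)
  qed
qed

lemma quotient_module_add:
  assumes "Module.submodule N A M" "x \<in> carrier M" "y \<in> carrier M"
  shows "(N +>\<^bsub>M\<^esub> x) \<oplus>\<^bsub>quotient_module M N\<^esub> (N +>\<^bsub>M\<^esub> y) = N +>\<^bsub>M\<^esub> (x \<oplus>\<^bsub>M\<^esub> y)"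
proof -
  interpret N: abelian_subgroup N M
    by (rule right_module_additive_subgroup[OF right_module_axioms assms(1)])
  show ?thesis
    using N.a_rcos_sum[OF assms(2,3)] by (simp add: quotient_module_def)
qed

text \<open>All cosets in the union that defines the action coincide, because \<open>N\<close> is
  closed under the action.\<close>

lemma quotient_module_smult:
  assumes "Module.submodule N A M" "x \<in> carrier M" "a \<in> carrier A"
  shows "a \<odot>\<^bsub>quotient_module M N\<^esub> (N +>\<^bsub>M\<^esub> x) = N +>\<^bsub>M\<^esub> (a \<odot>\<^bsub>M\<^esub> x)"
proof -
  interpret N: abelian_subgroup N M
    by (rule right_module_additive_subgroup[OF right_module_axioms assms(1)])
  have "N +>\<^bsub>M\<^esub> (a \<odot>\<^bsub>M\<^esub> y) = N +>\<^bsub>M\<^esub> (a \<odot>\<^bsub>M\<^esub> x)" if y: "y \<in> N +>\<^bsub>M\<^esub> x" for y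
  proof -
    obtain n where n: "n \<in> N" "y = n \<oplus>\<^bsub>M\<^esub> x"
      using y by (auto simp: a_r_coset_def' )
    have "a \<odot>\<^bsub>M\<^esub> y = a \<odot>\<^bsub>M\<^esub> n \<oplus>\<^bsub>M\<^esub> a \<odot>\<^bsub>M\<^esub> x"
      using n assms by (auto simp: right_smult_add_module)
    then have "a \<odot>\<^bsub>M\<^esub> y \<in> N +>\<^bsub>M\<^esub> (a \<odot>\<^bsub>M\<^esub> x)"
      using submodule_closed(6)[OF assms(1,3) n(1)] by (auto simp: a_r_coset_def')
    then show ?thesis
      using N.a_repr_independence'[of "a \<odot>\<^bsub>M\<^esub> y" "a \<odot>\<^bsub>M\<^esub> x"] assms right_smult_closed by auto
  qed
  moreover have "x \<in> N +>\<^bsub>M\<^esub> x" using N.a_rcos_self assms by auto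
  ultimately have "(\<Union>y\<in>N +>\<^bsub>M\<^esub> x. N +>\<^bsub>M\<^esub> (a \<odot>\<^bsub>M\<^esub> y)) = N +>\<^bsub>M\<^esub> (a \<odot>\<^bsub>M\<^esub> x)"
    by blast
  then show ?thesis by (simp add: quotient_module_def)
qed

lemma carrier_quotient_module: "carrier (quotient_module M N) = (\<lambda>x. N +>\<^bsub>M\<^esub> x) ` carrier M"
  by (auto simp: quotient_module_def A_RCOSETS_def')

lemma right_module_quotient:
  assumes "Module.submodule N A M"
  shows "right_module A (quotient_module M N)"
proof (intro right_module.intro right_module_axioms.intro R.ring_axioms)
  interpret N: abelian_subgroup N M
    by (rule right_module_additive_subgroup[OF right_module_axioms assms(1)])
  note simps = carrier_quotient_module quotient_module_add[OF assms]
  have zero: "\<zero>\<^bsub>quotient_module M N\<^esub> = N +>\<^bsub>M\<^esub> \<zero>\<^bsub>M\<^esub>"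
    using submodule_closed(1)[OF assms] by (simp add: quotient_module_def)
  show "abelian_group (quotient_module M N)"
  proof (intro abelian_groupI)
    fix C assume "C \<in> carrier (quotient_module M N)"
    then obtain x where "x \<in> carrier M" "C = N +>\<^bsub>M\<^esub> x" by (auto simp: simps)
    then show "\<exists>D\<in>carrier (quotient_module M N). D \<oplus>\<^bsub>quotient_module M N\<^esub> C = \<zero>\<^bsub>quotient_module M N\<^esub>"
      unfolding zero by (intro bexI[of _ "N +>\<^bsub>M\<^esub> (\<ominus>\<^bsub>M\<^esub> x)"]) (auto simp: simps M.l_neg)
  qed (auto simp: simps zero M.a_ac)
qed (use right_smult_closed in \<open>auto simp: carrier_quotient_module quotient_module_add[OF assms]
  quotient_module_smult[OF assms] right_smult_add_ring right_smult_add_module right_smult_assoc right_smult_one\<close>)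

end

text \<open>Vanishing of Hom in a pointwise form for homomorphisms that need not be extensional, so
  that compositions need no restriction to the carrier.\<close>

definition hom_trivial :: "('a, 'r) ring_scheme \<Rightarrow> ('a, 'm) module \<Rightarrow> ('a, 'n) module \<Rightarrow> bool" where
  "hom_trivial A M N \<longleftrightarrow> (\<forall>f\<in>module_hom A M N. \<forall>x\<in>carrier M. f x = \<zero>\<^bsub>N\<^esub>)"

lemma hom_trivialI:
  "(\<And>f x. f \<in> module_hom A M N \<Longrightarrow> x \<in> carrier M \<Longrightarrow> f x = \<zero>\<^bsub>N\<^esub>) \<Longrightarrow> hom_trivial A M N"
  by (auto simp: hom_trivial_def)

lemma module_hom_zero:
  assumes "right_module A M" "right_module A N" "f \<in> module_hom A M N"
  shows "f \<zero>\<^bsub>M\<^esub> = \<zero>\<^bsub>N\<^esub>"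
proof -
  interpret M: right_module A M by fact
  interpret N: right_module A N by fact
  have "f \<zero>\<^bsub>M\<^esub> \<in> carrier N" using assms(3) by (auto simp: module_hom_def)
  moreover have "f \<zero>\<^bsub>M\<^esub> \<oplus>\<^bsub>N\<^esub> f \<zero>\<^bsub>M\<^esub> = f \<zero>\<^bsub>M\<^esub>"
    using module_hom_add[OF assms(3), of "\<zero>\<^bsub>M\<^esub>" "\<zero>\<^bsub>M\<^esub>"] by simp
  ultimately show ?thesis by simp
qed

lemma hom_trivial_of_Hom:
  assumes "right_module A M" "Hom A M N = {zero_hom M N}"
  shows "hom_trivial A M N"
proof (rule hom_trivialI)
  interpret right_module A M by fact
  fix f x assume f: "f \<in> module_hom A M N" and x: "x \<in> carrier M"
  have "restrict f (carrier M) \<in> Hom A M N"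
    using f by (auto simp: Hom_def module_hom_def right_smult_closed)
  then have "restrict f (carrier M) x = zero_hom M N x" using assms(2) by simp
  then show "f x = \<zero>\<^bsub>N\<^esub>" using x by (simp add: zero_hom_def)
qed

text \<open>Left exactness of Hom(-, Y): a homomorphism that vanishes on \<open>N\<close> factors
  through the quotient.\<close>

lemma hom_trivial_extension_left:
  assumes "right_module A M" "right_module A Y" "Module.submodule N A M"
    and "hom_trivial A (M\<lparr>carrier := N\<rparr>) Y" "hom_trivial A (quotient_module M N) Y"
  shows "hom_trivial A M Y"
proof (rule hom_trivialI)
  interpret M: right_module A M by fact
  interpret Y: right_module A Y by fact
  interpret N: abelian_subgroup N M
    by (rule right_module_additive_subgroup[OF assms(1,3)])
  fix f x assume f: "f \<in> module_hom A M Y" and x: "x \<in> carrier M"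
  have "f \<in> module_hom A (M\<lparr>carrier := N\<rparr>) Y"
    using f M.submodule_closed(1)[OF assms(3)] by (auto simp: module_hom_def)
  then have fN: "f n = \<zero>\<^bsub>Y\<^esub>" if "n \<in> N" for n
    using assms(4) that by (auto simp: hom_trivial_def)
  \<comment> \<open>Any representative of the coset will do, since \<open>f\<close> vanishes on
    \<open>N\<close>.\<close>
  define g where "g C = f (SOME y. y \<in> C)" for C
  have g: "g (N +>\<^bsub>M\<^esub> y) = f y" if y: "y \<in> carrier M" for y
  proof -
    have "(SOME z. z \<in> N +>\<^bsub>M\<^esub> y) \<in> N +>\<^bsub>M\<^esub> y"
      using N.a_rcos_self[OF y] by (rule someI)
    then obtain n where "n \<in> N" "(SOME z. z \<in> N +>\<^bsub>M\<^esub> y) = n \<oplus>\<^bsub>M\<^esub> y"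
      by (auto simp: a_r_coset_def')
    then show ?thesis
      using f y fN by (auto simp: g_def module_hom_def Pi_iff)
  qed
  have "g \<in> module_hom A (quotient_module M N) Y"
    using f g by (auto simp: module_hom_def M.carrier_quotient_module M.quotient_module_add[OF assms(3)]
        M.quotient_module_smult[OF assms(3)] M.right_smult_closed)
  then have "g (N +>\<^bsub>M\<^esub> x) = \<zero>\<^bsub>Y\<^esub>"
    using assms(5) x by (auto simp: hom_trivial_def M.carrier_quotient_module)
  then show "f x = \<zero>\<^bsub>Y\<^esub>" using g x by simp
qed

text \<open>Left exactness of Hom(X, -): a homomorphism that vanishes modulo \<open>N\<close> has
  its values in \<open>N\<close>.\<close>

lemma hom_trivial_extension_right:
  assumes "right_module A M" "Module.submodule N A M"
    and "hom_trivial A X (M\<lparr>carrier := N\<rparr>)" "hom_trivial A X (quotient_module M N)"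
  shows "hom_trivial A X M"
proof (rule hom_trivialI)
  interpret M: right_module A M by fact
  interpret N: abelian_subgroup N M
    by (rule right_module_additive_subgroup[OF assms(1,2)])
  fix f x assume f: "f \<in> module_hom A X M" and x: "x \<in> carrier X"
  have fN: "f y \<in> N" if y: "y \<in> carrier X" for y
  proof -
    have "(\<lambda>z. N +>\<^bsub>M\<^esub> f z) \<in> module_hom A X (quotient_module M N)"
      using f by (auto simp: module_hom_def M.carrier_quotient_module M.quotient_module_add[OF assms(2)]
        M.quotient_module_smult[OF assms(2)] Pi_iff)
    then have "N +>\<^bsub>M\<^esub> f y = N"
      using assms(4) y by (auto simp: hom_trivial_def quotient_module_def)
    moreover have "f y \<in> N +>\<^bsub>M\<^esub> f y"
      using f y by (intro N.a_rcos_self) (auto simp: module_hom_def)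
    ultimately show ?thesis by simp
  qed
  then have "f \<in> module_hom A X (M\<lparr>carrier := N\<rparr>)"
    using f by (auto simp: module_hom_def)
  then show "f x = \<zero>\<^bsub>M\<^esub>" using assms(3) x by (auto simp: hom_trivial_def)
qed

lemma hom_trivial_iso_left:
  assumes "right_module A M" "module_isomorphic A M N" "hom_trivial A N Y"
  shows "hom_trivial A M Y"
proof (rule hom_trivialI)
  interpret M: right_module A M by fact
  fix f x assume f: "f \<in> module_hom A M Y" and x: "x \<in> carrier M"
  obtain h where h: "h \<in> module_hom A M N" "bij_betw h (carrier M) (carrier N)"
    using assms(2) by (auto simp: module_isomorphic_def Hom_def)
  define k where "k = the_inv_into (carrier M) h"
  have k: "k (h y) = y" if "y \<in> carrier M" for y
    using h(2) that by (simp add: k_def the_inv_into_f_f bij_betw_def)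
  have N: "carrier N = h ` carrier M" using h(2) by (simp add: bij_betw_def)
  have "k (h y \<oplus>\<^bsub>N\<^esub> h z) = y \<oplus>\<^bsub>M\<^esub> z" if "y \<in> carrier M" "z \<in> carrier M" for y z
    using k[of "y \<oplus>\<^bsub>M\<^esub> z"] that module_hom_add[OF h(1), of y z] by simp
  moreover have "k (a \<odot>\<^bsub>N\<^esub> h y) = a \<odot>\<^bsub>M\<^esub> y" if "y \<in> carrier M" "a \<in> carrier A" for y a
    using k[of "a \<odot>\<^bsub>M\<^esub> y"] that module_hom_smult[OF h(1), of a y] M.right_smult_closed by simp
  ultimately have "(\<lambda>y. f (k y)) \<in> module_hom A N Y"
    using f k by (auto simp: module_hom_def N)
  then show "f x = \<zero>\<^bsub>Y\<^esub>"
    using assms(3) k x unfolding hom_trivial_def N by fastforce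
qed

lemma hom_trivial_iso_right:
  assumes "right_module A M" "right_module A N" "module_isomorphic A M N" "hom_trivial A X N"
  shows "hom_trivial A X M"
proof (rule hom_trivialI)
  interpret M: right_module A M by fact
  fix f x assume f: "f \<in> module_hom A X M" and x: "x \<in> carrier X"
  obtain h where h: "h \<in> module_hom A M N" "bij_betw h (carrier M) (carrier N)"
    using assms(3) by (auto simp: module_isomorphic_def Hom_def)
  have "(\<lambda>y. h (f y)) \<in> module_hom A X N"
    using f h(1) by (auto simp: module_hom_def Pi_iff)
  then have "h (f x) = h \<zero>\<^bsub>M\<^esub>"
    using assms(4) x module_hom_zero[OF assms(1,2) h(1)] by (auto simp: hom_trivial_def)
  moreover have "f x \<in> carrier M" using f x by (auto simp: module_hom_def)
  ultimately show "f x = \<zero>\<^bsub>M\<^esub>"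
    using h(2) by (auto simp: bij_betw_def dest: inj_onD)
qed

lemma right_module_subquotient:
  assumes "right_module A M" "Module.submodule U A M" "Module.submodule V A M" "V \<subseteq> U"
  shows "right_module A (subquotient M U V)"
  unfolding subquotient_def using assms
  by (intro right_module.right_module_quotient right_module.right_module_restrict)
    (auto simp: right_module.submodule_restrict_iff)

lemma in_Filt_right_module: "in_Filt K A B M \<Longrightarrow> right_module A M"
  by (simp add: in_Filt_def fin_dim_right_module_def)

text \<open>Induction along the filtration: each step is an extension by a factor isomorphic to
  \<open>B\<close>.\<close>

lemma hom_trivial_Filt_left:
  assumes "in_Filt K A B M" "right_module A Y" "hom_trivial A B Y"
  shows "hom_trivial A M Y"
proof -
  interpret M: right_module A M using assms(1) by (rule in_Filt_right_module)
  obtain Ns where Ns: "Ns \<noteq> []" "hd Ns = {\<zero>\<^bsub>M\<^esub>}" "last Ns = carrier M"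
    "\<And>N. N \<in> set Ns \<Longrightarrow> Module.submodule N A M"
    "\<And>i. Suc i < length Ns \<Longrightarrow> Ns ! i \<subseteq> Ns ! Suc i \<and>
      module_isomorphic A (subquotient M (Ns ! Suc i) (Ns ! i)) B"
    using assms(1) by (auto simp: in_Filt_def)
  have "hom_trivial A (M\<lparr>carrier := Ns ! i\<rparr>) Y" if "i < length Ns" for i
    using that
  proof (induction i)
    case 0
    then have 0: "Ns ! 0 = {\<zero>\<^bsub>M\<^esub>}" "Module.submodule (Ns ! 0) A M"
      using Ns(1,2) Ns(4)[OF nth_mem[OF 0]] by (simp_all add: hd_conv_nth)
    show ?case
      using module_hom_zero[OF M.right_module_restrict[OF 0(2)] assms(2)]
      by (intro hom_trivialI) (auto simp: 0(1))
  next
    case (Suc i)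
    let ?U = "M\<lparr>carrier := Ns ! Suc i\<rparr>"
    have sub: "Module.submodule (Ns ! Suc i) A M" "Module.submodule (Ns ! i) A M"
      using Ns(4) Suc.prems by auto
    have rm: "right_module A (subquotient M (Ns ! Suc i) (Ns ! i))"
      using Ns(5)[OF Suc.prems] sub by (intro right_module_subquotient M.right_module_axioms) auto
    show ?case
    proof (rule hom_trivial_extension_left)
      show "right_module A ?U" by (rule M.right_module_restrict[OF sub(1)])
      show "Module.submodule (Ns ! i) A ?U"
        using sub Ns(5)[OF Suc.prems] by (auto simp: M.submodule_restrict_iff)
      show "hom_trivial A (?U\<lparr>carrier := Ns ! i\<rparr>) Y" using Suc by simp
      show "hom_trivial A (quotient_module ?U (Ns ! i)) Y"
        using Ns(5)[OF Suc.prems] rm assms(3)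
        unfolding subquotient_def by (auto intro: hom_trivial_iso_left)
    qed (rule assms(2))
  qed
  from this[of "length Ns - 1"] show ?thesis
    using Ns(1,3) by (simp add: last_conv_nth)
qed

lemma hom_trivial_Filt_right:
  assumes "in_Filt K A B M" "right_module A B" "hom_trivial A X B"
  shows "hom_trivial A X M"
proof -
  interpret M: right_module A M using assms(1) by (rule in_Filt_right_module)
  obtain Ns where Ns: "Ns \<noteq> []" "hd Ns = {\<zero>\<^bsub>M\<^esub>}" "last Ns = carrier M"
    "\<And>N. N \<in> set Ns \<Longrightarrow> Module.submodule N A M"
    "\<And>i. Suc i < length Ns \<Longrightarrow> Ns ! i \<subseteq> Ns ! Suc i \<and>
      module_isomorphic A (subquotient M (Ns ! Suc i) (Ns ! i)) B"
    using assms(1) by (auto simp: in_Filt_def)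
  have "hom_trivial A X (M\<lparr>carrier := Ns ! i\<rparr>)" if "i < length Ns" for i
    using that
  proof (induction i)
    case 0
    then have 0: "Ns ! 0 = {\<zero>\<^bsub>M\<^esub>}" using Ns by (auto simp: hd_conv_nth)
    show ?case by (auto simp: hom_trivial_def module_hom_def 0)
  next
    case (Suc i)
    let ?U = "M\<lparr>carrier := Ns ! Suc i\<rparr>"
    have sub: "Module.submodule (Ns ! Suc i) A M" "Module.submodule (Ns ! i) A M"
      using Ns(4) Suc.prems by auto
    have rm: "right_module A (subquotient M (Ns ! Suc i) (Ns ! i))"
      using Ns(5)[OF Suc.prems] sub by (intro right_module_subquotient M.right_module_axioms) auto
    show ?case
    proof (rule hom_trivial_extension_right)
      show "right_module A ?U" by (rule M.right_module_restrict[OF sub(1)])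
      show "Module.submodule (Ns ! i) A ?U"
        using sub Ns(5)[OF Suc.prems] by (auto simp: M.submodule_restrict_iff)
      show "hom_trivial A X (?U\<lparr>carrier := Ns ! i\<rparr>)" using Suc by simp
      show "hom_trivial A X (quotient_module ?U (Ns ! i))"
        using Ns(5)[OF Suc.prems] rm assms(2,3)
        unfolding subquotient_def by (auto intro: hom_trivial_iso_right)
    qed
  qed
  from this[of "length Ns - 1"] show ?thesis
    using Ns(1,3) by (simp add: last_conv_nth)
qed

definition rigid :: "('a, 'r) ring_scheme \<Rightarrow> ('a, 'm) module \<Rightarrow> 'm set \<Rightarrow> bool" where
  "rigid A M U \<longleftrightarrow> Module.submodule U A M \<and> hom_trivial A (M\<lparr>carrier := U\<rparr>) (quotient_module M U)"

text \<open>All earlier bricks have no nonzero homomorphism to the last one. By extensions up the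
  chain the same holds for \<open>U\<close>, and the top factor is filtered by the last brick, so
  Hom(U, M/U) = 0. The assumption on \<open>carrier M\<close> excludes the chain with a single
  member.\<close>

lemma brick_chain_filtration_penultimate:
  fixes M :: "('a, 'm) module"
  assumes "right_module A M" "brick_chain_filtration TYPE('b) K A M Ms" "carrier M \<noteq> {\<zero>\<^bsub>M\<^esub>}"
  shows "\<exists>U Ms'. Ms = Ms' @ [carrier M] \<and> rigid A M U \<and> U \<noteq> carrier M \<and>
    brick_chain_filtration TYPE('b) K A (M\<lparr>carrier := U\<rparr>) Ms'"
proof -
  interpret M: right_module A M by fact
  note bcf = assms(2)[unfolded brick_chain_filtration_def]
  have Ms: "Ms \<noteq> []" "hd Ms = {\<zero>\<^bsub>M\<^esub>}" "last Ms = carrier M"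
      "\<And>N. N \<in> set Ms \<Longrightarrow> Module.submodule N A M"
      "\<And>i. Suc i < length Ms \<Longrightarrow> Ms ! i \<subset> Ms ! Suc i"
    using bcf by simp_all
  from bcf obtain Bs :: "('a, 'b) module list" where
    len_Bs: "length Ms = Suc (length Bs)" and bricks: "\<forall>B\<in>set Bs. brick K A B"
    and filt: "\<forall>i<length Bs. in_Filt K A (Bs ! i) (subquotient M (Ms ! Suc i) (Ms ! i))"
    and hom: "\<forall>i j. i < j \<and> j < length Bs \<longrightarrow> Hom A (Bs ! i) (Bs ! j) = {zero_hom (Bs ! i) (Bs ! j)}"
    by (elim conjE exE) (rule that)
  have Bs: "length Ms = Suc (length Bs)" "\<And>B. B \<in> set Bs \<Longrightarrow> brick K A B"
      "\<And>i. i < length Bs \<Longrightarrow> in_Filt K A (Bs ! i) (subquotient M (Ms ! Suc i) (Ms ! i))"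
      "\<And>i j. i < j \<Longrightarrow> j < length Bs \<Longrightarrow> Hom A (Bs ! i) (Bs ! j) = {zero_hom (Bs ! i) (Bs ! j)}"
    using len_Bs bricks filt hom by simp_all
  have "Bs \<noteq> []"
  proof
    assume "Bs = []"
    then obtain N where "Ms = [N]" using Bs(1) by (cases Ms) auto
    then show False using Ms(2,3) assms(3) by simp
  qed
  \<comment> \<open>There are \<open>t + 1\<close> bricks and \<open>t + 2\<close> members of the
    chain. So \<open>Ms ! t\<close> is the penultimate member, and \<open>Bs ! t\<close> is the
    brick of the top factor.\<close>
  then obtain t where t: "length Bs = Suc t" by (cases "length Bs") auto
  define Ms' where "Ms' = butlast Ms"
  define U where "U = Ms ! t"
  have len: "length Ms' = Suc t" using Bs(1) t by (simp add: Ms'_def)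
  have Ms': "Ms = Ms' @ [carrier M]" using Ms(1,3) by (simp add: Ms'_def flip: Ms(3))
  have nth: "Ms' ! i = Ms ! i" if "i \<le> t" for i
    using that len by (simp add: Ms'_def nth_butlast)
  have nthS: "Ms ! Suc t = carrier M" using Ms' len by (metis nth_append_length)
  have lt: "i < length Ms \<longleftrightarrow> i \<le> Suc t" for i using Bs(1) t by auto
  have subM: "Module.submodule (Ms ! i) A M" if "i \<le> Suc t" for i
    using Ms(4) that lt by auto
  have U: "Module.submodule U A M" using subM by (simp add: U_def)
  have mono: "Ms ! i \<subseteq> U" if "i \<le> t" for i
    using that
  proof (induction rule: inc_induct)
    case (step n)
    then show ?case using Ms(5)[of n] lt[of "Suc n"] by auto
  qed (simp add: U_def)
  let ?B = "Bs ! t"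
  have br: "right_module A B" if "B \<in> set Bs" for B
    using Bs(2)[OF that] by (simp add: brick_def fin_dim_right_module_def)
  have rB: "right_module A ?B" using t by (intro br) simp
  have "hom_trivial A (M\<lparr>carrier := Ms ! i\<rparr>) ?B" if "i \<le> t" for i
    using that
  proof (induction i)
    case 0
    have 0: "Ms ! 0 = {\<zero>\<^bsub>M\<^esub>}" using Ms(1,2) by (simp add: hd_conv_nth)
    show ?case
      using module_hom_zero[OF M.right_module_restrict[OF subM[of 0]] rB]
      by (intro hom_trivialI) (auto simp: 0)
  next
    case (Suc i)
    let ?V = "M\<lparr>carrier := Ms ! Suc i\<rparr>"
    have sub: "Module.submodule (Ms ! Suc i) A M" "Module.submodule (Ms ! i) A M" "Ms ! i \<subseteq> Ms ! Suc i"
      using subM Suc.prems Ms(5)[of i] lt by auto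
    show ?case
    proof (rule hom_trivial_extension_left)
      show "right_module A ?V" by (rule M.right_module_restrict[OF sub(1)])
      show "Module.submodule (Ms ! i) A ?V"
        using sub by (auto simp: M.submodule_restrict_iff)
      show "hom_trivial A (?V\<lparr>carrier := Ms ! i\<rparr>) ?B" using Suc by simp
      have "hom_trivial A (Bs ! i) ?B"
        using Suc.prems t Bs(4)[of i t] br[of "Bs ! i"] by (intro hom_trivial_of_Hom) auto
      then show "hom_trivial A (quotient_module ?V (Ms ! i)) ?B"
        using Bs(3)[of i] t Suc.prems rB unfolding subquotient_def[symmetric]
        by (auto intro: hom_trivial_Filt_left)
    qed (rule rB)
  qed
  then have UB: "hom_trivial A (M\<lparr>carrier := U\<rparr>) ?B" by (simp add: U_def)
  have "in_Filt K A ?B (subquotient M (carrier M) U)"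
    using Bs(3)[of t] t nthS by (simp add: U_def)
  then have "hom_trivial A (M\<lparr>carrier := U\<rparr>) (quotient_module M U)"
    using UB rB by (auto simp: subquotient_def intro: hom_trivial_Filt_right)
  then have rig: "rigid A M U" using U by (simp add: rigid_def)
  have "U \<noteq> carrier M" using Ms(5)[of t] lt[of "Suc t"] nthS by (auto simp: U_def)
  moreover have "brick_chain_filtration TYPE('b) K A (M\<lparr>carrier := U\<rparr>) Ms'"
    unfolding brick_chain_filtration_def
  proof (intro conjI exI[of _ "butlast Bs"] ballI allI impI)
    show ne: "Ms' \<noteq> []" using len by auto
    show "hd Ms' = {\<zero>\<^bsub>M\<lparr>carrier := U\<rparr>\<^esub>}" using ne Ms(2) Ms' by simp
    show "last Ms' = carrier (M\<lparr>carrier := U\<rparr>)"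
      using ne len nth by (simp add: last_conv_nth U_def)
    show "Module.submodule N A (M\<lparr>carrier := U\<rparr>)" if N: "N \<in> set Ms'" for N
    proof -
      obtain i where i: "i < length Ms'" "N = Ms' ! i"
        using N by (auto simp: in_set_conv_nth)
      then have "i \<le> t" "N = Ms ! i" using len nth by simp_all
      then show ?thesis using subM[of i] mono by (simp add: M.submodule_restrict_iff[OF U])
    qed
    show "Ms' ! i \<subset> Ms' ! Suc i" if "Suc i < length Ms'" for i
      using that len nth Ms(5)[of i] lt[of "Suc i"] by simp
    show "length Ms' = Suc (length (butlast Bs))" using len t by simp
    show "brick K A B" if "B \<in> set (butlast Bs)" for B
      using Bs(2) in_set_butlastD[OF that] by blast
    \<comment> \<open>Of two updates of the carrier only the last one counts, so the factors of the
      shorter chain are the same records as before.\<close>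
    show "in_Filt K A (butlast Bs ! i) (subquotient (M\<lparr>carrier := U\<rparr>) (Ms' ! Suc i) (Ms' ! i))"
      if "i < length (butlast Bs)" for i
      using that t nth Bs(3)[of i] by (simp add: nth_butlast subquotient_def)
    show "Hom A (butlast Bs ! i) (butlast Bs ! j) = {zero_hom (butlast Bs ! i) (butlast Bs ! j)}"
      if "i < j \<and> j < length (butlast Bs)" for i j
      using that t Bs(4)[of i j] by (simp add: nth_butlast)
  qed
  ultimately show ?thesis using Ms' rig by blast
qed

section \<open>Reduced echelon bases of submodules\<close>

lemma finsum_hom:
  assumes "abelian_group G" "abelian_group H" "finite S" "v \<in> S \<rightarrow> carrier G" "f \<in> carrier G \<rightarrow> carrier H"
    and "\<And>x y. x \<in> carrier G \<Longrightarrow> y \<in> carrier G \<Longrightarrow> f (x \<oplus>\<^bsub>G\<^esub> y) = f x \<oplus>\<^bsub>H\<^esub> f y"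
  shows "f (\<Oplus>\<^bsub>G\<^esub>i\<in>S. v i) = (\<Oplus>\<^bsub>H\<^esub>i\<in>S. f (v i))"
proof -
  interpret G: abelian_group G by fact
  interpret H: abelian_group H by fact
  have f: "\<And>x. x \<in> carrier G \<Longrightarrow> f x \<in> carrier H" using assms(5) by auto
  have "f \<zero>\<^bsub>G\<^esub> \<oplus>\<^bsub>H\<^esub> f \<zero>\<^bsub>G\<^esub> = f \<zero>\<^bsub>G\<^esub>" using assms(6)[of "\<zero>\<^bsub>G\<^esub>" "\<zero>\<^bsub>G\<^esub>"] by simp
  then have f0: "f \<zero>\<^bsub>G\<^esub> = \<zero>\<^bsub>H\<^esub>" using f[OF G.zero_closed] by simp
  show ?thesis
    using assms(3,4)
  proof (induction S rule: finite_induct)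
    case (insert i S)
    have v: "v i \<in> carrier G" "\<And>j. j \<in> S \<Longrightarrow> v j \<in> carrier G" using insert.prems by auto
    have "f (\<Oplus>\<^bsub>G\<^esub>i\<in>insert i S. v i) = f (v i \<oplus>\<^bsub>G\<^esub> (\<Oplus>\<^bsub>G\<^esub>i\<in>S. v i))"
      using insert.hyps v by (simp add: Pi_def)
    also have "\<dots> = f (v i) \<oplus>\<^bsub>H\<^esub> f (\<Oplus>\<^bsub>G\<^esub>i\<in>S. v i)"
      using v by (intro assms(6) G.finsum_closed) auto
    also have "f (\<Oplus>\<^bsub>G\<^esub>i\<in>S. v i) = (\<Oplus>\<^bsub>H\<^esub>i\<in>S. f (v i))"
      using v by (intro insert.IH) auto
    finally show ?case using insert.hyps v f by (simp add: Pi_def)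
  qed (simp add: f0)
qed

lemma underlying_space_simps [simp]:
  "carrier (underlying_space K A M) = carrier M"
  "zero (underlying_space K A M) = zero M"
  "add (underlying_space K A M) = add M"
  by (simp_all add: underlying_space_def)

lemma underlying_space_a_inv [simp]: "a_inv (underlying_space K A M) = a_inv M"
  by (simp add: a_inv_def m_inv_def underlying_space_def fun_eq_iff)

lemma underlying_space_minus [simp]: "a_minus (underlying_space K A M) = a_minus M"
  by (simp add: a_minus_def fun_eq_iff)

lemma underlying_space_smult:
  "c \<odot>\<^bsub>underlying_space K A M\<^esub> x = (c \<odot>\<^bsub>A\<^esub> \<one>\<^bsub>A\<^esub>) \<odot>\<^bsub>M\<^esub> x"
  by (simp add: underlying_space_def)

lemma vectorspace_underlying_space:
  assumes "algebra_over_field K A" "right_module A M"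
  shows "vectorspace K (underlying_space K A M)"
proof -
  interpret A: algebra_over_field K A by fact
  interpret M: right_module A M by fact
  have one: "c \<odot>\<^bsub>A\<^esub> \<one>\<^bsub>A\<^esub> \<in> carrier A" if "c \<in> carrier K" for c
    using that by (intro A.smult_closed) auto
  have "Module.module K (underlying_space K A M)"
  proof (intro Module.moduleI A.R.is_cring)
    show "abelian_group (underlying_space K A M)"
    proof (intro abelian_groupI)
      fix x assume "x \<in> carrier (underlying_space K A M)"
      then show "\<exists>y\<in>carrier (underlying_space K A M).
          y \<oplus>\<^bsub>underlying_space K A M\<^esub> x = \<zero>\<^bsub>underlying_space K A M\<^esub>"
        by (intro bexI[of _ "\<ominus>\<^bsub>M\<^esub> x"]) (auto simp: M.M.l_neg)
    qed (simp_all add: M.M.a_ac)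
    fix a b x assume ab: "a \<in> carrier K" "b \<in> carrier K" and x: "x \<in> carrier (underlying_space K A M)"
    \<comment> \<open>A right action reverses products; commutativity of \<open>K\<close> restores
      the order.\<close>
    have "(b \<odot>\<^bsub>A\<^esub> \<one>\<^bsub>A\<^esub>) \<otimes>\<^bsub>A\<^esub> (a \<odot>\<^bsub>A\<^esub> \<one>\<^bsub>A\<^esub>) = b \<odot>\<^bsub>A\<^esub> (a \<odot>\<^bsub>A\<^esub> \<one>\<^bsub>A\<^esub>)"
      using ab one by (simp add: A.smult_mult_left)
    also have "\<dots> = (a \<otimes>\<^bsub>K\<^esub> b) \<odot>\<^bsub>A\<^esub> \<one>\<^bsub>A\<^esub>"
      using ab by (simp add: A.R.m_comm[of a b] A.smult_assoc1)
    finally show "(a \<otimes>\<^bsub>K\<^esub> b) \<odot>\<^bsub>underlying_space K A M\<^esub> x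
        = a \<odot>\<^bsub>underlying_space K A M\<^esub> (b \<odot>\<^bsub>underlying_space K A M\<^esub> x)"
      using ab one x M.right_smult_assoc[of "b \<odot>\<^bsub>A\<^esub> \<one>\<^bsub>A\<^esub>" "a \<odot>\<^bsub>A\<^esub> \<one>\<^bsub>A\<^esub>" x]
      by (simp add: underlying_space_smult)
  qed (use one in \<open>auto simp: underlying_space_smult A.smult_l_distr A.smult_one
      M.right_smult_closed M.right_smult_add_ring M.right_smult_add_module M.right_smult_one\<close>)
  then show ?thesis by (intro vectorspace.intro A.field.field_axioms)
qed

text \<open>Scalar multiples of the unit are central in the algebra.\<close>

lemma action_commutes_scalars:
  assumes "algebra_over_field K A" "right_module A M" "c \<in> carrier K" "a \<in> carrier A" "x \<in> carrier M"
  shows "a \<odot>\<^bsub>M\<^esub> (c \<odot>\<^bsub>underlying_space K A M\<^esub> x) = c \<odot>\<^bsub>underlying_space K A M\<^esub> (a \<odot>\<^bsub>M\<^esub> x)"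
proof -
  interpret A: algebra_over_field K A by fact
  interpret M: right_module A M by fact
  have c: "c \<odot>\<^bsub>A\<^esub> \<one>\<^bsub>A\<^esub> \<in> carrier A" using assms by (intro A.smult_closed) auto
  have "(c \<odot>\<^bsub>A\<^esub> \<one>\<^bsub>A\<^esub>) \<otimes>\<^bsub>A\<^esub> a = a \<otimes>\<^bsub>A\<^esub> (c \<odot>\<^bsub>A\<^esub> \<one>\<^bsub>A\<^esub>)"
    using assms by (simp add: A.smult_mult_left A.smult_mult_right)
  then show ?thesis
    using assms c M.right_smult_assoc[of a "c \<odot>\<^bsub>A\<^esub> \<one>\<^bsub>A\<^esub>" x] M.right_smult_assoc[of "c \<odot>\<^bsub>A\<^esub> \<one>\<^bsub>A\<^esub>" a x]
    by (simp add: underlying_space_smult)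
qed

text \<open>A basis \<open>e\<close> with dual coordinates \<open>co\<close>, indexed by an
  arbitrary finite set of numbers. A submodule is then coordinatized by its own pivots and the same
  functions \<open>co\<close>, without renumbering.\<close>

locale coordinatized_module =
  fixes K :: "('k, 'p) ring_scheme" and A :: "('k, 'a, 'q) module_scheme" and M :: "('a, 'm) module"
    and I :: "nat set" and e :: "nat \<Rightarrow> 'm" and co :: "nat \<Rightarrow> 'm \<Rightarrow> 'k"
  assumes algebra: "algebra_over_field K A" and right_module: "right_module A M"
    and finite_I: "finite I"
    and e_closed: "l \<in> I \<Longrightarrow> e l \<in> carrier M"
    and co_closed: "l \<in> I \<Longrightarrow> x \<in> carrier M \<Longrightarrow> co l x \<in> carrier K"
    and co_add: "l \<in> I \<Longrightarrow> x \<in> carrier M \<Longrightarrow> y \<in> carrier M \<Longrightarrow> co l (x \<oplus>\<^bsub>M\<^esub> y) = co l x \<oplus>\<^bsub>K\<^esub> co l y"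
    and co_smult: "l \<in> I \<Longrightarrow> c \<in> carrier K \<Longrightarrow> x \<in> carrier M \<Longrightarrow>
      co l (c \<odot>\<^bsub>underlying_space K A M\<^esub> x) = c \<otimes>\<^bsub>K\<^esub> co l x"
    and co_e: "l \<in> I \<Longrightarrow> l' \<in> I \<Longrightarrow> co l (e l') = (if l = l' then \<one>\<^bsub>K\<^esub> else \<zero>\<^bsub>K\<^esub>)"
    and co_eq_zero: "x \<in> carrier M \<Longrightarrow> (\<And>l. l \<in> I \<Longrightarrow> co l x = \<zero>\<^bsub>K\<^esub>) \<Longrightarrow> x = \<zero>\<^bsub>M\<^esub>"
begin

abbreviation "V \<equiv> underlying_space K A M"

sublocale V: vectorspace K V
  by (rule vectorspace_underlying_space[OF algebra right_module])

sublocale Mod: right_module A M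
  by (rule right_module)

lemma sm_closed: "c \<in> carrier K \<Longrightarrow> x \<in> carrier M \<Longrightarrow> c \<odot>\<^bsub>V\<^esub> x \<in> carrier M"
  using V.smult_closed by simp

lemma fsum_closed: "(\<And>i. i \<in> S \<Longrightarrow> v i \<in> carrier M) \<Longrightarrow> (\<Oplus>\<^bsub>V\<^esub>i\<in>S. v i) \<in> carrier M"
  using V.M.finsum_closed[of v S] by (auto simp: Pi_def)

lemma co_finsum:
  assumes "finite S" "l \<in> I" "\<And>i. i \<in> S \<Longrightarrow> v i \<in> carrier M"
  shows "co l (\<Oplus>\<^bsub>V\<^esub>i\<in>S. v i) = (\<Oplus>\<^bsub>K\<^esub>i\<in>S. co l (v i))"
  using assms co_closed co_add
  by (intro finsum_hom V.M.abelian_group_axioms V.R.abelian_group_axioms) auto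

lemma co_zero: "l \<in> I \<Longrightarrow> co l \<zero>\<^bsub>M\<^esub> = \<zero>\<^bsub>K\<^esub>"
  using co_finsum[of "{}" l "\<lambda>_. \<zero>\<^bsub>M\<^esub>"] by simp

lemma co_minus:
  assumes "l \<in> I" "x \<in> carrier M" "y \<in> carrier M"
  shows "co l (x \<ominus>\<^bsub>M\<^esub> y) = co l x \<ominus>\<^bsub>K\<^esub> co l y"
proof -
  have "co l (\<ominus>\<^bsub>M\<^esub> y) \<oplus>\<^bsub>K\<^esub> co l y = \<zero>\<^bsub>K\<^esub>"
    using co_add[OF assms(1), of "\<ominus>\<^bsub>M\<^esub> y" y] assms co_zero by (simp add: Mod.M.l_neg)
  then have "co l (\<ominus>\<^bsub>M\<^esub> y) = \<ominus>\<^bsub>K\<^esub> co l y"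
    using assms co_closed by (intro V.R.minus_equality[symmetric]) auto
  then show ?thesis using assms co_add by (simp add: a_minus_def)
qed

lemma co_inject:
  assumes "x \<in> carrier M" "y \<in> carrier M" "\<And>l. l \<in> I \<Longrightarrow> co l x = co l y"
  shows "x = y"
proof -
  have "x \<ominus>\<^bsub>M\<^esub> y = \<zero>\<^bsub>M\<^esub>"
  proof (rule co_eq_zero)
    fix l assume l: "l \<in> I"
    then show "co l (x \<ominus>\<^bsub>M\<^esub> y) = \<zero>\<^bsub>K\<^esub>"
      using assms co_closed by (simp add: co_minus V.R.minus_other_side)
  qed (use assms in auto)
  then show ?thesis using assms by (simp add: Mod.M.minus_other_side)
qed

definition pivots :: "'m set \<Rightarrow> nat set" where
  "pivots U = {s \<in> I. \<exists>u\<in>U. co s u = \<one>\<^bsub>K\<^esub> \<and> (\<forall>l\<in>I. s < l \<longrightarrow> co l u = \<zero>\<^bsub>K\<^esub>)}"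

lemma pivots_subset: "pivots U \<subseteq> I" "s \<in> pivots U \<Longrightarrow> s \<in> I"
  by (auto simp: pivots_def)

lemma finite_pivots: "finite (pivots U)"
  using pivots_subset(1) finite_I by (rule finite_subset)

end

locale coordinatized_submodule = coordinatized_module +
  fixes U
  assumes submodule: "Module.submodule U A M"
begin

lemmas U_closed = Mod.submodule_closed[OF submodule]

lemma U_carrier: "x \<in> U \<Longrightarrow> x \<in> carrier M"
  using U_closed(1) by auto

lemma U_smult: "c \<in> carrier K \<Longrightarrow> x \<in> U \<Longrightarrow> c \<odot>\<^bsub>V\<^esub> x \<in> U"
  unfolding underlying_space_smult
  using algebra by (intro U_closed(6)) (auto simp: algebra_over_field_def vectorspace_def ring_def
      intro!: Module.module.smult_closed monoid.one_closed)

lemma U_finsum: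
  assumes "finite S" "\<And>i. i \<in> S \<Longrightarrow> v i \<in> U"
  shows "(\<Oplus>\<^bsub>V\<^esub>i\<in>S. v i) \<in> U"
  using assms
proof (induction S rule: finite_induct)
  case (insert i S)
  then show ?case
    using U_carrier U_closed(3) by (simp add: Pi_def)
qed (simp add: U_closed(2))

text \<open>The leading position of a nonzero vector of \<open>U\<close> is a pivot, and the vector
  does not vanish there.\<close>

lemma pivots_separate:
  assumes "u \<in> U" "\<And>s. s \<in> pivots U \<Longrightarrow> co s u = \<zero>\<^bsub>K\<^esub>"
  shows "u = \<zero>\<^bsub>M\<^esub>"
proof (rule ccontr)
  assume "u \<noteq> \<zero>\<^bsub>M\<^esub>"
  define L where "L = {l \<in> I. co l u \<noteq> \<zero>\<^bsub>K\<^esub>}"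
  have L: "finite L" "L \<noteq> {}"
    using finite_I co_eq_zero[OF U_carrier[OF assms(1)]] \<open>u \<noteq> \<zero>\<^bsub>M\<^esub>\<close> by (auto simp: L_def)
  define s where "s = Max L"
  have s: "s \<in> I" "co s u \<noteq> \<zero>\<^bsub>K\<^esub>" using Max_in[OF L] by (auto simp: s_def L_def)
  have up: "co l u = \<zero>\<^bsub>K\<^esub>" if "l \<in> I" "s < l" for l
    using Max_ge[OF L(1), of l] that by (auto simp: s_def L_def)
  have c: "co s u \<in> carrier K" using s co_closed U_carrier assms by auto
  define i where "i = inv\<^bsub>K\<^esub> (co s u)"
  have i: "i \<in> carrier K" "i \<otimes>\<^bsub>K\<^esub> co s u = \<one>\<^bsub>K\<^esub>"
    using c s V.field.field_Units by (auto simp: i_def)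
  have "s \<in> pivots U"
    unfolding pivots_def using i s up assms(1) U_carrier U_smult
    by (auto simp: co_smult intro!: bexI[of _ "i \<odot>\<^bsub>V\<^esub> u"])
  then show False using assms(2) s by blast
qed

text \<open>Start from a vector with leading position \<open>s\<close> and clear its entries at the
  smaller pivots with their reduced vectors, which vanish at \<open>s\<close> and above.\<close>

lemma exists_reduced:
  "s \<in> pivots U \<Longrightarrow> \<exists>u\<in>U. (\<forall>l\<in>I. s < l \<longrightarrow> co l u = \<zero>\<^bsub>K\<^esub>) \<and>
    (\<forall>s'\<in>pivots U. co s' u = (if s' = s then \<one>\<^bsub>K\<^esub> else \<zero>\<^bsub>K\<^esub>))"
proof (induction s rule: less_induct)
  case (less s)
  define P where "P = {s' \<in> pivots U. s' < s}"
  have P: "finite P" using finite_pivots by (simp add: P_def)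
  obtain u where u: "u \<in> U" "co s u = \<one>\<^bsub>K\<^esub>" "\<And>l. l \<in> I \<Longrightarrow> s < l \<Longrightarrow> co l u = \<zero>\<^bsub>K\<^esub>"
    using less.prems by (auto simp: pivots_def)
  have "\<forall>s'\<in>P. \<exists>r\<in>U. (\<forall>l\<in>I. s' < l \<longrightarrow> co l r = \<zero>\<^bsub>K\<^esub>) \<and>
    (\<forall>s''\<in>pivots U. co s'' r = (if s'' = s' then \<one>\<^bsub>K\<^esub> else \<zero>\<^bsub>K\<^esub>))"
    using less.IH by (auto simp: P_def)
  then obtain r where r: "\<And>s'. s' \<in> P \<Longrightarrow> r s' \<in> U"
    "\<And>s' l. s' \<in> P \<Longrightarrow> l \<in> I \<Longrightarrow> s' < l \<Longrightarrow> co l (r s') = \<zero>\<^bsub>K\<^esub>"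
    "\<And>s' s''. s' \<in> P \<Longrightarrow> s'' \<in> pivots U \<Longrightarrow> co s'' (r s') = (if s'' = s' then \<one>\<^bsub>K\<^esub> else \<zero>\<^bsub>K\<^esub>)"
    by metis
  have PI: "s' \<in> I" if "s' \<in> P" for s' using that pivots_subset by (auto simp: P_def)
  have cu: "co l u \<in> carrier K" if "l \<in> I" for l using that u(1) U_carrier co_closed by auto
  have cr: "co l (r s') \<in> carrier K" if "l \<in> I" "s' \<in> P" for l s'
    using that r(1) U_carrier co_closed by auto
  define w where "w = (\<Oplus>\<^bsub>V\<^esub>s'\<in>P. co s' u \<odot>\<^bsub>V\<^esub> r s')"
  have tm: "co s' u \<odot>\<^bsub>V\<^esub> r s' \<in> U" if "s' \<in> P" for s'
    using that r(1) cu PI U_smult by auto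
  have w: "w \<in> U" unfolding w_def using P tm by (intro U_finsum) auto
  have cw: "co l w = (\<Oplus>\<^bsub>K\<^esub>s'\<in>P. co s' u \<otimes>\<^bsub>K\<^esub> co l (r s'))" if l: "l \<in> I" for l
  proof -
    have "co l w = (\<Oplus>\<^bsub>K\<^esub>s'\<in>P. co l (co s' u \<odot>\<^bsub>V\<^esub> r s'))"
      unfolding w_def using P l tm U_carrier by (intro co_finsum) auto
    also have "\<dots> = (\<Oplus>\<^bsub>K\<^esub>s'\<in>P. co s' u \<otimes>\<^bsub>K\<^esub> co l (r s'))"
      using l r(1) cu cr PI U_carrier by (intro V.R.finsum_cong') (auto simp: co_smult)
    finally show ?thesis .
  qed
  have cw0: "co l w = \<zero>\<^bsub>K\<^esub>" if l: "l \<in> I" "\<And>s'. s' \<in> P \<Longrightarrow> co l (r s') = \<zero>\<^bsub>K\<^esub>" for l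
  proof -
    have "co l w = (\<Oplus>\<^bsub>K\<^esub>s'\<in>P. \<zero>\<^bsub>K\<^esub>)"
      unfolding cw[OF l(1)] using l cu PI by (intro V.R.finsum_cong') auto
    then show ?thesis by simp
  qed
  have cv: "co l (u \<ominus>\<^bsub>M\<^esub> w) = co l u \<ominus>\<^bsub>K\<^esub> co l w" if "l \<in> I" for l
    using that u(1) w U_carrier by (intro co_minus) auto
  show ?case
  proof (intro bexI[of _ "u \<ominus>\<^bsub>M\<^esub> w"] conjI ballI impI)
    show "u \<ominus>\<^bsub>M\<^esub> w \<in> U" using u(1) w by (rule U_closed(5))
    fix l assume l: "l \<in> I" "s < l"
    then have "co l w = \<zero>\<^bsub>K\<^esub>" using r(2) by (intro cw0) (auto simp: P_def)
    then show "co l (u \<ominus>\<^bsub>M\<^esub> w) = \<zero>\<^bsub>K\<^esub>" unfolding cv[OF l(1)] using l u(3) by (simp add: a_minus_def)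
  next
    fix t assume t: "t \<in> pivots U"
    then have tI: "t \<in> I" by (rule pivots_subset(2))
    consider "t = s" | "s < t" | "t \<in> P" using t by (fastforce simp: P_def)
    then show "co t (u \<ominus>\<^bsub>M\<^esub> w) = (if t = s then \<one>\<^bsub>K\<^esub> else \<zero>\<^bsub>K\<^esub>)"
    proof cases
      case 1
      then have "co t w = \<zero>\<^bsub>K\<^esub>" using tI r(2) by (intro cw0) (auto simp: P_def)
      then show ?thesis unfolding cv[OF tI] using 1 u(2) by (simp add: a_minus_def)
    next
      case 2
      then have "co t w = \<zero>\<^bsub>K\<^esub>" using tI r(2) by (intro cw0) (auto simp: P_def)
      then show ?thesis unfolding cv[OF tI] using 2 tI u(3) by (simp add: a_minus_def)
    next
      case 3
      have "co t w = (\<Oplus>\<^bsub>K\<^esub>s'\<in>P. if t = s' then co s' u else \<zero>\<^bsub>K\<^esub>)"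
        unfolding cw[OF tI] using r(3) t cu PI by (intro V.R.finsum_cong') auto
      also have "\<dots> = co t u"
        using 3 P cu PI by (intro V.R.finsum_singleton) auto
      finally show ?thesis
        unfolding cv[OF tI] using 3 cu[OF tI] by (auto simp: P_def)
    qed
  qed
qed

end

context coordinatized_module
begin

definition reduced :: "'m set \<Rightarrow> nat \<Rightarrow> 'm" where
  "reduced U s = (SOME u. u \<in> U \<and> (\<forall>l\<in>I. s < l \<longrightarrow> co l u = \<zero>\<^bsub>K\<^esub>) \<and>
    (\<forall>s'\<in>pivots U. co s' u = (if s' = s then \<one>\<^bsub>K\<^esub> else \<zero>\<^bsub>K\<^esub>)))"

text \<open>
  The projection onto \<open>U\<close> along the coordinate subspace spanned by the non-pivots.
\<close>

definition proj :: "'m set \<Rightarrow> 'm \<Rightarrow> 'm" where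
  "proj U v = (\<Oplus>\<^bsub>V\<^esub>s\<in>pivots U. co s v \<odot>\<^bsub>V\<^esub> reduced U s)"

end

context coordinatized_submodule
begin

lemma reduced:
  assumes "s \<in> pivots U"
  shows "reduced U s \<in> U" "l \<in> I \<Longrightarrow> s < l \<Longrightarrow> co l (reduced U s) = \<zero>\<^bsub>K\<^esub>"
    "s' \<in> pivots U \<Longrightarrow> co s' (reduced U s) = (if s' = s then \<one>\<^bsub>K\<^esub> else \<zero>\<^bsub>K\<^esub>)"
proof -
  have "\<exists>u. u \<in> U \<and> (\<forall>l\<in>I. s < l \<longrightarrow> co l u = \<zero>\<^bsub>K\<^esub>) \<and>
    (\<forall>s'\<in>pivots U. co s' u = (if s' = s then \<one>\<^bsub>K\<^esub> else \<zero>\<^bsub>K\<^esub>))"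
    using exists_reduced[OF assms] by blast
  from someI_ex[OF this] show "reduced U s \<in> U" "l \<in> I \<Longrightarrow> s < l \<Longrightarrow> co l (reduced U s) = \<zero>\<^bsub>K\<^esub>"
    "s' \<in> pivots U \<Longrightarrow> co s' (reduced U s) = (if s' = s then \<one>\<^bsub>K\<^esub> else \<zero>\<^bsub>K\<^esub>)"
    unfolding reduced_def by auto
qed

lemma reduced_carrier: "s \<in> pivots U \<Longrightarrow> reduced U s \<in> carrier M"
  using reduced(1) U_carrier by blast

lemma co_pivot_closed: "s \<in> pivots U \<Longrightarrow> v \<in> carrier M \<Longrightarrow> co s v \<in> carrier K"
  using pivots_subset co_closed by blast

lemma proj_term: "s \<in> pivots U \<Longrightarrow> v \<in> carrier M \<Longrightarrow> co s v \<odot>\<^bsub>V\<^esub> reduced U s \<in> U"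
  using reduced(1) co_pivot_closed U_smult by blast

lemma proj_in: "v \<in> carrier M \<Longrightarrow> proj U v \<in> U"
  unfolding proj_def using finite_pivots proj_term by (intro U_finsum) auto

lemma proj_carrier: "v \<in> carrier M \<Longrightarrow> proj U v \<in> carrier M"
  using proj_in U_carrier by blast

lemma co_proj:
  assumes "v \<in> carrier M" "l \<in> I"
  shows "co l (proj U v) = (\<Oplus>\<^bsub>K\<^esub>s\<in>pivots U. co s v \<otimes>\<^bsub>K\<^esub> co l (reduced U s))"
proof -
  have "co l (proj U v) = (\<Oplus>\<^bsub>K\<^esub>s\<in>pivots U. co l (co s v \<odot>\<^bsub>V\<^esub> reduced U s))"
    unfolding proj_def using assms proj_term U_carrier finite_pivots by (intro co_finsum) auto
  also have "\<dots> = (\<Oplus>\<^bsub>K\<^esub>s\<in>pivots U. co s v \<otimes>\<^bsub>K\<^esub> co l (reduced U s))"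
    using assms reduced_carrier co_pivot_closed co_closed
    by (intro V.R.finsum_cong') (auto simp: co_smult)
  finally show ?thesis .
qed

lemma co_pivot_proj:
  assumes "v \<in> carrier M" "t \<in> pivots U"
  shows "co t (proj U v) = co t v"
proof -
  have "co t (proj U v) = (\<Oplus>\<^bsub>K\<^esub>s\<in>pivots U. if t = s then co s v else \<zero>\<^bsub>K\<^esub>)"
    using assms co_proj pivots_subset(2) reduced(3) co_pivot_closed
    by (simp, intro V.R.finsum_cong') auto
  also have "\<dots> = co t v"
    using assms finite_pivots co_pivot_closed by (intro V.R.finsum_singleton) auto
  finally show ?thesis .
qed

text \<open>The difference lies in \<open>U\<close> and vanishes at all pivots.\<close>

lemma proj_eq:
  assumes "u \<in> U"
  shows "proj U u = u"
proof -
  have u: "u \<in> carrier M" using assms U_carrier by blast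
  have "proj U u \<ominus>\<^bsub>M\<^esub> u = \<zero>\<^bsub>M\<^esub>"
  proof (rule pivots_separate)
    show "proj U u \<ominus>\<^bsub>M\<^esub> u \<in> U" using proj_in[OF u] assms by (rule U_closed(5))
    fix s assume s: "s \<in> pivots U"
    then show "co s (proj U u \<ominus>\<^bsub>M\<^esub> u) = \<zero>\<^bsub>K\<^esub>"
      using u proj_carrier pivots_subset(2) co_closed
      by (simp add: co_minus co_pivot_proj V.R.minus_other_side)
  qed
  then show ?thesis using u proj_carrier by (simp add: Mod.M.minus_other_side)
qed

lemma proj_add:
  assumes "x \<in> carrier M" "y \<in> carrier M"
  shows "proj U (x \<oplus>\<^bsub>M\<^esub> y) = proj U x \<oplus>\<^bsub>M\<^esub> proj U y"
proof -
  have "proj U (x \<oplus>\<^bsub>M\<^esub> y) = (\<Oplus>\<^bsub>V\<^esub>s\<in>pivots U. co s x \<odot>\<^bsub>V\<^esub> reduced U s \<oplus>\<^bsub>V\<^esub> co s y \<odot>\<^bsub>V\<^esub> reduced U s)"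
    unfolding proj_def
    using assms pivots_subset(2) co_pivot_closed reduced_carrier sm_closed V.smult_l_distr
    by (intro V.M.finsum_cong') (auto simp: co_add)
  also have "\<dots> = proj U x \<oplus>\<^bsub>V\<^esub> proj U y"
    unfolding proj_def using assms co_pivot_closed reduced_carrier sm_closed
    by (intro V.M.finsum_addf) auto
  finally show ?thesis by simp
qed

lemma proj_smult:
  assumes "x \<in> carrier M" "c \<in> carrier K"
  shows "proj U (c \<odot>\<^bsub>V\<^esub> x) = c \<odot>\<^bsub>V\<^esub> proj U x"
proof -
  have "proj U (c \<odot>\<^bsub>V\<^esub> x) = (\<Oplus>\<^bsub>V\<^esub>s\<in>pivots U. c \<odot>\<^bsub>V\<^esub> (co s x \<odot>\<^bsub>V\<^esub> reduced U s))"
    unfolding proj_def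
    using assms pivots_subset(2) co_pivot_closed reduced_carrier sm_closed V.smult_assoc1
    by (intro V.M.finsum_cong') (auto simp: co_smult)
  also have "\<dots> = c \<odot>\<^bsub>V\<^esub> proj U x"
    unfolding proj_def using assms co_pivot_closed reduced_carrier sm_closed finite_pivots
    by (intro V.finsum_smult_ldistr[symmetric]) auto
  finally show ?thesis .
qed

text \<open>If every index is a pivot, the projection onto \<open>U\<close> preserves all
  coordinates.\<close>

lemma pivots_eq_I:
  assumes "pivots U = I"
  shows "U = carrier M"
proof (intro equalityI subsetI)
  fix v assume v: "v \<in> carrier M"
  then have "proj U v = v"
    using assms proj_carrier co_pivot_proj by (intro co_inject) auto
  then show "v \<in> U" using proj_in[OF v] by simp
qed (rule U_carrier)

text \<open>The coordinates at the pivots are dual to the reduced vectors. This lets the final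
  induction pass from \<open>M\<close> to \<open>U\<close>, with \<open>pivots U\<close> in the role
  of \<open>I\<close>.\<close>

lemma coordinatized_restrict: "coordinatized_module K A (M\<lparr>carrier := U\<rparr>) (pivots U) (reduced U) co"
proof (rule coordinatized_module.intro)
  have sm: "c \<odot>\<^bsub>underlying_space K A (M\<lparr>carrier := U\<rparr>)\<^esub> x = c \<odot>\<^bsub>V\<^esub> x" for c x
    by (simp add: underlying_space_smult)
  show "algebra_over_field K A" by (rule algebra)
  show "right_module A (M\<lparr>carrier := U\<rparr>)" by (rule Mod.right_module_restrict[OF submodule])
  show "finite (pivots U)" by (rule finite_pivots)
  fix l assume l: "l \<in> pivots U"
  then have lI: "l \<in> I" by (rule pivots_subset(2))
  show "reduced U l \<in> carrier (M\<lparr>carrier := U\<rparr>)" using reduced(1)[OF l] by simp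
  show "co l x \<in> carrier K" if "x \<in> carrier (M\<lparr>carrier := U\<rparr>)" for x
    using that co_closed[OF lI] U_carrier by simp
  show "co l (x \<oplus>\<^bsub>M\<lparr>carrier := U\<rparr>\<^esub> y) = co l x \<oplus>\<^bsub>K\<^esub> co l y"
    if "x \<in> carrier (M\<lparr>carrier := U\<rparr>)" "y \<in> carrier (M\<lparr>carrier := U\<rparr>)" for x y
    using that co_add[OF lI] U_carrier by simp
  show "co l (c \<odot>\<^bsub>underlying_space K A (M\<lparr>carrier := U\<rparr>)\<^esub> x) = c \<otimes>\<^bsub>K\<^esub> co l x"
    if "c \<in> carrier K" "x \<in> carrier (M\<lparr>carrier := U\<rparr>)" for c x
    using that co_smult[OF lI] U_carrier by (simp add: sm)
  show "co l (reduced U l') = (if l = l' then \<one>\<^bsub>K\<^esub> else \<zero>\<^bsub>K\<^esub>)" if "l' \<in> pivots U" for l'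
    using reduced(3)[OF that l] by simp
next
  fix x assume "x \<in> carrier (M\<lparr>carrier := U\<rparr>)" "\<And>l. l \<in> pivots U \<Longrightarrow> co l x = \<zero>\<^bsub>K\<^esub>"
  then show "x = \<zero>\<^bsub>M\<lparr>carrier := U\<rparr>\<^esub>" using pivots_separate by simp
qed

end

section \<open>Counting rigid submodules\<close>

context coordinatized_module
begin

section \<open>Linear maps and linear combinations\<close>

definition lin :: "('m \<Rightarrow> 'm) \<Rightarrow> bool" where
  "lin f \<longleftrightarrow> f \<in> module_hom K V V"

lemma linI:
  assumes "\<And>x. x \<in> carrier M \<Longrightarrow> f x \<in> carrier M"
    and "\<And>x y. x \<in> carrier M \<Longrightarrow> y \<in> carrier M \<Longrightarrow> f (x \<oplus>\<^bsub>M\<^esub> y) = f x \<oplus>\<^bsub>M\<^esub> f y"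
    and "\<And>c x. c \<in> carrier K \<Longrightarrow> x \<in> carrier M \<Longrightarrow> f (c \<odot>\<^bsub>V\<^esub> x) = c \<odot>\<^bsub>V\<^esub> f x"
  shows "lin f"
  using assms by (simp add: lin_def module_hom_def)

lemma linD:
  assumes "lin f"
  shows "x \<in> carrier M \<Longrightarrow> f x \<in> carrier M"
    "x \<in> carrier M \<Longrightarrow> y \<in> carrier M \<Longrightarrow> f (x \<oplus>\<^bsub>M\<^esub> y) = f x \<oplus>\<^bsub>M\<^esub> f y"
    "c \<in> carrier K \<Longrightarrow> x \<in> carrier M \<Longrightarrow> f (c \<odot>\<^bsub>V\<^esub> x) = c \<odot>\<^bsub>V\<^esub> f x"
  using assms by (auto simp: lin_def module_hom_def)

lemma lin_comp: "lin f \<Longrightarrow> lin g \<Longrightarrow> lin (\<lambda>x. f (g x))"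
  by (intro linI) (simp_all add: linD)

lemma lin_minus:
  assumes "lin f" "x \<in> carrier M" "y \<in> carrier M"
  shows "f (x \<ominus>\<^bsub>M\<^esub> y) = f x \<ominus>\<^bsub>M\<^esub> f y"
proof -
  have "f (x \<ominus>\<^bsub>M\<^esub> y) \<oplus>\<^bsub>M\<^esub> f y = f (x \<ominus>\<^bsub>M\<^esub> y \<oplus>\<^bsub>M\<^esub> y)"
    using assms by (simp add: linD(2)[OF assms(1)])
  also have "x \<ominus>\<^bsub>M\<^esub> y \<oplus>\<^bsub>M\<^esub> y = x"
    using assms by (simp add: a_minus_def Mod.M.a_assoc Mod.M.l_neg)
  finally show ?thesis
    using assms linD(1)[OF assms(1)] unfolding a_minus_def by (simp add: Mod.M.add.inv_solve_right)
qed

lemma diff_diff: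
  assumes "x \<in> carrier M" "y \<in> carrier M" "z \<in> carrier M"
  shows "(x \<ominus>\<^bsub>M\<^esub> y) \<ominus>\<^bsub>M\<^esub> (x \<ominus>\<^bsub>M\<^esub> z) = z \<ominus>\<^bsub>M\<^esub> y"
proof -
  have "(x \<ominus>\<^bsub>M\<^esub> y) \<ominus>\<^bsub>M\<^esub> (x \<ominus>\<^bsub>M\<^esub> z) = (x \<oplus>\<^bsub>M\<^esub> \<ominus>\<^bsub>M\<^esub> x) \<oplus>\<^bsub>M\<^esub> (z \<ominus>\<^bsub>M\<^esub> y)"
    using assms by (simp add: a_minus_def Mod.M.minus_add Mod.M.a_ac)
  then show ?thesis using assms by (simp add: Mod.M.r_neg)
qed

lemma lin_diff:
  assumes f: "lin f" and g: "lin g"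
  shows "lin (\<lambda>x. f x \<ominus>\<^bsub>M\<^esub> g x)"
proof (rule linI)
  show "x \<in> carrier M \<Longrightarrow> f x \<ominus>\<^bsub>M\<^esub> g x \<in> carrier M" for x
    using linD(1)[OF f] linD(1)[OF g] by simp
  show "f (x \<oplus>\<^bsub>M\<^esub> y) \<ominus>\<^bsub>M\<^esub> g (x \<oplus>\<^bsub>M\<^esub> y) = f x \<ominus>\<^bsub>M\<^esub> g x \<oplus>\<^bsub>M\<^esub> (f y \<ominus>\<^bsub>M\<^esub> g y)"
    if "x \<in> carrier M" "y \<in> carrier M" for x y
    using that linD(1)[OF f] linD(1)[OF g]
    by (simp add: linD(2)[OF f] linD(2)[OF g] a_minus_def Mod.M.minus_add Mod.M.a_ac)
  show "f (c \<odot>\<^bsub>V\<^esub> x) \<ominus>\<^bsub>M\<^esub> g (c \<odot>\<^bsub>V\<^esub> x) = c \<odot>\<^bsub>V\<^esub> (f x \<ominus>\<^bsub>M\<^esub> g x)"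
    if "c \<in> carrier K" "x \<in> carrier M" for c x
    using that linD(1)[OF f] linD(1)[OF g] V.smult_r_distr[of c "f x" "\<ominus>\<^bsub>M\<^esub> g x"] V.smult_r_minus[of c "g x"]
    by (simp add: linD(3)[OF f] linD(3)[OF g] a_minus_def)
qed

lemma lin_action: "a \<in> carrier A \<Longrightarrow> lin (\<lambda>x. a \<odot>\<^bsub>M\<^esub> x)"
  using Mod.right_smult_closed Mod.right_smult_add_module action_commutes_scalars[OF algebra right_module]
  by (intro linI) auto

text \<open>The family is indexed, by cells or by submodules, because different indices may carry
  equal vectors.\<close>

definition lc :: "('i \<Rightarrow> 'k) \<Rightarrow> ('i \<Rightarrow> 'm) \<Rightarrow> 'i set \<Rightarrow> 'm" where
  "lc w v S = (\<Oplus>\<^bsub>V\<^esub>i\<in>S. w i \<odot>\<^bsub>V\<^esub> v i)"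

lemma lc_closed:
  assumes "w \<in> S \<rightarrow> carrier K" "\<And>i. i \<in> S \<Longrightarrow> v i \<in> carrier M"
  shows "lc w v S \<in> carrier M"
  unfolding lc_def using assms sm_closed by (intro fsum_closed) auto

lemma lin_lc:
  assumes "lin f" "finite S" "w \<in> S \<rightarrow> carrier K" "\<And>i. i \<in> S \<Longrightarrow> v i \<in> carrier M"
  shows "f (lc w v S) = lc w (\<lambda>i. f (v i)) S"
proof -
  have "f (lc w v S) = (\<Oplus>\<^bsub>V\<^esub>i\<in>S. f (w i \<odot>\<^bsub>V\<^esub> v i))"
    unfolding lc_def using assms sm_closed linD[OF assms(1)]
    by (intro finsum_hom V.M.abelian_group_axioms) auto
  also have "\<dots> = lc w (\<lambda>i. f (v i)) S"
    unfolding lc_def using assms(2-4) linD[OF assms(1)] sm_closed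
    by (intro V.M.finsum_cong') (auto simp: Pi_iff)
  finally show ?thesis .
qed

lemma co_lc:
  assumes "l \<in> I" "finite S" "w \<in> S \<rightarrow> carrier K" "\<And>i. i \<in> S \<Longrightarrow> v i \<in> carrier M"
  shows "co l (lc w v S) = (\<Oplus>\<^bsub>K\<^esub>i\<in>S. w i \<otimes>\<^bsub>K\<^esub> co l (v i))"
proof -
  have "co l (lc w v S) = (\<Oplus>\<^bsub>K\<^esub>i\<in>S. co l (w i \<odot>\<^bsub>V\<^esub> v i))"
    unfolding lc_def using assms sm_closed by (intro co_finsum) auto
  also have "\<dots> = (\<Oplus>\<^bsub>K\<^esub>i\<in>S. w i \<otimes>\<^bsub>K\<^esub> co l (v i))"
    using assms co_smult co_closed by (intro V.R.finsum_cong') (auto simp: Pi_iff)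
  finally show ?thesis .
qed

lemma lc_diff:
  assumes "finite S" "w \<in> S \<rightarrow> carrier K" "\<And>i. i \<in> S \<Longrightarrow> v i \<in> carrier M" "\<And>i. i \<in> S \<Longrightarrow> v' i \<in> carrier M"
  shows "lc w (\<lambda>i. v i \<ominus>\<^bsub>M\<^esub> v' i) S = lc w v S \<ominus>\<^bsub>M\<^esub> lc w v' S"
proof (rule co_inject)
  have w: "\<And>i. i \<in> S \<Longrightarrow> w i \<in> carrier K" using assms(2) by auto
  show "lc w (\<lambda>i. v i \<ominus>\<^bsub>M\<^esub> v' i) S \<in> carrier M" "lc w v S \<ominus>\<^bsub>M\<^esub> lc w v' S \<in> carrier M"
    using assms by (auto intro!: lc_closed)
  fix l assume l: "l \<in> I"
  have c: "\<And>i. i \<in> S \<Longrightarrow> co l (v i) \<in> carrier K" "\<And>i. i \<in> S \<Longrightarrow> co l (v' i) \<in> carrier K"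
    using l assms co_closed by auto
  have "co l (lc w (\<lambda>i. v i \<ominus>\<^bsub>M\<^esub> v' i) S) = (\<Oplus>\<^bsub>K\<^esub>i\<in>S. w i \<otimes>\<^bsub>K\<^esub> co l (v i \<ominus>\<^bsub>M\<^esub> v' i))"
    using assms l by (intro co_lc) auto
  also have "\<dots> = (\<Oplus>\<^bsub>K\<^esub>i\<in>S. w i \<otimes>\<^bsub>K\<^esub> co l (v i) \<oplus>\<^bsub>K\<^esub> \<ominus>\<^bsub>K\<^esub> (w i \<otimes>\<^bsub>K\<^esub> co l (v' i)))"
    using w c l assms(3,4) unfolding a_minus_def[symmetric]
    by (intro V.R.finsum_cong') (auto simp: co_minus a_minus_def[where R = K] V.R.r_distr V.R.r_minus)
  also have "\<dots> = (\<Oplus>\<^bsub>K\<^esub>i\<in>S. w i \<otimes>\<^bsub>K\<^esub> co l (v i)) \<oplus>\<^bsub>K\<^esub> (\<Oplus>\<^bsub>K\<^esub>i\<in>S. \<ominus>\<^bsub>K\<^esub> (w i \<otimes>\<^bsub>K\<^esub> co l (v' i)))"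
    using w c by (intro V.R.finsum_addf) auto
  also have "\<dots> = (\<Oplus>\<^bsub>K\<^esub>i\<in>S. w i \<otimes>\<^bsub>K\<^esub> co l (v i)) \<oplus>\<^bsub>K\<^esub> \<ominus>\<^bsub>K\<^esub> (\<Oplus>\<^bsub>K\<^esub>i\<in>S. w i \<otimes>\<^bsub>K\<^esub> co l (v' i))"
    using w c assms(1) by (subst V.R.finsum_minus) auto
  also have "\<dots> = co l (lc w v S) \<ominus>\<^bsub>K\<^esub> co l (lc w v' S)"
    using assms l by (simp add: co_lc a_minus_def)
  also have "\<dots> = co l (lc w v S \<ominus>\<^bsub>M\<^esub> lc w v' S)"
    using assms l by (intro co_minus[symmetric] lc_closed) auto
  finally show "co l (lc w (\<lambda>i. v i \<ominus>\<^bsub>M\<^esub> v' i) S) = co l (lc w v S \<ominus>\<^bsub>M\<^esub> lc w v' S)" .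
qed

text \<open>The matrix unit that moves the pivot position of a cell to its nonpivot position. These
  maps span the tangent directions of the cell.\<close>

definition cell_map :: "nat \<times> nat \<Rightarrow> 'm \<Rightarrow> 'm" where
  "cell_map q v = co (fst q) v \<odot>\<^bsub>V\<^esub> e (snd q)"

lemma cell_map_closed: "fst q \<in> I \<Longrightarrow> snd q \<in> I \<Longrightarrow> v \<in> carrier M \<Longrightarrow> cell_map q v \<in> carrier M"
  unfolding cell_map_def by (intro sm_closed co_closed e_closed)

lemma co_cell_map:
  assumes "fst q \<in> I" "snd q \<in> I" "v \<in> carrier M" "l \<in> I"
  shows "co l (cell_map q v) = (if l = snd q then co (fst q) v else \<zero>\<^bsub>K\<^esub>)"
  unfolding cell_map_def using assms co_closed e_closed by (simp add: co_smult co_e)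

lemma lin_cell_map:
  assumes "fst q \<in> I" "snd q \<in> I"
  shows "lin (cell_map q)"
proof (rule linI)
  show "cell_map q (x \<oplus>\<^bsub>M\<^esub> y) = cell_map q x \<oplus>\<^bsub>M\<^esub> cell_map q y" if "x \<in> carrier M" "y \<in> carrier M" for x y
    unfolding cell_map_def using that assms co_closed e_closed V.smult_l_distr by (simp add: co_add)
  show "cell_map q (c \<odot>\<^bsub>V\<^esub> x) = c \<odot>\<^bsub>V\<^esub> cell_map q x" if "c \<in> carrier K" "x \<in> carrier M" for c x
    unfolding cell_map_def using that assms co_closed e_closed V.smult_assoc1 by (simp add: co_smult)
qed (use assms cell_map_closed in auto)

lemma echelon_cellsD:
  assumes "q \<in> echelon_cells I S" "S \<subseteq> I"
  shows "fst q \<in> I" "snd q \<in> I" "fst q \<in> S" "snd q \<notin> S" "snd q < fst q"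
  using assms by (auto simp: echelon_cells_def)

lemma finite_echelon_cells: "S \<subseteq> I \<Longrightarrow> finite (echelon_cells I S)"
  by (rule finite_subset[OF _ finite_cartesian_product[OF finite_I finite_I]]) (auto simp: echelon_cells_def)

lemma rigid_coordinatized: "rigid A M U \<Longrightarrow> coordinatized_submodule K A M I e co U"
  by (intro coordinatized_submodule.intro coordinatized_module_axioms coordinatized_submodule_axioms.intro)
    (simp add: rigid_def)

text \<open>All cells point to nonpivots. So these combinations take values in a complement of every
  submodule with pivot set \<open>S\<close>.\<close>

lemma co_lc_cell_map_pivot:
  assumes "S \<subseteq> I" "X \<in> echelon_cells I S \<rightarrow> carrier K" "y \<in> carrier M" "l \<in> S"
  shows "co l (lc X (\<lambda>q. cell_map q y) (echelon_cells I S)) = \<zero>\<^bsub>K\<^esub>"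
proof -
  note Q = echelon_cellsD[OF _ assms(1)]
  have l: "l \<in> I" using assms by auto
  have "co l (lc X (\<lambda>q. cell_map q y) (echelon_cells I S)) = (\<Oplus>\<^bsub>K\<^esub>q\<in>echelon_cells I S. X q \<otimes>\<^bsub>K\<^esub> co l (cell_map q y))"
    using assms l Q cell_map_closed finite_echelon_cells by (intro co_lc) auto
  also have "\<dots> = (\<Oplus>\<^bsub>K\<^esub>q\<in>echelon_cells I S. \<zero>\<^bsub>K\<^esub>)"
  proof (intro V.R.finsum_cong')
    fix q assume q: "q \<in> echelon_cells I S"
    then have "co l (cell_map q y) = \<zero>\<^bsub>K\<^esub>"
      using co_cell_map[OF Q(1,2)[OF q] assms(3) l] Q(4)[OF q] assms(4) by auto
    then show "X q \<otimes>\<^bsub>K\<^esub> co l (cell_map q y) = \<zero>\<^bsub>K\<^esub>" using assms(2) q by (auto simp: Pi_iff)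
  qed auto
  finally show ?thesis by simp
qed

text \<open>The cells that reach coordinate \<open>l\<close> correspond to the pivots above
  \<open>l\<close>.\<close>

lemma co_lc_cell_map_nonpivot:
  assumes "S \<subseteq> I" "X \<in> echelon_cells I S \<rightarrow> carrier K" "y \<in> carrier M" "l \<in> I - S"
  shows "co l (lc X (\<lambda>q. cell_map q y) (echelon_cells I S))
    = (\<Oplus>\<^bsub>K\<^esub>s\<in>{s \<in> S. l < s}. X (s, l) \<otimes>\<^bsub>K\<^esub> co s y)"
proof -
  let ?Q = "echelon_cells I S"
  let ?P = "(\<lambda>s. (s, l)) ` {s \<in> S. l < s}"
  note Q = echelon_cellsD[OF _ assms(1)]
  have l: "l \<in> I" using assms by auto
  have P: "?P \<subseteq> ?Q" using assms by (auto simp: echelon_cells_def)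
  have X: "X q \<in> carrier K" if "q \<in> ?Q" for q using assms(2) that by auto
  have cy: "co (fst q) y \<in> carrier K" if "q \<in> ?Q" for q using co_closed Q(1)[OF that] assms(3) by blast
  have "co l (lc X (\<lambda>q. cell_map q y) ?Q) = (\<Oplus>\<^bsub>K\<^esub>q\<in>?Q. X q \<otimes>\<^bsub>K\<^esub> co l (cell_map q y))"
    using assms l Q cell_map_closed finite_echelon_cells by (intro co_lc) auto
  also have "\<dots> = (\<Oplus>\<^bsub>K\<^esub>q\<in>?P. X q \<otimes>\<^bsub>K\<^esub> co (fst q) y)"
  proof (rule V.R.add.finprod_mono_neutral_cong_left[symmetric])
    show "finite ?Q" using assms by (intro finite_echelon_cells)
    show "?P \<subseteq> ?Q" by (rule P)
    fix q assume q: "q \<in> ?Q - ?P"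
    then have "snd q \<noteq> l" using Q by (cases q) force
    then show "X q \<otimes>\<^bsub>K\<^esub> co l (cell_map q y) = \<zero>\<^bsub>K\<^esub>"
      using q X Q(1,2)[of q] assms(3) l by (simp add: co_cell_map)
  next
    fix q assume q: "q \<in> ?P"
    then have "co l (cell_map q y) = co (fst q) y"
      using co_cell_map[of q y l] Q(1,2)[of q] P assms(3) l by auto
    then show "X q \<otimes>\<^bsub>K\<^esub> co (fst q) y = X q \<otimes>\<^bsub>K\<^esub> co l (cell_map q y)" by simp
  next
    show "(\<lambda>q. X q \<otimes>\<^bsub>K\<^esub> co l (cell_map q y)) \<in> ?Q \<rightarrow> carrier K"
      using X Q(1,2) cell_map_closed assms(3) l co_closed by auto
  qed
  also have "\<dots> = (\<Oplus>\<^bsub>K\<^esub>s\<in>{s \<in> S. l < s}. X (s, l) \<otimes>\<^bsub>K\<^esub> co (fst (s, l)) y)"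
  proof (rule V.R.finsum_reindex)
    show "(\<lambda>q. X q \<otimes>\<^bsub>K\<^esub> co (fst q) y) \<in> ?P \<rightarrow> carrier K"
    proof
      fix q assume "q \<in> ?P"
      then have "q \<in> ?Q" using P by blast
      then show "X q \<otimes>\<^bsub>K\<^esub> co (fst q) y \<in> carrier K" using X cy by simp
    qed
  qed (auto intro: inj_onI)
  finally show ?thesis by simp
qed

end

context coordinatized_submodule
begin

lemma lin_proj: "lin (proj U)"
  by (intro linI proj_carrier proj_add proj_smult)

text \<open>Subtracting the projection identifies the quotient by \<open>U\<close> with the span of
  the nonpivot vectors, so membership in \<open>U\<close> becomes a system of linear
  equations.\<close>

lemma proj_split:
  assumes "v \<in> carrier M"
  shows "v \<in> U \<longleftrightarrow> v \<ominus>\<^bsub>M\<^esub> proj U v = \<zero>\<^bsub>M\<^esub>"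
proof
  assume "v \<in> U"
  then show "v \<ominus>\<^bsub>M\<^esub> proj U v = \<zero>\<^bsub>M\<^esub>" using assms by (simp add: proj_eq)
next
  assume "v \<ominus>\<^bsub>M\<^esub> proj U v = \<zero>\<^bsub>M\<^esub>"
  then have "v = proj U v" using assms proj_carrier by simp
  then show "v \<in> U" using proj_in[OF assms] by simp
qed

text \<open>
  The third assumption says that \<open>f\<close> is an infinitesimal deformation of \<open>U\<close>: modulo \<open>U\<close> it is a
  homomorphism from \<open>U\<close> to \<open>M / U\<close>.
\<close>

lemma deformation_trivial:
  assumes "hom_trivial A (M\<lparr>carrier := U\<rparr>) (quotient_module M U)" "lin f"
    and "\<And>a u. a \<in> carrier A \<Longrightarrow> u \<in> U \<Longrightarrow> f (a \<odot>\<^bsub>M\<^esub> u) \<ominus>\<^bsub>M\<^esub> a \<odot>\<^bsub>M\<^esub> f u \<in> U"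
    and "u \<in> U"
  shows "f u \<in> U"
proof -
  interpret N: abelian_subgroup U M
    by (rule right_module_additive_subgroup[OF right_module submodule])
  have fc: "f u \<in> carrier M" if "u \<in> U" for u
    using linD(1)[OF assms(2)] U_carrier that by blast
  have "(\<lambda>u. U +>\<^bsub>M\<^esub> f u) \<in> module_hom A (M\<lparr>carrier := U\<rparr>) (quotient_module M U)"
    unfolding module_hom_def
  proof (intro CollectI conjI allI impI Pi_I)
    fix u assume "u \<in> carrier (M\<lparr>carrier := U\<rparr>)"
    then show "U +>\<^bsub>M\<^esub> f u \<in> carrier (quotient_module M U)"
      using fc by (auto simp: Mod.carrier_quotient_module)
  next
    fix u v assume "u \<in> carrier (M\<lparr>carrier := U\<rparr>) \<and> v \<in> carrier (M\<lparr>carrier := U\<rparr>)"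
    then show "U +>\<^bsub>M\<^esub> f (u \<oplus>\<^bsub>M\<lparr>carrier := U\<rparr>\<^esub> v)
        = (U +>\<^bsub>M\<^esub> f u) \<oplus>\<^bsub>quotient_module M U\<^esub> (U +>\<^bsub>M\<^esub> f v)"
      using fc U_carrier linD(2)[OF assms(2)] by (simp add: Mod.quotient_module_add[OF submodule])
  next
    fix a u assume "a \<in> carrier A \<and> u \<in> carrier (M\<lparr>carrier := U\<rparr>)"
    then have a: "a \<in> carrier A" and u: "u \<in> U" by auto
    have c: "f (a \<odot>\<^bsub>M\<^esub> u) \<in> carrier M" "a \<odot>\<^bsub>M\<^esub> f u \<in> carrier M"
      using a u U_closed(6) fc Mod.right_smult_closed by auto
    have "f (a \<odot>\<^bsub>M\<^esub> u) \<in> U +>\<^bsub>M\<^esub> (a \<odot>\<^bsub>M\<^esub> f u)"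
      using c assms(3)[OF a u] by (simp add: N.a_rcos_module a_minus_def)
    then have "U +>\<^bsub>M\<^esub> (a \<odot>\<^bsub>M\<^esub> f u) = U +>\<^bsub>M\<^esub> f (a \<odot>\<^bsub>M\<^esub> u)"
      using c(2) by (rule N.a_repr_independence')
    then show "U +>\<^bsub>M\<^esub> f (a \<odot>\<^bsub>M\<lparr>carrier := U\<rparr>\<^esub> u) = a \<odot>\<^bsub>quotient_module M U\<^esub> (U +>\<^bsub>M\<^esub> f u)"
      using a u fc by (simp add: Mod.quotient_module_smult[OF submodule])
  qed
  then have "U +>\<^bsub>M\<^esub> f u = U"
    using assms(1,4) by (auto simp: hom_trivial_def quotient_module_def)
  moreover have "f u \<in> U +>\<^bsub>M\<^esub> f u" using fc[OF assms(4)] by (rule N.a_rcos_self)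
  ultimately show ?thesis by simp
qed

end

context coordinatized_module
begin

text \<open>Reduced vectors of two submodules with the same pivots agree at all pivots and vanish
  above their own pivot. So they differ only in the cells, and the difference of the projections is
  a tangent direction.\<close>

lemma lc_cell_map_eq_diff_proj:
  assumes "rigid A M U" "rigid A M U'" "pivots U = S" "pivots U' = S" "y \<in> carrier M"
  shows "lc (\<lambda>q. co (snd q) (reduced U (fst q)) \<ominus>\<^bsub>K\<^esub> co (snd q) (reduced U' (fst q)))
      (\<lambda>q. cell_map q y) (echelon_cells I S) = proj U y \<ominus>\<^bsub>M\<^esub> proj U' y"
    (is "lc ?X _ ?Q = _")
proof (rule co_inject)
  interpret U: coordinatized_submodule K A M I e co U by (rule rigid_coordinatized[OF assms(1)])
  interpret U': coordinatized_submodule K A M I e co U' by (rule rigid_coordinatized[OF assms(2)])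
  have S: "S \<subseteq> I" "finite S" using pivots_subset(1) finite_pivots assms(3) by auto
  note Q = echelon_cellsD[OF _ S(1)]
  have rc: "reduced U s \<in> carrier M" "reduced U' s \<in> carrier M" if "s \<in> S" for s
    using U.reduced_carrier U'.reduced_carrier assms that by auto
  have cr: "co l (reduced U s) \<in> carrier K" "co l (reduced U' s) \<in> carrier K" if "s \<in> S" "l \<in> I" for s l
    using rc that co_closed by auto
  have cy: "co s y \<in> carrier K" if "s \<in> S" for s using that S assms(5) co_closed by auto
  have X: "?X \<in> ?Q \<rightarrow> carrier K" using cr Q(2,3) by auto
  show "lc ?X (\<lambda>q. cell_map q y) ?Q \<in> carrier M"
    using X Q(1,2) assms(5) cell_map_closed by (intro lc_closed) auto
  have pc: "proj U y \<in> carrier M" "proj U' y \<in> carrier M"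
    using U.proj_carrier U'.proj_carrier assms(5) by auto
  then show "proj U y \<ominus>\<^bsub>M\<^esub> proj U' y \<in> carrier M" by simp
  fix l assume l: "l \<in> I"
  show "co l (lc ?X (\<lambda>q. cell_map q y) ?Q) = co l (proj U y \<ominus>\<^bsub>M\<^esub> proj U' y)"
  proof (cases "l \<in> S")
    case True
    then show ?thesis
      using co_lc_cell_map_pivot[OF S(1) X assms(5) True] U.co_pivot_proj[OF assms(5), of l]
        U'.co_pivot_proj[OF assms(5), of l] assms(3,4) pc l cy[OF True] by (simp add: co_minus a_minus_def[where R = K] V.R.r_neg)
  next
    case False
    let ?g = "\<lambda>s. co l (reduced U s) \<ominus>\<^bsub>K\<^esub> co l (reduced U' s)"
    have "co l (lc ?X (\<lambda>q. cell_map q y) ?Q) = (\<Oplus>\<^bsub>K\<^esub>s\<in>{s \<in> S. l < s}. ?g s \<otimes>\<^bsub>K\<^esub> co s y)"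
      using co_lc_cell_map_nonpivot[OF S(1) X assms(5), of l] l False by simp
    \<comment> \<open>Pivots below \<open>l\<close> may be added, since their reduced vectors vanish
      at \<open>l\<close>.\<close>
    also have "\<dots> = (\<Oplus>\<^bsub>K\<^esub>s\<in>S. ?g s \<otimes>\<^bsub>K\<^esub> co s y)"
    proof (rule V.R.add.finprod_mono_neutral_cong_left)
      fix s assume "s \<in> S - {s \<in> S. l < s}"
      then have s: "s \<in> S" "s < l" using False by (auto simp: not_less le_less)
      then show "?g s \<otimes>\<^bsub>K\<^esub> co s y = \<zero>\<^bsub>K\<^esub>"
        using U.reduced(2)[of s l] U'.reduced(2)[of s l] assms(3,4) l cy by (simp add: a_minus_def[where R = K])
    qed (use S cr l cy in auto)
    also have "\<dots> = (\<Oplus>\<^bsub>K\<^esub>s\<in>S. co s y \<otimes>\<^bsub>K\<^esub> co l (reduced U s)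
        \<oplus>\<^bsub>K\<^esub> \<ominus>\<^bsub>K\<^esub> (co s y \<otimes>\<^bsub>K\<^esub> co l (reduced U' s)))"
    proof (intro V.R.finsum_cong')
      fix s assume "s \<in> S"
      then have "co s y \<in> carrier K" "co l (reduced U s) \<in> carrier K" "co l (reduced U' s) \<in> carrier K"
        using cy cr l by auto
      then show "?g s \<otimes>\<^bsub>K\<^esub> co s y = co s y \<otimes>\<^bsub>K\<^esub> co l (reduced U s)
        \<oplus>\<^bsub>K\<^esub> \<ominus>\<^bsub>K\<^esub> (co s y \<otimes>\<^bsub>K\<^esub> co l (reduced U' s))"
        by (simp add: a_minus_def V.R.l_distr V.R.r_distr V.R.l_minus V.R.r_minus V.R.m_comm)
    qed (use cy cr l in auto)
    also have "\<dots> = (\<Oplus>\<^bsub>K\<^esub>s\<in>S. co s y \<otimes>\<^bsub>K\<^esub> co l (reduced U s))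
        \<oplus>\<^bsub>K\<^esub> (\<Oplus>\<^bsub>K\<^esub>s\<in>S. \<ominus>\<^bsub>K\<^esub> (co s y \<otimes>\<^bsub>K\<^esub> co l (reduced U' s)))"
      using cy cr l by (intro V.R.finsum_addf) auto
    also have "\<dots> = (\<Oplus>\<^bsub>K\<^esub>s\<in>S. co s y \<otimes>\<^bsub>K\<^esub> co l (reduced U s))
        \<oplus>\<^bsub>K\<^esub> \<ominus>\<^bsub>K\<^esub> (\<Oplus>\<^bsub>K\<^esub>s\<in>S. co s y \<otimes>\<^bsub>K\<^esub> co l (reduced U' s))"
      using cy cr l S by (subst V.R.finsum_minus) auto
    also have "\<dots> = co l (proj U y \<ominus>\<^bsub>M\<^esub> proj U' y)"
      using U.co_proj[OF assms(5) l] U'.co_proj[OF assms(5) l] pc l assms(3,4)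
      by (simp add: co_minus) (simp add: a_minus_def)
    finally show ?thesis .
  qed
qed

text \<open>
  The matrix \<open>\<Phi> U' U\<close> represents \<open>f \<mapsto> (u \<mapsto> f (u a) - f (u) a)\<close>, from the maps \<open>U \<rightarrow> M / U'\<close> in the
  directions of the cell to the families of maps indexed by \<open>a\<close>; its entries are affine in the
  coordinates of \<open>U\<close>. Its kernel consists of homomorphisms \<open>U \<rightarrow> M / U'\<close>, so it is zero if \<open>U = U'\<close>,
  and contains the restricted projection, with coordinates \<open>x U - x U'\<close>, otherwise.
\<close>

lemma card_rigid_le:
  assumes "finite J" "\<And>U. U \<in> J \<Longrightarrow> rigid A M U" "\<And>U. U \<in> J \<Longrightarrow> pivots U = S" "S \<subseteq> I"
  shows "card J \<le> 4 ^ card (echelon_cells I S)"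
proof -
  let ?Q = "echelon_cells I S"
  define x where "x U q = co (snd q) (reduced U (fst q))" for U and q :: "nat \<times> nat"
  \<comment> \<open>The commutator of a cell map with the action of \<open>a\<close>, taken modulo
    \<open>U\<close> by means of the complementary projection.\<close>
  define T where "T U a q y = (let z = cell_map q (a \<odot>\<^bsub>M\<^esub> y) \<ominus>\<^bsub>M\<^esub> a \<odot>\<^bsub>M\<^esub> cell_map q y in z \<ominus>\<^bsub>M\<^esub> proj U z)"
    for U a q y
  \<comment> \<open>Rows are indexed by vectors \<open>v\<close> of \<open>M\<close> rather than of
    \<open>U\<close>, so that all matrices have the same rows. The submodule \<open>U\<close> enters
    only through \<open>proj U v\<close>, which is affine in the coordinates
    \<open>x U\<close>.\<close>
  define \<Phi> where "\<Phi> U' U r q = (case r of (a, v, l) \<Rightarrow> co l (T U' a q (proj U v)))" for U' U r q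
  define h where "h X y = lc X (\<lambda>q. cell_map q y) ?Q" for X y
  note Q = echelon_cellsD[OF _ assms(4)]
  have finQ: "finite ?Q" using assms(4) by (rule finite_echelon_cells)
  have sub: "coordinatized_submodule K A M I e co U" if "U \<in> J" for U
    using assms(2)[OF that] by (rule rigid_coordinatized)
  note proj_carrier = coordinatized_submodule.proj_carrier[OF sub]
  have linT: "lin (T U a q)" if "U \<in> J" "a \<in> carrier A" "q \<in> ?Q" for U a q
  proof -
    have 1: "lin (\<lambda>y. cell_map q (a \<odot>\<^bsub>M\<^esub> y) \<ominus>\<^bsub>M\<^esub> a \<odot>\<^bsub>M\<^esub> cell_map q y)"
      using lin_diff[OF lin_comp[OF lin_cell_map lin_action] lin_comp[OF lin_action lin_cell_map]] that Q by blast
    have "lin (\<lambda>y. (cell_map q (a \<odot>\<^bsub>M\<^esub> y) \<ominus>\<^bsub>M\<^esub> a \<odot>\<^bsub>M\<^esub> cell_map q y)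
        \<ominus>\<^bsub>M\<^esub> proj U (cell_map q (a \<odot>\<^bsub>M\<^esub> y) \<ominus>\<^bsub>M\<^esub> a \<odot>\<^bsub>M\<^esub> cell_map q y))"
      by (rule lin_diff[OF 1 lin_comp[OF coordinatized_submodule.lin_proj[OF sub[OF that(1)]] 1]])
    then show ?thesis unfolding T_def Let_def .
  qed
  have hc: "h X y \<in> carrier M" if "X \<in> ?Q \<rightarrow> carrier K" "y \<in> carrier M" for X y
    unfolding h_def using that Q cell_map_closed by (intro lc_closed) auto
  have lin_h: "lin (h X)" if X: "X \<in> ?Q \<rightarrow> carrier K" for X
  proof (rule linI)
    have ec: "X q \<odot>\<^bsub>V\<^esub> cell_map q y \<in> carrier M" if "q \<in> ?Q" "y \<in> carrier M" for q y
      using sm_closed[of "X q" "cell_map q y"] X cell_map_closed[OF Q(1,2)[OF that(1)] that(2)] that(1)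
      by (simp add: Pi_iff)
    show "h X (y \<oplus>\<^bsub>M\<^esub> z) = h X y \<oplus>\<^bsub>M\<^esub> h X z" if "y \<in> carrier M" "z \<in> carrier M" for y z
    proof -
      have "h X (y \<oplus>\<^bsub>M\<^esub> z) = (\<Oplus>\<^bsub>V\<^esub>q\<in>?Q. X q \<odot>\<^bsub>V\<^esub> cell_map q y \<oplus>\<^bsub>V\<^esub> X q \<odot>\<^bsub>V\<^esub> cell_map q z)"
        unfolding h_def lc_def
      proof (intro V.M.finsum_cong')
        fix q assume q: "q \<in> ?Q"
        then have "X q \<in> carrier K" using X by auto
        then show "X q \<odot>\<^bsub>V\<^esub> cell_map q (y \<oplus>\<^bsub>M\<^esub> z) = X q \<odot>\<^bsub>V\<^esub> cell_map q y \<oplus>\<^bsub>V\<^esub> X q \<odot>\<^bsub>V\<^esub> cell_map q z"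
          using linD(2)[OF lin_cell_map[OF Q(1,2)[OF q]] that] V.smult_r_distr[of "X q" "cell_map q y" "cell_map q z"]
            cell_map_closed[OF Q(1,2)[OF q]] that by simp
      qed (use ec that in auto)
      also have "\<dots> = h X y \<oplus>\<^bsub>V\<^esub> h X z"
        unfolding h_def lc_def using ec that by (intro V.M.finsum_addf) auto
      finally show ?thesis by simp
    qed
    show "h X (c \<odot>\<^bsub>V\<^esub> y) = c \<odot>\<^bsub>V\<^esub> h X y" if "c \<in> carrier K" "y \<in> carrier M" for c y
    proof -
      have "h X (c \<odot>\<^bsub>V\<^esub> y) = (\<Oplus>\<^bsub>V\<^esub>q\<in>?Q. c \<odot>\<^bsub>V\<^esub> (X q \<odot>\<^bsub>V\<^esub> cell_map q y))"
        unfolding h_def lc_def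
      proof (intro V.M.finsum_cong')
        fix q assume q: "q \<in> ?Q"
        then have "X q \<in> carrier K" using X by auto
        then show "X q \<odot>\<^bsub>V\<^esub> cell_map q (c \<odot>\<^bsub>V\<^esub> y) = c \<odot>\<^bsub>V\<^esub> (X q \<odot>\<^bsub>V\<^esub> cell_map q y)"
          using linD(3)[OF lin_cell_map[OF Q(1,2)[OF q]] that] cell_map_closed[OF Q(1,2)[OF q]] that
            V.smult_assoc1[of "X q" c "cell_map q y"] V.smult_assoc1[of c "X q" "cell_map q y"]
          by (simp add: V.R.m_comm)
      qed (use ec that sm_closed in auto)
      also have "\<dots> = c \<odot>\<^bsub>V\<^esub> h X y"
        unfolding h_def lc_def using ec that finQ by (intro V.finsum_smult_ldistr[symmetric]) auto
      finally show ?thesis .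
    qed
  qed (rule hc[OF X])
  \<comment> \<open>Applied to \<open>X\<close>, the matrix gives the failure of \<open>h X\<close>
    to be a homomorphism from \<open>U\<close> to the quotient by \<open>U'\<close>.\<close>
  have sum_\<Phi>: "(\<Oplus>\<^bsub>K\<^esub>q\<in>?Q. \<Phi> U' U (a, v, l) q \<otimes>\<^bsub>K\<^esub> X q)
      = co l (let z = h X (a \<odot>\<^bsub>M\<^esub> proj U v) \<ominus>\<^bsub>M\<^esub> a \<odot>\<^bsub>M\<^esub> h X (proj U v) in z \<ominus>\<^bsub>M\<^esub> proj U' z)"
    if UJ: "U \<in> J" "U' \<in> J" and X: "X \<in> ?Q \<rightarrow> carrier K"
      and r: "a \<in> carrier A" "v \<in> carrier M" "l \<in> I" for U U' X a v l
  proof -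
    define y where "y = proj U v"
    have y: "y \<in> carrier M" "a \<odot>\<^bsub>M\<^esub> y \<in> carrier M"
      using proj_carrier[OF UJ(1) r(2)] Mod.right_smult_closed r by (auto simp: y_def)
    have ec: "\<And>q. q \<in> ?Q \<Longrightarrow> cell_map q y \<in> carrier M" "\<And>q. q \<in> ?Q \<Longrightarrow> cell_map q (a \<odot>\<^bsub>M\<^esub> y) \<in> carrier M"
      using Q y cell_map_closed by auto
    have ac: "\<And>q. q \<in> ?Q \<Longrightarrow> a \<odot>\<^bsub>M\<^esub> cell_map q y \<in> carrier M" using ec r Mod.right_smult_closed by auto
    let ?z = "\<lambda>q. cell_map q (a \<odot>\<^bsub>M\<^esub> y) \<ominus>\<^bsub>M\<^esub> a \<odot>\<^bsub>M\<^esub> cell_map q y"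
    have z: "\<And>q. q \<in> ?Q \<Longrightarrow> ?z q \<in> carrier M" using ec ac by simp
    have Tc: "\<And>q. q \<in> ?Q \<Longrightarrow> T U' a q y \<in> carrier M" using linD(1)[OF linT] UJ r y by blast
    have "(\<Oplus>\<^bsub>K\<^esub>q\<in>?Q. \<Phi> U' U (a, v, l) q \<otimes>\<^bsub>K\<^esub> X q) = (\<Oplus>\<^bsub>K\<^esub>q\<in>?Q. X q \<otimes>\<^bsub>K\<^esub> co l (T U' a q y))"
    proof (intro V.R.finsum_cong')
      fix q assume q: "q \<in> ?Q"
      then have "X q \<in> carrier K" "co l (T U' a q y) \<in> carrier K" using X Tc co_closed r by auto
      then show "\<Phi> U' U (a, v, l) q \<otimes>\<^bsub>K\<^esub> X q = X q \<otimes>\<^bsub>K\<^esub> co l (T U' a q y)"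
        by (simp add: \<Phi>_def y_def V.R.m_comm)
    qed (use X Tc co_closed r in auto)
    also have "\<dots> = co l (lc X (\<lambda>q. T U' a q y) ?Q)"
      using X Tc r finQ by (intro co_lc[symmetric]) auto
    also have "lc X (\<lambda>q. T U' a q y) ?Q = lc X ?z ?Q \<ominus>\<^bsub>M\<^esub> lc X (\<lambda>q. proj U' (?z q)) ?Q"
      unfolding T_def Let_def using X z finQ proj_carrier[OF UJ(2)] by (intro lc_diff) auto
    also have "lc X (\<lambda>q. proj U' (?z q)) ?Q = proj U' (lc X ?z ?Q)"
      using X z finQ by (intro lin_lc[symmetric] coordinatized_submodule.lin_proj[OF sub[OF UJ(2)]]) auto
    also have "lc X ?z ?Q = h X (a \<odot>\<^bsub>M\<^esub> y) \<ominus>\<^bsub>M\<^esub> lc X (\<lambda>q. a \<odot>\<^bsub>M\<^esub> cell_map q y) ?Q"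
      unfolding h_def using X ec ac finQ by (intro lc_diff) auto
    also have "lc X (\<lambda>q. a \<odot>\<^bsub>M\<^esub> cell_map q y) ?Q = a \<odot>\<^bsub>M\<^esub> h X y"
      unfolding h_def using X ec finQ by (intro lin_lc[symmetric] lin_action r) auto
    finally show ?thesis unfolding Let_def y_def .
  qed
  show ?thesis
  proof (rule V.field.card_le_four_power[where x = x and \<Phi> = \<Phi> and Rows = "carrier A \<times> carrier M \<times> I"])
    show "finite J" "finite ?Q" by fact+
    have xc: "co l (reduced U s) \<in> carrier K" if "U \<in> J" "s \<in> S" "l \<in> I" for U s l
      using coordinatized_submodule.reduced_carrier[OF sub[OF that(1)]] assms(3)[OF that(1)] that co_closed by auto
    show x: "x U q \<in> carrier K" if "U \<in> J" "q \<in> ?Q" for U q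
      unfolding x_def using that Q xc by blast
    show "\<Phi> U' U r q \<in> carrier K"
      if J: "U' \<in> J" "U \<in> J" and r: "r \<in> carrier A \<times> carrier M \<times> I" and q: "q \<in> ?Q" for U' U r q
    proof -
      obtain a v l where avl: "r = (a, v, l)" "a \<in> carrier A" "v \<in> carrier M" "l \<in> I" using r by auto
      have "T U' a q (proj U v) \<in> carrier M"
        by (rule linD(1)[OF linT[OF J(1) avl(2) q] proj_carrier[OF J(2) avl(3)]])
      then show ?thesis using co_closed[OF avl(4)] by (simp add: \<Phi>_def avl(1))
    qed
    show "V.R.affine_on J ?Q x (\<lambda>U. \<Phi> U' U r q)"
      if U': "U' \<in> J" and r: "r \<in> carrier A \<times> carrier M \<times> I" and q: "q \<in> ?Q" for U' r q
      unfolding V.R.affine_on_def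
    proof (intro ballI impI)
      fix w assume w: "w \<in> J \<rightarrow> carrier K" "(\<Oplus>\<^bsub>K\<^esub>U\<in>J. w U) = \<zero>\<^bsub>K\<^esub>"
        "\<forall>p\<in>?Q. (\<Oplus>\<^bsub>K\<^esub>U\<in>J. w U \<otimes>\<^bsub>K\<^esub> x U p) = \<zero>\<^bsub>K\<^esub>"
      obtain a v l where avl: "r = (a, v, l)" "a \<in> carrier A" "v \<in> carrier M" "l \<in> I" using r by auto
      have wc: "\<And>U. U \<in> J \<Longrightarrow> w U \<in> carrier K" using w(1) by auto
      \<comment> \<open>The coordinates of a reduced vector are constant at the pivots, zero above
        its own pivot, and free entries \<open>x U p\<close> elsewhere. The weights annihilate all
        three kinds.\<close>
      have red: "lc w (\<lambda>U. reduced U s) J = \<zero>\<^bsub>M\<^esub>" if s: "s \<in> S" for s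
      proof (rule co_eq_zero)
        have rc: "\<And>U. U \<in> J \<Longrightarrow> reduced U s \<in> carrier M"
          using coordinatized_submodule.reduced_carrier[OF sub] assms(3) s by blast
        show "lc w (\<lambda>U. reduced U s) J \<in> carrier M" using w(1) rc by (intro lc_closed) auto
        fix m assume m: "m \<in> I"
        have eq: "co m (lc w (\<lambda>U. reduced U s) J) = (\<Oplus>\<^bsub>K\<^esub>U\<in>J. w U \<otimes>\<^bsub>K\<^esub> co m (reduced U s))"
          using w(1) rc m assms(1) by (intro co_lc) auto
        consider "m \<in> S" | "m \<notin> S" "s < m" | "m \<notin> S" "m < s" using s by fastforce
        then show "co m (lc w (\<lambda>U. reduced U s) J) = \<zero>\<^bsub>K\<^esub>"
        proof cases
          case 1
          define d where "d = (if m = s then \<one>\<^bsub>K\<^esub> else \<zero>\<^bsub>K\<^esub>)"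
          have "co m (reduced U s) = d" if "U \<in> J" for U
            using coordinatized_submodule.reduced(3)[OF sub[OF that], of s m] assms(3)[OF that] s 1 by (simp add: d_def)
          then have "(\<Oplus>\<^bsub>K\<^esub>U\<in>J. w U \<otimes>\<^bsub>K\<^esub> co m (reduced U s)) = (\<Oplus>\<^bsub>K\<^esub>U\<in>J. w U \<otimes>\<^bsub>K\<^esub> d)"
            using wc by (intro V.R.finsum_cong') (auto simp: d_def)
          also have "\<dots> = (\<Oplus>\<^bsub>K\<^esub>U\<in>J. w U) \<otimes>\<^bsub>K\<^esub> d"
            using wc assms(1) by (intro V.R.finsum_ldistr[symmetric]) (auto simp: d_def)
          finally show ?thesis using w(2) by (simp add: eq d_def)
        next
          case 2
          have "co m (reduced U s) = \<zero>\<^bsub>K\<^esub>" if "U \<in> J" for U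
            using coordinatized_submodule.reduced(2)[OF sub[OF that], of s m] assms(3)[OF that] s 2 m by simp
          then have "(\<Oplus>\<^bsub>K\<^esub>U\<in>J. w U \<otimes>\<^bsub>K\<^esub> co m (reduced U s)) = (\<Oplus>\<^bsub>K\<^esub>U\<in>J. \<zero>\<^bsub>K\<^esub>)"
            using wc by (intro V.R.finsum_cong') auto
          then show ?thesis by (simp add: eq)
        next
          case 3
          then have "(s, m) \<in> ?Q" using s m by (simp add: echelon_cells_def)
          then show ?thesis using w(3) unfolding eq by (force simp: x_def)
        qed
      qed
      have pc: "\<And>U. U \<in> J \<Longrightarrow> proj U v \<in> carrier M" using proj_carrier avl by blast
      \<comment> \<open>\<open>proj U v\<close> combines the reduced vectors with coefficients
        \<open>co s v\<close>, which do not depend on \<open>U\<close>.\<close>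
      have projsum: "lc w (\<lambda>U. proj U v) J = \<zero>\<^bsub>M\<^esub>"
      proof (rule co_eq_zero)
        show "lc w (\<lambda>U. proj U v) J \<in> carrier M" using w(1) pc by (intro lc_closed) auto
        fix m assume m: "m \<in> I"
        have cv: "\<And>s. s \<in> S \<Longrightarrow> co s v \<in> carrier K" using assms(4) co_closed avl by blast
        have finS: "finite S" using assms(4) finite_I by (rule finite_subset)
        have "co m (lc w (\<lambda>U. proj U v) J) = (\<Oplus>\<^bsub>K\<^esub>U\<in>J. w U \<otimes>\<^bsub>K\<^esub> co m (proj U v))"
          using w(1) pc m assms(1) by (intro co_lc) auto
        also have "\<dots> = (\<Oplus>\<^bsub>K\<^esub>U\<in>J. \<Oplus>\<^bsub>K\<^esub>s\<in>S. co s v \<otimes>\<^bsub>K\<^esub> (w U \<otimes>\<^bsub>K\<^esub> co m (reduced U s)))"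
        proof (intro V.R.finsum_cong')
          fix U assume U: "U \<in> J"
          have "co m (proj U v) = (\<Oplus>\<^bsub>K\<^esub>s\<in>S. co s v \<otimes>\<^bsub>K\<^esub> co m (reduced U s))"
            using coordinatized_submodule.co_proj[OF sub[OF U] avl(3) m] assms(3)[OF U] by simp
          then have "w U \<otimes>\<^bsub>K\<^esub> co m (proj U v) = (\<Oplus>\<^bsub>K\<^esub>s\<in>S. w U \<otimes>\<^bsub>K\<^esub> (co s v \<otimes>\<^bsub>K\<^esub> co m (reduced U s)))"
            using finS wc[OF U] cv xc[OF U] m by (simp add: V.R.finsum_rdistr Pi_def)
          also have "\<dots> = (\<Oplus>\<^bsub>K\<^esub>s\<in>S. co s v \<otimes>\<^bsub>K\<^esub> (w U \<otimes>\<^bsub>K\<^esub> co m (reduced U s)))"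
            using wc[OF U] cv xc[OF U] m by (intro V.R.finsum_cong') (auto simp: V.R.m_lcomm)
          finally show "w U \<otimes>\<^bsub>K\<^esub> co m (proj U v) = (\<Oplus>\<^bsub>K\<^esub>s\<in>S. co s v \<otimes>\<^bsub>K\<^esub> (w U \<otimes>\<^bsub>K\<^esub> co m (reduced U s)))" .
        qed (use wc cv xc m in \<open>auto intro!: V.R.finsum_closed\<close>)
        also have "\<dots> = (\<Oplus>\<^bsub>K\<^esub>s\<in>S. \<Oplus>\<^bsub>K\<^esub>U\<in>J. co s v \<otimes>\<^bsub>K\<^esub> (w U \<otimes>\<^bsub>K\<^esub> co m (reduced U s)))"
          using assms(1) finS wc cv xc m by (intro V.R.finsum_swap) auto
        also have "\<dots> = (\<Oplus>\<^bsub>K\<^esub>s\<in>S. \<zero>\<^bsub>K\<^esub>)"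
        proof (intro V.R.finsum_cong')
          fix s assume s: "s \<in> S"
          have rc: "\<And>U. U \<in> J \<Longrightarrow> reduced U s \<in> carrier M"
            using coordinatized_submodule.reduced_carrier[OF sub] assms(3) s by blast
          have "(\<Oplus>\<^bsub>K\<^esub>U\<in>J. co s v \<otimes>\<^bsub>K\<^esub> (w U \<otimes>\<^bsub>K\<^esub> co m (reduced U s)))
              = co s v \<otimes>\<^bsub>K\<^esub> (\<Oplus>\<^bsub>K\<^esub>U\<in>J. w U \<otimes>\<^bsub>K\<^esub> co m (reduced U s))"
            using assms(1) wc cv[OF s] xc s m by (intro V.R.finsum_rdistr[symmetric]) auto
          also have "\<dots> = co s v \<otimes>\<^bsub>K\<^esub> co m (lc w (\<lambda>U. reduced U s) J)"
            using w(1) rc m assms(1) by (simp add: co_lc)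
          finally show "(\<Oplus>\<^bsub>K\<^esub>U\<in>J. co s v \<otimes>\<^bsub>K\<^esub> (w U \<otimes>\<^bsub>K\<^esub> co m (reduced U s))) = \<zero>\<^bsub>K\<^esub>"
            using red[OF s] cv[OF s] m by (simp add: co_zero)
        qed auto
        finally show "co m (lc w (\<lambda>U. proj U v) J) = \<zero>\<^bsub>K\<^esub>" by simp
      qed
      note L = linT[OF U' avl(2) q]
      have "(\<Oplus>\<^bsub>K\<^esub>U\<in>J. w U \<otimes>\<^bsub>K\<^esub> \<Phi> U' U r q) = co l (lc w (\<lambda>U. T U' a q (proj U v)) J)"
        using w(1) linD(1)[OF L] pc avl assms(1) by (simp add: \<Phi>_def co_lc)
      also have "lc w (\<lambda>U. T U' a q (proj U v)) J = T U' a q (lc w (\<lambda>U. proj U v) J)"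
        using w(1) pc assms(1) by (intro lin_lc[symmetric] L) auto
      \<comment> \<open>Zero is written as a multiple of zero, so that homogeneity gives the value
        of the linear map there.\<close>
      also have "\<dots> = T U' a q (\<zero>\<^bsub>K\<^esub> \<odot>\<^bsub>V\<^esub> \<zero>\<^bsub>M\<^esub>)"
        using V.lmult_0[of "\<zero>\<^bsub>M\<^esub>"] by (simp add: projsum)
      also have "\<dots> = \<zero>\<^bsub>K\<^esub> \<odot>\<^bsub>V\<^esub> T U' a q \<zero>\<^bsub>M\<^esub>"
        by (intro linD(3)[OF L]) auto
      also have "\<dots> = \<zero>\<^bsub>M\<^esub>"
        using V.lmult_0[of "T U' a q \<zero>\<^bsub>M\<^esub>"] linD(1)[OF L] by simp
      also have "co l \<zero>\<^bsub>M\<^esub> = \<zero>\<^bsub>K\<^esub>" using avl by (intro co_zero)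
      finally show "(\<Oplus>\<^bsub>K\<^esub>U\<in>J. w U \<otimes>\<^bsub>K\<^esub> \<Phi> U' U r q) = \<zero>\<^bsub>K\<^esub>" .
    qed
    show "\<exists>X\<in>?Q \<rightarrow> carrier K. (\<exists>q\<in>?Q. X q \<noteq> \<zero>\<^bsub>K\<^esub>) \<and>
        (\<forall>r\<in>carrier A \<times> carrier M \<times> I. (\<Oplus>\<^bsub>K\<^esub>q\<in>?Q. \<Phi> U' U r q \<otimes>\<^bsub>K\<^esub> X q) = \<zero>\<^bsub>K\<^esub>)"
      if UJ: "U \<in> J" "U' \<in> J" and ne: "U \<noteq> U'" for U U'
    proof -
      interpret U: coordinatized_submodule K A M I e co U by (rule sub[OF UJ(1)])
      interpret U': coordinatized_submodule K A M I e co U' by (rule sub[OF UJ(2)])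
      \<comment> \<open>With these coefficients \<open>h X\<close> is \<open>proj U\<close> minus
        \<open>proj U'\<close>. On \<open>U\<close> it is the quotient map modulo \<open>U'\<close>,
        since \<open>proj U\<close> fixes \<open>U\<close> and \<open>proj U'\<close> has its values
        in \<open>U'\<close>.\<close>
      define X where "X = (\<lambda>q. co (snd q) (reduced U (fst q)) \<ominus>\<^bsub>K\<^esub> co (snd q) (reduced U' (fst q)))"
      have X: "X \<in> ?Q \<rightarrow> carrier K"
        using x[OF UJ(1)] x[OF UJ(2)] unfolding X_def x_def by (intro Pi_I V.R.minus_closed) auto
      have hX: "h X y = proj U y \<ominus>\<^bsub>M\<^esub> proj U' y" if "y \<in> carrier M" for y
        unfolding h_def X_def
        by (rule lc_cell_map_eq_diff_proj[OF assms(2)[OF UJ(1)] assms(2)[OF UJ(2)]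
          assms(3)[OF UJ(1)] assms(3)[OF UJ(2)] that])
      have "\<exists>q\<in>?Q. X q \<noteq> \<zero>\<^bsub>K\<^esub>"
      proof (rule ccontr)
        assume "\<not> ?thesis"
        then have X0: "\<And>q. q \<in> ?Q \<Longrightarrow> X q = \<zero>\<^bsub>K\<^esub>" by blast
        have h0: "h X y = \<zero>\<^bsub>M\<^esub>" if y: "y \<in> carrier M" for y
        proof -
          have "h X y = (\<Oplus>\<^bsub>V\<^esub>q\<in>?Q. \<zero>\<^bsub>V\<^esub>)"
            unfolding h_def lc_def using X0 V.lmult_0 cell_map_closed[OF Q(1,2) y]
            by (intro V.M.finsum_cong') auto
          then show ?thesis by simp
        qed
        have pp: "proj U y = proj U' y" if "y \<in> carrier M" for y
        proof -
          have "proj U y \<ominus>\<^bsub>M\<^esub> proj U' y = \<zero>\<^bsub>M\<^esub>" using hX[OF that] h0[OF that] by simp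
          then show ?thesis using U.proj_carrier[OF that] U'.proj_carrier[OF that] by simp
        qed
        have "U = U'"
        proof (intro equalityI subsetI)
          fix u assume u: "u \<in> U"
          then have "u = proj U' u" using U.proj_eq[OF u] pp[OF U.U_carrier[OF u]] by simp
          then show "u \<in> U'" using U'.proj_in[OF U.U_carrier[OF u]] by simp
        next
          fix u assume u: "u \<in> U'"
          then have "u = proj U u" using U'.proj_eq[OF u] pp[OF U'.U_carrier[OF u]] by simp
          then show "u \<in> U" using U.proj_in[OF U'.U_carrier[OF u]] by simp
        qed
        then show False using ne by simp
      qed
      moreover have "(\<Oplus>\<^bsub>K\<^esub>q\<in>?Q. \<Phi> U' U r q \<otimes>\<^bsub>K\<^esub> X q) = \<zero>\<^bsub>K\<^esub>"
        if r: "r \<in> carrier A \<times> carrier M \<times> I" for r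
      proof -
        obtain a v l where avl: "r = (a, v, l)" "a \<in> carrier A" "v \<in> carrier M" "l \<in> I" using r by auto
        define u where "u = proj U v"
        have u: "u \<in> U" "a \<odot>\<^bsub>M\<^esub> u \<in> U" "u \<in> carrier M" "a \<odot>\<^bsub>M\<^esub> u \<in> carrier M"
          using U.proj_in[OF avl(3)] U.U_closed(6) avl(2) U.U_carrier by (auto simp: u_def)
        define z where "z = h X (a \<odot>\<^bsub>M\<^esub> u) \<ominus>\<^bsub>M\<^esub> a \<odot>\<^bsub>M\<^esub> h X u"
        have p: "proj U' u \<in> U'" "proj U' (a \<odot>\<^bsub>M\<^esub> u) \<in> U'" using U'.proj_in u by auto
        have pc: "proj U' u \<in> carrier M" "proj U' (a \<odot>\<^bsub>M\<^esub> u) \<in> carrier M" "a \<odot>\<^bsub>M\<^esub> proj U' u \<in> carrier M"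
          using p U'.U_carrier Mod.right_smult_closed avl(2) by auto
        have "a \<odot>\<^bsub>M\<^esub> (u \<ominus>\<^bsub>M\<^esub> proj U' u) = a \<odot>\<^bsub>M\<^esub> u \<ominus>\<^bsub>M\<^esub> a \<odot>\<^bsub>M\<^esub> proj U' u"
          using u pc by (intro lin_minus lin_action avl(2))
        then have "z = (a \<odot>\<^bsub>M\<^esub> u \<ominus>\<^bsub>M\<^esub> proj U' (a \<odot>\<^bsub>M\<^esub> u)) \<ominus>\<^bsub>M\<^esub> (a \<odot>\<^bsub>M\<^esub> u \<ominus>\<^bsub>M\<^esub> a \<odot>\<^bsub>M\<^esub> proj U' u)"
          unfolding z_def using u hX U.proj_eq by simp
        \<comment> \<open>The images of \<open>u\<close> under \<open>a\<close> cancel, and a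
          difference of elements of \<open>U'\<close> remains.\<close>
        also have "\<dots> = a \<odot>\<^bsub>M\<^esub> proj U' u \<ominus>\<^bsub>M\<^esub> proj U' (a \<odot>\<^bsub>M\<^esub> u)"
          using u pc by (intro diff_diff)
        finally have "z \<in> U'"
          using p U'.U_closed(5,6) avl(2) by simp
        then have "z \<ominus>\<^bsub>M\<^esub> proj U' z = \<zero>\<^bsub>M\<^esub>" using U'.proj_split U'.U_carrier by blast
        then show ?thesis
          using sum_\<Phi>[OF UJ X avl(2-4)] avl(4) unfolding avl(1) Let_def u_def[symmetric] z_def[symmetric]
          by (simp add: co_zero)
      qed
      ultimately show ?thesis using X by blast
    qed
    show "X q = \<zero>\<^bsub>K\<^esub>"
      if U: "U \<in> J" and X: "X \<in> ?Q \<rightarrow> carrier K"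
        and zero: "\<And>r. r \<in> carrier A \<times> carrier M \<times> I \<Longrightarrow> (\<Oplus>\<^bsub>K\<^esub>q\<in>?Q. \<Phi> U U r q \<otimes>\<^bsub>K\<^esub> X q) = \<zero>\<^bsub>K\<^esub>"
        and q: "q \<in> ?Q" for U X q
    proof -
      interpret U: coordinatized_submodule K A M I e co U by (rule sub[OF U])
      have pU: "pivots U = S" using assms(3) U by blast
      \<comment> \<open>The rows \<open>(a, u, l)\<close> express this, because
        \<open>proj U u = u\<close>.\<close>
      have dev: "h X (a \<odot>\<^bsub>M\<^esub> u) \<ominus>\<^bsub>M\<^esub> a \<odot>\<^bsub>M\<^esub> h X u \<in> U" (is "?z \<in> U") if a: "a \<in> carrier A" and u: "u \<in> U" for a u
      proof -
        have uc: "u \<in> carrier M" "a \<odot>\<^bsub>M\<^esub> u \<in> carrier M" using u a U.U_carrier U.U_closed(6) by auto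
        have zc: "?z \<in> carrier M" using hc[OF X] uc a Mod.right_smult_closed by simp
        have "?z \<ominus>\<^bsub>M\<^esub> proj U ?z = \<zero>\<^bsub>M\<^esub>"
        proof (rule co_eq_zero)
          show "?z \<ominus>\<^bsub>M\<^esub> proj U ?z \<in> carrier M" using zc U.proj_carrier by simp
          fix l assume l: "l \<in> I"
          then have "(\<Oplus>\<^bsub>K\<^esub>q\<in>?Q. \<Phi> U U (a, u, l) q \<otimes>\<^bsub>K\<^esub> X q) = \<zero>\<^bsub>K\<^esub>" using a uc by (intro zero) auto
          then show "co l (?z \<ominus>\<^bsub>M\<^esub> proj U ?z) = \<zero>\<^bsub>K\<^esub>"
            using sum_\<Phi>[OF U U X a uc(1) l] unfolding Let_def U.proj_eq[OF u] by simp
        qed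
        then show ?thesis using U.proj_split[OF zc] by simp
      qed
      have fs: "fst q \<in> S" "snd q \<in> I - S" "snd q < fst q" using Q q by auto
      let ?u = "reduced U (fst q)"
      have u: "?u \<in> U" using U.reduced(1) fs pU by blast
      have uc: "?u \<in> carrier M" using u by (rule U.U_carrier)
      \<comment> \<open>Rigidity makes \<open>h X\<close> map \<open>U\<close> to itself. As its
        values also vanish at all pivots, it is zero on the reduced vector.\<close>
      have "h X ?u \<in> U"
        using assms(2)[OF U] by (intro U.deformation_trivial[OF _ lin_h[OF X] dev u]) (simp add: rigid_def)
      then have "h X ?u = \<zero>\<^bsub>M\<^esub>"
      proof (rule U.pivots_separate)
        show "co s (h X ?u) = \<zero>\<^bsub>K\<^esub>" if "s \<in> pivots U" for s
          unfolding h_def using that pU by (intro co_lc_cell_map_pivot assms(4) X uc) simp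
      qed
      then have "\<zero>\<^bsub>K\<^esub> = co (snd q) (h X ?u)" using fs by (simp add: co_zero)
      also have "\<dots> = (\<Oplus>\<^bsub>K\<^esub>s\<in>{s \<in> S. snd q < s}. X (s, snd q) \<otimes>\<^bsub>K\<^esub> co s ?u)"
        unfolding h_def by (rule co_lc_cell_map_nonpivot[OF assms(4) X uc fs(2)])
      \<comment> \<open>The reduced vector has a one at its own pivot and zeros at the others, which
        isolates the coefficient of \<open>q\<close>.\<close>
      also have "\<dots> = (\<Oplus>\<^bsub>K\<^esub>s\<in>{s \<in> S. snd q < s}. if fst q = s then X (s, snd q) else \<zero>\<^bsub>K\<^esub>)"
      proof (intro V.R.finsum_cong')
        fix s assume s: "s \<in> {s \<in> S. snd q < s}"
        then have "(s, snd q) \<in> ?Q" using fs by (auto simp: echelon_cells_def)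
        then have "X (s, snd q) \<in> carrier K" using X by auto
        then show "X (s, snd q) \<otimes>\<^bsub>K\<^esub> co s ?u = (if fst q = s then X (s, snd q) else \<zero>\<^bsub>K\<^esub>)"
          using U.reduced(3)[of "fst q" s] fs s pU by auto
      qed (use X fs in \<open>auto simp: echelon_cells_def Pi_iff\<close>)
      also have "\<dots> = X (fst q, snd q)"
        using fs X finite_subset[OF assms(4) finite_I]
        by (intro V.R.finsum_singleton[of "fst q" _ "\<lambda>s. X (s, snd q)"]) (auto simp: echelon_cells_def Pi_iff)
      finally show ?thesis by simp
    qed
  qed
qed

text \<open>A bound that holds for all finite subsets forces finiteness, even when the field is
  infinite.\<close>

lemma finite_rigid:
  assumes "S \<subseteq> I"
  shows "finite {U. rigid A M U \<and> pivots U = S} \<and>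
    card {U. rigid A M U \<and> pivots U = S} \<le> 4 ^ card (echelon_cells I S)"
proof (rule finite_if_finite_subsets_card_bdd)
  fix G assume "G \<subseteq> {U. rigid A M U \<and> pivots U = S}" "finite G"
  then show "card G \<le> 4 ^ card (echelon_cells I S)"
    using assms by (intro card_rigid_le) auto
qed

end

section \<open>Counting brick chain filtrations\<close>

lemma (in vectorspace) coordinates_exist:
  assumes "fin_dim"
  obtains e :: "nat \<Rightarrow> 'c" and co :: "nat \<Rightarrow> 'c \<Rightarrow> 'a" where
    "\<And>l. l < dim \<Longrightarrow> e l \<in> carrier V"
    "\<And>l x. l < dim \<Longrightarrow> x \<in> carrier V \<Longrightarrow> co l x \<in> carrier K"
    "\<And>l x y. l < dim \<Longrightarrow> x \<in> carrier V \<Longrightarrow> y \<in> carrier V \<Longrightarrow> co l (x \<oplus>\<^bsub>V\<^esub> y) = co l x \<oplus>\<^bsub>K\<^esub> co l y"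
    "\<And>l c x. l < dim \<Longrightarrow> c \<in> carrier K \<Longrightarrow> x \<in> carrier V \<Longrightarrow> co l (c \<odot>\<^bsub>V\<^esub> x) = c \<otimes>\<^bsub>K\<^esub> co l x"
    "\<And>l l'. l < dim \<Longrightarrow> l' < dim \<Longrightarrow> co l (e l') = (if l = l' then \<one>\<^bsub>K\<^esub> else \<zero>\<^bsub>K\<^esub>)"
    "\<And>x. x \<in> carrier V \<Longrightarrow> (\<And>l. l < dim \<Longrightarrow> co l x = \<zero>\<^bsub>K\<^esub>) \<Longrightarrow> x = \<zero>\<^bsub>V\<^esub>"
proof -
  obtain B where B: "finite B" "basis B" using finite_basis_exists[OF assms] by blast
  have BV: "B \<subseteq> carrier V" using B(2) by (simp add: basis_def)
  have d: "dim = card B" by (rule dim_basis[OF B])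
  obtain e where e: "bij_betw e {0..<card B} B" using ex_bij_betw_nat_finite[OF B(1)] by blast
  have eB: "e l \<in> B" if "l < dim" for l using e that d by (auto simp: bij_betw_def)
  define P where "P v a \<longleftrightarrow> a \<in> B \<rightarrow>\<^sub>E carrier K \<and> lincomb a B = v" for v a
  define cf where "cf v = (THE a. P v a)" for v
  have ex1: "\<exists>!a. P v a" if "v \<in> carrier V" for v
    using basis_criterion[OF B(1) BV] B(2) that unfolding P_def by blast
  have cf: "cf v \<in> B \<rightarrow> carrier K" "lincomb (cf v) B = v" if "v \<in> carrier V" for v
    using theI'[OF ex1[OF that]] by (auto simp: cf_def P_def)
  \<comment> \<open>\<open>cf v\<close> is unique among extensional coefficient functions, so any
    other one is first restricted to \<open>B\<close>.\<close>
  have cf_eq: "cf v b = a b" if "a \<in> B \<rightarrow> carrier K" "lincomb a B = v" "b \<in> B" for v a b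
  proof -
    have v: "v \<in> carrier V" using that(1,2) BV by (auto intro!: lincomb_closed)
    have "lincomb (restrict a B) B = lincomb a B"
      using that(1) BV by (intro lincomb_cong) auto
    then have "P v (restrict a B)" using that by (auto simp: P_def)
    then have "cf v = restrict a B"
      using ex1[OF v] unfolding cf_def by (intro the1_equality)
    then show ?thesis using that(3) by simp
  qed
  define co where "co l v = cf v (e l)" for l v
  show ?thesis
  proof (rule that[of e co])
    show "l < dim \<Longrightarrow> e l \<in> carrier V" for l using eB BV by blast
    show "l < dim \<Longrightarrow> x \<in> carrier V \<Longrightarrow> co l x \<in> carrier K" for l x
      using cf(1)[of x] eB by (auto simp: co_def)
    show "co l (x \<oplus>\<^bsub>V\<^esub> y) = co l x \<oplus>\<^bsub>K\<^esub> co l y"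
      if l: "l < dim" and x: "x \<in> carrier V" and y: "y \<in> carrier V" for l x y
    proof -
      have "lincomb (\<lambda>b. cf x b \<oplus>\<^bsub>K\<^esub> cf y b) B = x \<oplus>\<^bsub>V\<^esub> y"
        using lincomb_sum[OF B(1) BV cf(1)[OF x] cf(1)[OF y]] cf(2)[OF x] cf(2)[OF y] by simp
      then show ?thesis
        using cf(1)[OF x] cf(1)[OF y] eB[OF l] unfolding co_def by (intro cf_eq) auto
    qed
    show "co l (c \<odot>\<^bsub>V\<^esub> x) = c \<otimes>\<^bsub>K\<^esub> co l x"
      if l: "l < dim" and c: "c \<in> carrier K" and x: "x \<in> carrier V" for l c x
    proof -
      have "lincomb (\<lambda>b. c \<otimes>\<^bsub>K\<^esub> cf x b) B = c \<odot>\<^bsub>V\<^esub> x"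
        using lincomb_smult[OF BV cf(1)[OF x] c] cf(2)[OF x] by simp
      then show ?thesis
        using cf(1)[OF x] eB[OF l] c unfolding co_def by (intro cf_eq) auto
    qed
    show "co l (e l') = (if l = l' then \<one>\<^bsub>K\<^esub> else \<zero>\<^bsub>K\<^esub>)" if l: "l < dim" "l' < dim" for l l'
    proof -
      let ?a = "\<lambda>b. if b = e l' then \<one>\<^bsub>K\<^esub> else \<zero>\<^bsub>K\<^esub>"
      have "lincomb ?a B = (\<Oplus>\<^bsub>V\<^esub>b\<in>B. if e l' = b then b else \<zero>\<^bsub>V\<^esub>)"
        unfolding lincomb_def using BV by (intro M.finsum_cong') (auto simp: subset_iff)
      also have "\<dots> = e l'"
        using eB[OF l(2)] B(1) BV by (intro M.finsum_singleton) auto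
      finally have "cf (e l') (e l) = ?a (e l)" using eB[OF l(1)] by (intro cf_eq) auto
      moreover have "e l = e l' \<longleftrightarrow> l = l'"
        using e l d by (auto simp: bij_betw_def dest: inj_onD)
      ultimately show ?thesis by (simp add: co_def)
    qed
    show "x = \<zero>\<^bsub>V\<^esub>" if x: "x \<in> carrier V" and z: "\<And>l. l < dim \<Longrightarrow> co l x = \<zero>\<^bsub>K\<^esub>" for x
    proof -
      have "cf x b = \<zero>\<^bsub>K\<^esub>" if "b \<in> B" for b
      proof -
        have "b \<in> e ` {0..<card B}" using e that by (simp add: bij_betw_def)
        then obtain l where "l < dim" "b = e l" using d by auto
        then show ?thesis using z by (simp add: co_def)
      qed
      then have "(\<Oplus>\<^bsub>V\<^esub>b\<in>B. cf x b \<odot>\<^bsub>V\<^esub> b) = (\<Oplus>\<^bsub>V\<^esub>b\<in>B. \<zero>\<^bsub>V\<^esub>)"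
        using BV by (intro M.finsum_cong') (auto simp: subset_iff)
      then show ?thesis using cf(2)[OF x] by (simp add: lincomb_def)
    qed
  qed
qed

text \<open>The empty chain, t = 0, is a list with one member; the zero module leaves no room for a
  strict inclusion of submodules.\<close>

lemma brick_chain_filtrations_zero_module:
  assumes "carrier M = {\<zero>\<^bsub>M\<^esub>}"
  shows "brick_chain_filtrations TYPE('b) K A M \<subseteq> {[carrier M]}"
proof
  fix Ms assume "Ms \<in> brick_chain_filtrations TYPE('b) K A M"
  then have "brick_chain_filtration TYPE('b) K A M Ms" by (simp add: brick_chain_filtrations_def)
  note bcf = this[unfolded brick_chain_filtration_def]
  have Ms: "Ms \<noteq> []" "last Ms = carrier M" "\<And>N. N \<in> set Ms \<Longrightarrow> Module.submodule N A M"
    "\<And>i. Suc i < length Ms \<Longrightarrow> Ms ! i \<subset> Ms ! Suc i"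
    using bcf by simp_all
  have sub: "N \<subseteq> carrier M \<and> N \<noteq> {}" if "N \<in> set Ms" for N
    using Ms(3)[OF that] by (auto simp: Module.submodule_def subgroup_def)
  have "length Ms < 2"
  proof (rule ccontr)
    assume "\<not> length Ms < 2"
    then have len: "Suc 0 < length Ms" by simp
    then have "Ms ! 0 \<in> set Ms" "Ms ! Suc 0 \<in> set Ms" using Ms(1) by simp_all
    then have "Ms ! 0 \<subset> Ms ! Suc 0" "Ms ! Suc 0 \<subseteq> carrier M" "Ms ! 0 \<noteq> {}"
      using Ms(4)[OF len] sub by blast+
    then show False using assms by auto
  qed
  then have "length Ms = 1" using Ms(1) by (cases Ms) auto
  then obtain N where "Ms = [N]" by (auto simp: length_Suc_conv)
  then show "Ms \<in> {[carrier M]}" using Ms(2) by simp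
qed

text \<open>A chain is determined by its penultimate member \<open>U\<close> and its truncation,
  which is a chain of \<open>U\<close>. The union over \<open>U\<close> is organized by the pivot
  set, whose size is the dimension of \<open>U\<close>.\<close>

lemma card_brick_chain_filtrations_le:
  fixes M :: "('a, 'm) module"
  assumes "coordinatized_module K A M I e co"
  shows "finite (brick_chain_filtrations TYPE('b) K A M)
    \<and> card (brick_chain_filtrations TYPE('b) K A M) \<le> 2 ^ ((card I)\<^sup>2)"
  using assms
proof (induction "card I" arbitrary: M I e co rule: less_induct)
  case less
  interpret coordinatized_module K A M I e co by fact
  let ?F = "\<lambda>M. brick_chain_filtrations TYPE('b) K A M"
  show ?case
  proof (cases "carrier M = {\<zero>\<^bsub>M\<^esub>}")
    case True
    have sub: "?F M \<subseteq> {[carrier M]}" by (rule brick_chain_filtrations_zero_module[OF True])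
    have "card (?F M) \<le> card {[carrier M]}" by (rule card_mono[OF _ sub]) simp
    also have "\<dots> \<le> 2 ^ ((card I)\<^sup>2)" by simp
    finally show ?thesis using finite_subset[OF sub] by simp
  next
    case False
    define R where "R S = {U. rigid A M U \<and> pivots U = S}" for S
    define G where "G U = (\<lambda>Ms. Ms @ [carrier M]) ` ?F (M\<lparr>carrier := U\<rparr>)" for U
    have R: "finite (R S)" "card (R S) \<le> 4 ^ card (echelon_cells I S)" if "S \<in> Pow I - {I}" for S
      using finite_rigid[of S] that by (auto simp: R_def)
    have G: "finite (G U)" "card (G U) \<le> 2 ^ ((card S)\<^sup>2)" if S: "S \<in> Pow I - {I}" and U: "U \<in> R S" for S U
    proof -
      interpret U: coordinatized_submodule K A M I e co U
        using U by (intro rigid_coordinatized) (simp add: R_def)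
      have "S = pivots U" using U by (simp add: R_def)
      moreover have "card S < card I" using S finite_I by (intro psubset_card_mono) auto
      ultimately have IH: "finite (?F (M\<lparr>carrier := U\<rparr>))" "card (?F (M\<lparr>carrier := U\<rparr>)) \<le> 2 ^ ((card S)\<^sup>2)"
        using less.hyps[OF _ U.coordinatized_restrict] by auto
      then show "finite (G U)" "card (G U) \<le> 2 ^ ((card S)\<^sup>2)"
        using card_image_le[OF IH(1), of "\<lambda>Ms. Ms @ [carrier M]"] by (auto simp: G_def)
    qed
    \<comment> \<open>Only an inclusion: adding \<open>M\<close> on top of a chain of a rigid
      \<open>U\<close> need not give a brick chain filtration.\<close>
    have sub: "?F M \<subseteq> (\<Union>S\<in>Pow I - {I}. \<Union>U\<in>R S. G U)"
    proof
      fix Ms assume "Ms \<in> ?F M"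
      then have "brick_chain_filtration TYPE('b) K A M Ms" by (simp add: brick_chain_filtrations_def)
      from brick_chain_filtration_penultimate[OF right_module this False]
      obtain U Ms' where U: "Ms = Ms' @ [carrier M]" "rigid A M U" "U \<noteq> carrier M"
        "brick_chain_filtration TYPE('b) K A (M\<lparr>carrier := U\<rparr>) Ms'" by blast
      interpret U: coordinatized_submodule K A M I e co U
        using U(2) by (rule rigid_coordinatized)
      \<comment> \<open>The pivot set \<open>I\<close> is excluded by
        \<open>U \<noteq> carrier M\<close>, so the induction descends.\<close>
      have "pivots U \<in> Pow I - {I}" using pivots_subset(1)[of U] U.pivots_eq_I U(3) by auto
      moreover have "U \<in> R (pivots U)" using U(2) by (simp add: R_def)
      moreover have "Ms \<in> G U" using U(1,4) by (auto simp: G_def brick_chain_filtrations_def)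
      ultimately show "Ms \<in> (\<Union>S\<in>Pow I - {I}. \<Union>U\<in>R S. G U)" by blast
    qed
    have fin: "finite (\<Union>S\<in>Pow I - {I}. \<Union>U\<in>R S. G U)"
      using finite_I R(1) G(1) by (intro finite_UN_I finite_Diff) auto
    have "card (?F M) \<le> card (\<Union>S\<in>Pow I - {I}. \<Union>U\<in>R S. G U)"
      by (rule card_mono[OF fin sub])
    also have "\<dots> \<le> (\<Sum>S\<in>Pow I - {I}. card (\<Union>U\<in>R S. G U))"
      using finite_I by (intro card_UN_le) simp
    also have "\<dots> \<le> (\<Sum>S\<in>Pow I - {I}. 4 ^ card (echelon_cells I S) * 2 ^ ((card S)\<^sup>2))"
    proof (rule sum_mono)
      fix S assume S: "S \<in> Pow I - {I}"
      have "card (\<Union>U\<in>R S. G U) \<le> (\<Sum>U\<in>R S. card (G U))"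
        using R(1)[OF S] by (rule card_UN_le)
      also have "\<dots> \<le> (\<Sum>U\<in>R S. 2 ^ ((card S)\<^sup>2))" using G(2)[OF S] by (rule sum_mono)
      also have "\<dots> \<le> 4 ^ card (echelon_cells I S) * 2 ^ ((card S)\<^sup>2)" using R(2)[OF S] by simp
      finally show "card (\<Union>U\<in>R S. G U) \<le> 4 ^ card (echelon_cells I S) * 2 ^ ((card S)\<^sup>2)" .
    qed
    also have "\<dots> \<le> 2 ^ ((card I)\<^sup>2)" by (rule sum_four_power_cells_le[OF finite_I])
    finally show ?thesis using finite_subset[OF sub fin] by simp
  qed
qed

text \<open>Finiteness is stated as well, because \<open>card\<close> is zero on infinite sets and
  the bound alone would not exclude them.\<close>

theorem theoremA:
  fixes K :: "('k, 'p) ring_scheme"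
    and A :: "('k, 'a, 'q) module_scheme"
    and M :: "('a, 'm) module"
  assumes "fin_dim_algebra K A"
    and "fin_dim_right_module K A M"
  shows "finite (brick_chain_filtrations TYPE('b) K A M)
    \<and> num_brick_chain_filtrations TYPE('b) K A M \<le> 2 ^ ((module_dim K A M)\<^sup>2)"
proof -
  have alg: "algebra_over_field K A" using assms(1) by (simp add: fin_dim_algebra_def)
  have rm: "right_module A M" and fd: "vectorspace.fin_dim K (underlying_space K A M)"
    using assms(2) by (simp_all add: fin_dim_right_module_def)
  interpret V: vectorspace K "underlying_space K A M"
    by (rule vectorspace_underlying_space[OF alg rm])
  obtain e co where "coordinatized_module K A M {..<V.dim} e co"
  proof (rule V.coordinates_exist[OF fd], goal_cases)
    case (1 e co)
    then have "coordinatized_module K A M {..<V.dim} e co"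
      using alg rm by (intro coordinatized_module.intro) simp_all
    then show ?case by (rule 1(1))
  qed
  from card_brick_chain_filtrations_le[OF this, where 'b = 'b] show ?thesis
    by (simp add: num_brick_chain_filtrations_def module_dim_def)
qed

end
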